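(* Let $G$ and $H$ be snarks with Hists $T_G$ and $T_H$ respectively. Then: (1) there is a snark $G'$ with a Hist $T'$ such that $oc(G',T')=oc(G,T_G)\cup oc(H,T_H)$ (multiset union); (2) if $k\in oc(G,T_G)$ and $l\in oc(H,T_H)$, then there is a snark $\hat G$ with a Hist $\hat T$ such that $oc(\hat G,\hat T)$ is the multiset obtained from $oc(G,T_G)\cup oc(H,T_H)$ by removing one copy of $k$ and one copy of $l$ and adding one copy of $k+l-1$.
   Context: A snark is a cyclically $4$-edge-connected cubic (3-regular) graph of girth at least $5$ that admits no proper $3$-edge-colouring. A Hist of a cubic graph $G$ is a spanning tree $T$ of $G$ with no vertex of degree two (so every vertex of $T$ has degree $1$ or $3$). Given a Hist $T$ of a cubic graph $G$, the edges of $G$ not in $T$ form vertex-disjoint cycles whose vertices are exactly the leaves of $T$; these are the outer cycles of $(G,T)$. If $C_1,\dots,C_k$ are all outer cycles, $oc(G,T)$ denotes the multiset $\{|V(C_1)|,\dots,|V(C_k)|\}$ of their lengths. *)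

theory Defs
  imports Main "HOL-Library.Multiset"
begin

definition simple_graph :: "'a set \<Rightarrow> 'a set set \<Rightarrow> bool" where
  "simple_graph V E \<longleftrightarrow> finite V \<and>
     (\<forall>e\<in>E. \<exists>u v. e = {u, v} \<and> u \<noteq> v \<and> u \<in> V \<and> v \<in> V)"

definition deg :: "'a set set \<Rightarrow> 'a \<Rightarrow> nat" where
  "deg F v = card {e \<in> F. v \<in> e}"

definition cubic :: "'a set \<Rightarrow> 'a set set \<Rightarrow> bool" where
  "cubic V E \<longleftrightarrow> simple_graph V E \<and> (\<forall>v\<in>V. deg E v = 3)"

definition cycle_in :: "'a set set \<Rightarrow> 'a list \<Rightarrow> bool" where
  "cycle_in F vs \<longleftrightarrow> length vs \<ge> 3 \<and> distinct vs \<and>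
     (\<forall>i < length vs. {vs ! i, vs ! ((i + 1) mod length vs)} \<in> F)"

definition girth_ge :: "'a set set \<Rightarrow> nat \<Rightarrow> bool" where
  "girth_ge E g \<longleftrightarrow> (\<forall>vs. cycle_in E vs \<longrightarrow> length vs \<ge> g)"

definition cut_edges :: "'a set set \<Rightarrow> 'a set \<Rightarrow> 'a set set" where
  "cut_edges E S = {e \<in> E. e \<inter> S \<noteq> {} \<and> e - S \<noteq> {}}"

definition cyc_4_edge_connected :: "'a set \<Rightarrow> 'a set set \<Rightarrow> bool" where
  "cyc_4_edge_connected V E \<longleftrightarrow>
     (\<forall>S \<subseteq> V. (\<exists>vs. cycle_in E vs \<and> set vs \<subseteq> S) \<and>
               (\<exists>vs. cycle_in E vs \<and> set vs \<subseteq> V - S)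
               \<longrightarrow> card (cut_edges E S) \<ge> 4)"

definition three_edge_colourable :: "'a set set \<Rightarrow> bool" where
  "three_edge_colourable E \<longleftrightarrow>
     (\<exists>c :: 'a set \<Rightarrow> nat. (\<forall>e\<in>E. c e < 3) \<and>
        (\<forall>e\<in>E. \<forall>f\<in>E. e \<noteq> f \<and> e \<inter> f \<noteq> {} \<longrightarrow> c e \<noteq> c f))"

definition snark :: "'a set \<Rightarrow> 'a set set \<Rightarrow> bool" where
  "snark V E \<longleftrightarrow> cubic V E \<and> cyc_4_edge_connected V E \<and> girth_ge E 5 \<and>
     \<not> three_edge_colourable E"

definition adj :: "'a set set \<Rightarrow> 'a \<Rightarrow> 'a \<Rightarrow> bool" where
  "adj F u v \<longleftrightarrow> {u, v} \<in> F"

definition spanning_tree :: "'a set \<Rightarrow> 'a set set \<Rightarrow> 'a set set \<Rightarrow> bool" where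
  "spanning_tree V E T \<longleftrightarrow> T \<subseteq> E \<and>
     (\<forall>u\<in>V. \<forall>v\<in>V. (adj T)\<^sup>*\<^sup>* u v) \<and> \<not> (\<exists>vs. cycle_in T vs)"

text \<open>A Hist: spanning tree without vertices of degree 2.\<close>
definition hist :: "'a set \<Rightarrow> 'a set set \<Rightarrow> 'a set set \<Rightarrow> bool" where
  "hist V E T \<longleftrightarrow> spanning_tree V E T \<and> (\<forall>v\<in>V. deg T v = 1 \<or> deg T v = 3)"

definition leaves :: "'a set \<Rightarrow> 'a set set \<Rightarrow> 'a set" where
  "leaves V T = {v \<in> V. deg T v = 1}"

definition outer_cycles :: "'a set \<Rightarrow> 'a set set \<Rightarrow> 'a set set \<Rightarrow> 'a set set" where
  "outer_cycles V E T =
     {{w \<in> leaves V T. (adj (E - T))\<^sup>*\<^sup>* v w} | v. v \<in> leaves V T}"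

definition oc :: "'a set \<Rightarrow> 'a set set \<Rightarrow> 'a set set \<Rightarrow> nat multiset" where
  "oc V E T = image_mset card (mset_set (outer_cycles V E T))"

end

theory Submission
  imports Defs
begin

text \<open>
  Both parts use Isaacs' dot product with expanded vertices. From \<open>H\<close> remove two vertices \<open>x\<close>, \<open>y\<close>
  adjacent in \<open>T\<^sub>H\<close>; by parity, a colouring of the rest gives equal colours to the two edges dangling
  at the neighbours of \<open>x\<close>, and likewise for \<open>y\<close>. In \<open>G\<close>, such a pair of equal colours can be absorbed
  either by cutting an edge, or by subdividing two edges at a common vertex \<open>v\<close> and attaching one
  dangling edge to each subdivision vertex; in both cases a colouring of \<open>G\<close> would result.

  For (1), \<open>x\<close> and \<open>y\<close> are inner vertices of \<open>T\<^sub>H\<close> and two inner vertices of \<open>T\<^sub>G\<close> are treated in the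
  second way, with all subdivided edges in \<open>T\<^sub>G\<close>; all four connecting edges join the tree.
  For (2), \<open>x\<close> is a leaf on the outer cycle of length \<open>l\<close> and \<open>y\<close> its parent. The pair at \<open>x\<close> is joined to a cut
  edge of the outer cycle of length \<open>k\<close>, which merges the two cycles and loses \<open>x\<close>, and the pair at \<open>y\<close>
  to subdivided tree edges.

  Cyclic 4-edge-connectivity of a cubic graph means that every cut with at least two vertices on each
  side has at least four edges, since a forest in a cubic graph has a large boundary.
\<close>

section \<open>Degrees and edge cuts\<close>

text \<open>Isaacs' plain dot product cuts two edges of \<open>G\<close>. A cut tree edge would tear
  the Hist apart, and a cut edge outside it changes an outer cycle, which is wanted only in (2). A
  subdivided tree edge does neither: the subdivided tree stays connected, its new vertices reach
  degree 3 through the connecting edges, and the edges outside it are untouched. On the other side,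
  \<open>TH\<close> without two adjacent vertices falls into as many subtrees as these had other
  tree neighbours: four for two inner vertices, two for a leaf and its parent. Each subtree receives
  one connecting edge, so the result is again a tree. Two adjacent inner vertices exist because
  otherwise the tree would be a single edge or a star with three leaves, which a cubic graph of
  girth 5 excludes.

  Trees are recognised as connected graphs with one edge fewer than vertices, so no cycle is traced
  through a glued tree. Outer cycles are handled only as connected components of the edges outside
  the tree; that such a component survives the loss of \<open>x\<close> is a parity argument on
  degrees.\<close>

abbreviation inc :: "'a set set \<Rightarrow> 'a \<Rightarrow> 'a set set" where
  "inc F v \<equiv> {e \<in> F. v \<in> e}"

lemma simple_graph_finite: "simple_graph V E \<Longrightarrow> finite E"
  unfolding simple_graph_def by (rule finite_subset[of _ "Pow V"]) auto

lemma simple_graph_edge: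
  assumes "simple_graph V E" "{u, w} \<in> E"
  shows "u \<noteq> w" "u \<in> V" "w \<in> V"
  using assms unfolding simple_graph_def by (metis doubleton_eq_iff insert_absorb2)+

lemma simple_graph_edgeE:
  assumes "simple_graph V E" "e \<in> E"
  obtains u w where "e = {u, w}" "u \<noteq> w" "u \<in> V" "w \<in> V"
  using assms unfolding simple_graph_def by blast

lemma simple_graph_subset: "simple_graph V E \<Longrightarrow> F \<subseteq> E \<Longrightarrow> simple_graph V F"
  unfolding simple_graph_def by blast

lemma simple_graph_notin: "simple_graph V E \<Longrightarrow> p \<notin> V \<Longrightarrow> e \<in> E \<Longrightarrow> p \<notin> e"
  unfolding simple_graph_def by fastforce

lemma deg_insert:
  assumes "finite E" "e \<notin> E"
  shows "deg (insert e E) z = deg E z + of_bool (z \<in> e)"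
proof -
  have "inc (insert e E) z = (if z \<in> e then insert e (inc E z) else inc E z)" by auto
  then show ?thesis using assms by (simp add: deg_def)
qed

lemma deg_remove:
  assumes "finite E" "e \<in> E"
  shows "deg (E - {e}) z + of_bool (z \<in> e) = deg E z"
  using deg_insert[of "E - {e}" e z] assms by (simp add: insert_absorb)

lemma deg_Un:
  assumes "finite E" "finite F" "E \<inter> F = {}"
  shows "deg (E \<union> F) z = deg E z + deg F z"
proof -
  have "inc (E \<union> F) z = inc E z \<union> inc F z" by auto
  then show ?thesis using assms by (simp add: deg_def card_Un_disjoint disjoint_iff)
qed

lemma deg_eq_0: "(\<And>e. e \<in> E \<Longrightarrow> z \<notin> e) \<Longrightarrow> deg E z = 0"
  by (metis (no_types, lifting) card.empty deg_def empty_Collect_eq)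

lemma cut_edges_insert:
  assumes "finite E" "{u, w} \<notin> E"
  shows "card (cut_edges (insert {u, w} E) S) = card (cut_edges E S) + of_bool ((u \<in> S) \<noteq> (w \<in> S))"
proof -
  have "cut_edges (insert {u, w} E) S =
      (if (u \<in> S) \<noteq> (w \<in> S) then insert {u, w} (cut_edges E S) else cut_edges E S)"
    unfolding cut_edges_def by auto
  moreover have "{u, w} \<notin> cut_edges E S" "finite (cut_edges E S)"
    using assms by (auto simp: cut_edges_def)
  ultimately show ?thesis by simp
qed

lemma cut_edges_remove:
  assumes "finite E" "{u, w} \<in> E"
  shows "card (cut_edges (E - {{u, w}}) S) + of_bool ((u \<in> S) \<noteq> (w \<in> S)) = card (cut_edges E S)"
  using cut_edges_insert[of "E - {{u, w}}" u w S] assms by (simp add: insert_absorb)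

lemma cut_edges_Un:
  assumes "finite E" "finite F" "E \<inter> F = {}"
  shows "card (cut_edges (E \<union> F) S) = card (cut_edges E S) + card (cut_edges F S)"
proof -
  have "cut_edges (E \<union> F) S = cut_edges E S \<union> cut_edges F S" by (auto simp: cut_edges_def)
  then show ?thesis using assms by (simp add: card_Un_disjoint disjoint_iff cut_edges_def)
qed

lemma cut_edges_Int: "simple_graph V E \<Longrightarrow> cut_edges E (S \<inter> V) = cut_edges E S"
  unfolding cut_edges_def simple_graph_def by fastforce

lemma cut_edges_compl: "simple_graph V E \<Longrightarrow> cut_edges E (V - S) = cut_edges E S"
  unfolding cut_edges_def simple_graph_def by fastforce

text \<open>Summing degrees counts an edge once for each end in \<open>S\<close>. Most counts below
  start here: edges inside a set with a small cut, parity of colour classes, parity of degrees in a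
  component, and the cut of a set that avoids two deleted vertices.\<close>

lemma handshake:
  assumes "simple_graph V F" "finite S"
  shows "(\<Sum>v\<in>S. deg F v) = 2 * card {e \<in> F. e \<subseteq> S} + card (cut_edges F S)"
  using simple_graph_finite[OF assms(1)] assms(1)
proof (induction F rule: finite_induct)
  case empty
  then show ?case by (simp add: deg_def cut_edges_def)
next
  case (insert e F)
  obtain u w where e: "e = {u, w}" "u \<noteq> w"
    using insert.prems by (blast elim: simple_graph_edgeE)
  have IH: "(\<Sum>v\<in>S. deg F v) = 2 * card {e \<in> F. e \<subseteq> S} + card (cut_edges F S)"
    using insert simple_graph_subset by blast
  have "(\<Sum>v\<in>S. deg (insert e F) v) = (\<Sum>v\<in>S. deg F v) + (\<Sum>v\<in>S. of_bool (v \<in> e))"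
    using insert.hyps by (simp add: deg_insert sum.distrib)
  also have "(\<Sum>v\<in>S. of_bool (v \<in> e)) = card (S \<inter> e)"
    using assms(2) by (simp add: of_bool_def sum.If_cases)
  also have "S \<inter> e = (if u \<in> S then {u} else {}) \<union> (if w \<in> S then {w} else {})"
    using e by auto
  also have "card \<dots> = of_bool (u \<in> S) + of_bool (w \<in> S)" using e by auto
  finally have 1: "(\<Sum>v\<in>S. deg (insert e F) v) =
      2 * card {e \<in> F. e \<subseteq> S} + card (cut_edges F S) + (of_bool (u \<in> S) + of_bool (w \<in> S))"
    using IH by simp
  have "{f \<in> insert e F. f \<subseteq> S} =
      (if u \<in> S \<and> w \<in> S then insert e {f \<in> F. f \<subseteq> S} else {f \<in> F. f \<subseteq> S})"
    using e by auto
  then have 2: "card {f \<in> insert e F. f \<subseteq> S} = card {f \<in> F. f \<subseteq> S} + of_bool (u \<in> S \<and> w \<in> S)"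
    using insert.hyps by simp
  have 3: "card (cut_edges (insert e F) S) = card (cut_edges F S) + of_bool ((u \<in> S) \<noteq> (w \<in> S))"
    unfolding e(1) using insert.hyps e(1) by (intro cut_edges_insert) auto
  show ?case unfolding 1 2 3 by simp
qed

lemma even_sum_deg_closed:
  assumes "simple_graph V F" "finite S"
    and "\<And>u w. {u, w} \<in> F \<Longrightarrow> u \<in> S \<Longrightarrow> w \<in> S"
  shows "even (\<Sum>v\<in>S. deg F v)"
proof -
  have "cut_edges F S = {}"
  proof (rule ccontr)
    assume "cut_edges F S \<noteq> {}"
    then obtain e where e: "e \<in> F" "e \<inter> S \<noteq> {}" "e - S \<noteq> {}" by (auto simp: cut_edges_def)
    obtain u w where "e = {u, w}" using e assms(1) by (blast elim: simple_graph_edgeE)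
    with e assms(3)[of u w] assms(3)[of w u] show False by (auto simp: insert_commute)
  qed
  then show ?thesis using handshake[OF assms(1,2)] by simp
qed

section \<open>Cycles and trees\<close>

lemma adj_sym: "adj F u w \<Longrightarrow> adj F w u"
  by (simp add: adj_def insert_commute)

lemma adj_rtranclp_sym: "(adj F)\<^sup>*\<^sup>* u w \<Longrightarrow> (adj F)\<^sup>*\<^sup>* w u"
  by (induction rule: rtranclp_induct) (auto intro: adj_sym converse_rtranclp_into_rtranclp)

lemma adj_rtranclp_lift:
  assumes "\<And>u w. {u, w} \<in> F \<Longrightarrow> (adj F')\<^sup>*\<^sup>* u w" "(adj F)\<^sup>*\<^sup>* u w"
  shows "(adj F')\<^sup>*\<^sup>* u w"
  using assms(2)
proof (induction rule: rtranclp_induct)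
  case (step y z)
  then show ?case using assms(1)[of y z] by (meson adj_def rtranclp_trans)
qed simp

lemma adj_rtranclp_mono: "F \<subseteq> F' \<Longrightarrow> (adj F)\<^sup>*\<^sup>* u w \<Longrightarrow> (adj F')\<^sup>*\<^sup>* u w"
  by (rule adj_rtranclp_lift[of F]) (auto simp: adj_def intro!: r_into_rtranclp)

lemma adj_rtranclp_closed:
  assumes "\<And>u w. {u, w} \<in> F \<Longrightarrow> u \<in> S \<Longrightarrow> w \<in> S" "(adj F)\<^sup>*\<^sup>* u w" "u \<in> S"
  shows "w \<in> S"
  using assms(2,3) by (induction rule: rtranclp_induct) (auto simp: adj_def intro: assms(1))

lemma deg_ge2_other:
  assumes "simple_graph V F" "2 \<le> deg F v"
  obtains w where "{v, w} \<in> F" "w \<noteq> u" "w \<noteq> v"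
proof -
  have "\<not> inc F v \<subseteq> {{v, u}}"
    using assms(2) card_mono[of "{{v, u}}" "inc F v"] by (auto simp: deg_def)
  then obtain e where e: "e \<in> F" "v \<in> e" "e \<noteq> {v, u}" by auto
  then obtain a b where ab: "e = {a, b}" "a \<noteq> b" using assms(1) by (blast elim: simple_graph_edgeE)
  show thesis
  proof (cases "v = a")
    case True then show ?thesis using that[of b] e ab by auto
  next
    case False then show ?thesis using that[of a] e ab by (auto simp: insert_commute)
  qed
qed

text \<open>A longest path is kept as a list headed by one of its ends. That end has a neighbour
  besides the second vertex; by maximality it lies on the path, and the path up to it closes to a
  cycle.\<close>

lemma min_deg_2_cycle:
  assumes sg: "simple_graph V F" and ne: "V \<noteq> {}" and d: "\<And>v. v \<in> V \<Longrightarrow> 2 \<le> deg F v"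
  shows "\<exists>vs. cycle_in F vs"
proof -
  define path where "path vs \<longleftrightarrow> distinct vs \<and> set vs \<subseteq> V \<and> vs \<noteq> [] \<and>
    (\<forall>i. Suc i < length vs \<longrightarrow> {vs ! i, vs ! Suc i} \<in> F)" for vs
  have fin: "finite V" using sg by (simp add: simple_graph_def)
  obtain v where "v \<in> V" using ne by auto
  then have "path [v]" by (simp add: path_def)
  moreover have "\<forall>vs. path vs \<longrightarrow> length vs \<le> card V"
    using fin by (metis card_mono distinct_card path_def)
  ultimately obtain vs where vs: "path vs" and max: "\<And>ws. path ws \<Longrightarrow> length ws \<le> length vs"
    using ex_has_greatest_nat[of path "[v]" length "Suc (card V)"] by (meson le_imp_less_Suc)
  obtain x xs where xs: "vs = x # xs" using vs by (cases vs) (auto simp: path_def)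
  have "x \<in> V" using vs xs by (simp add: path_def)
  \<comment> \<open>For a path with a single vertex the neighbour to be avoided is set to
    \<open>x\<close> itself, so that one statement covers both cases.\<close>
  then obtain w where w: "{x, w} \<in> F" "w \<noteq> (if xs = [] then x else hd xs)" "w \<noteq> x"
    using deg_ge2_other[OF sg d] by metis
  have "w \<in> set vs"
  proof (rule ccontr)
    assume "w \<notin> set vs"
    moreover have "w \<in> V" using simple_graph_edge[OF sg w(1)] by simp
    ultimately have "path (w # vs)" using vs w xs
      by (auto simp: path_def nth_Cons insert_commute split: nat.splits)
    then show False using max by fastforce
  qed
  then obtain j where j: "j < length vs" "vs ! j = w" by (auto simp: in_set_conv_nth)
  have "j \<noteq> 0" using j w(3) xs by (metis nth_Cons_0)
  \<comment> \<open>Index 1 is the second vertex of the path, which \<open>w\<close> avoids; hence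
    the cycle has at least three vertices.\<close>
  moreover have "j \<noteq> 1" using j w xs by (auto simp: hd_conv_nth)
  ultimately have j2: "2 \<le> j" by simp
  have "cycle_in F (take (Suc j) vs)"
    unfolding cycle_in_def
  proof (intro conjI allI impI)
    show "3 \<le> length (take (Suc j) vs)" using j j2 by simp
    show "distinct (take (Suc j) vs)" using vs by (simp add: path_def)
    fix i assume i: "i < length (take (Suc j) vs)"
    show "{take (Suc j) vs ! i, take (Suc j) vs ! ((i + 1) mod length (take (Suc j) vs))} \<in> F"
    proof (cases "i = j")
      case True
      moreover have "vs ! 0 = x" using xs by simp
      ultimately show ?thesis using j w(1) by (simp add: insert_commute)
    next
      case False
      then have "i < j" using i by simp
      then show ?thesis using vs j by (simp add: path_def)
    qed
  qed
  then show ?thesis by blast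
qed

lemma cycle_in_mono: "cycle_in F vs \<Longrightarrow> F \<subseteq> F' \<Longrightarrow> cycle_in F' vs"
  unfolding cycle_in_def by blast

lemma cycle_in_set:
  assumes "cycle_in F vs" "simple_graph V F"
  shows "set vs \<subseteq> V"
  using assms simple_graph_edge[OF assms(2)] unfolding cycle_in_def
  by (metis in_set_conv_nth subsetI)

text \<open>A vertex of degree at most 1 can be deleted with the loss of at most one edge, so the
  inequality persists; when there is no such vertex, the minimum degree is 2.\<close>

lemma many_edges_cycle:
  assumes "simple_graph V F" "V \<noteq> {}" "card V \<le> card F"
  shows "\<exists>vs. cycle_in F vs"
  using assms
proof (induction "card V" arbitrary: V F)
  case 0
  then show ?case by (simp add: simple_graph_def)
next
  case (Suc n)
  show ?case
  proof (cases "\<forall>v\<in>V. 2 \<le> deg F v")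
    case True then show ?thesis using min_deg_2_cycle Suc by blast
  next
    case False
    then obtain v where v: "v \<in> V" "deg F v \<le> 1" by force
    let ?F = "{e \<in> F. v \<notin> e}"
    have fin: "finite V" "finite F" using Suc.prems simple_graph_finite by (auto simp: simple_graph_def)
    have "F = inc F v \<union> ?F" by auto
    then have "card F = deg F v + card ?F"
      unfolding deg_def using fin by (subst card_Un_disjoint[symmetric]) auto
    then have le: "card (V - {v}) \<le> card ?F" using v Suc.prems fin by simp
    have sg: "simple_graph (V - {v}) ?F" using Suc.prems(1) unfolding simple_graph_def by blast
    show ?thesis
    proof (cases "V = {v}")
      case True
      then have "F = {}" using Suc.prems(1) unfolding simple_graph_def by blast
      then show ?thesis using Suc.prems True by simp
    next
      case False
      then have "V - {v} \<noteq> {}" using v by auto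
      moreover have "n = card (V - {v})" using Suc.hyps(2) v fin by simp
      ultimately obtain vs where "cycle_in ?F vs" using Suc.hyps(1) sg le by blast
      then show ?thesis using cycle_in_mono[of ?F vs F] by blast
    qed
  qed
qed

text \<open>A vertex set grown from a single vertex along edges leaving it gains an inner edge with
  every new vertex.\<close>

lemma connected_card:
  assumes sg: "simple_graph V T" and ne: "V \<noteq> {}"
    and conn: "\<And>u v. u \<in> V \<Longrightarrow> v \<in> V \<Longrightarrow> (adj T)\<^sup>*\<^sup>* u v"
  shows "card V \<le> card T + 1"
proof -
  have fin: "finite V" "finite T" using sg simple_graph_finite by (auto simp: simple_graph_def)
  have "\<exists>S\<subseteq>V. S \<noteq> {} \<and> card S = Suc k \<and> k \<le> card {e \<in> T. e \<subseteq> S}" if "Suc k \<le> card V" for k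
    using that
  proof (induction k)
    case 0
    then show ?case using ne by (auto intro!: exI[of _ "{SOME v. v \<in> V}"] some_in_eq[THEN iffD2])
  next
    case (Suc k)
    then obtain S where S: "S \<subseteq> V" "S \<noteq> {}" "card S = Suc k" "k \<le> card {e \<in> T. e \<subseteq> S}" by auto
    then have "S \<noteq> V" using Suc.prems by auto
    then obtain u v where uv: "u \<in> S" "v \<in> V" "v \<notin> S" using S by auto
    then have "(adj T)\<^sup>*\<^sup>* u v" using conn S by auto
    then obtain a b where ab: "{a, b} \<in> T" "a \<in> S" "b \<notin> S"
      using adj_rtranclp_closed[of T S u v] uv by blast
    have bV: "b \<in> V" using simple_graph_edge[OF sg ab(1)] by simp
    have "insert {a, b} {e \<in> T. e \<subseteq> S} \<subseteq> {e \<in> T. e \<subseteq> insert b S}" using ab by auto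
    then have "card (insert {a, b} {e \<in> T. e \<subseteq> S}) \<le> card {e \<in> T. e \<subseteq> insert b S}"
      using fin by (intro card_mono) auto
    then have "Suc k \<le> card {e \<in> T. e \<subseteq> insert b S}" using S(4) ab fin by simp
    moreover have "card (insert b S) = Suc (Suc k)" using S ab fin finite_subset by fastforce
    ultimately show ?case using S bV by (intro exI[of _ "insert b S"]) auto
  qed
  from this[of "card V - 1"] obtain S where "card V - 1 \<le> card {e \<in> T. e \<subseteq> S}"
    using ne fin card_gt_0_iff[of V] by auto
  also have "\<dots> \<le> card T" using fin by (intro card_mono) auto
  finally show ?thesis by simp
qed

text \<open>The edge that closes the list is bypassed by walking along the rest of the
  cycle.\<close>

lemma cycle_edge_redundant:
  assumes "cycle_in T vs"
  obtains e where "e \<in> T" "\<And>u w. (adj T)\<^sup>*\<^sup>* u w \<Longrightarrow> (adj (T - {e}))\<^sup>*\<^sup>* u w"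
proof -
  define n where "n = length vs"
  have n: "3 \<le> n" and dist: "distinct vs"
    and E: "\<And>i. i < n \<Longrightarrow> {vs ! i, vs ! ((i + 1) mod n)} \<in> T"
    using assms by (auto simp: cycle_in_def n_def)
  let ?e = "{vs ! (n - 1), vs ! 0}"
  have eT: "?e \<in> T" using E[of "n - 1"] n by simp
  have path: "(adj (T - {?e}))\<^sup>*\<^sup>* (vs ! 0) (vs ! i)" if "i < n" for i
    using that
  proof (induction i)
    case (Suc i)
    have "{vs ! i, vs ! Suc i} \<in> T" using E[of i] Suc.prems by simp
    moreover have "{vs ! i, vs ! Suc i} \<noteq> ?e"
    proof -
      have eq: "vs ! j = vs ! k \<longleftrightarrow> j = k" if "j < n" "k < n" for j k
        using that dist by (simp add: nth_eq_iff_index_eq n_def)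
      have "vs ! Suc i \<noteq> vs ! 0" using eq[of "Suc i" 0] Suc.prems by simp
      \<comment> \<open>At \<open>i = 0\<close> this is where length at least 3 enters: otherwise
        \<open>vs ! 1\<close> could be the last vertex.\<close>
      moreover have "vs ! i \<noteq> vs ! 0 \<or> vs ! Suc i \<noteq> vs ! (n - 1)"
      proof (cases "i = 0")
        case True
        then show ?thesis using eq[of "Suc i" "n - 1"] Suc.prems n by simp
      next
        case False
        then show ?thesis using eq[of i 0] Suc.prems by simp
      qed
      ultimately show ?thesis unfolding doubleton_eq_iff by blast
    qed
    ultimately have "adj (T - {?e}) (vs ! i) (vs ! Suc i)" by (simp add: adj_def)
    then show ?case using Suc by auto
  qed simp
  have *: "(adj (T - {?e}))\<^sup>*\<^sup>* (vs ! 0) (vs ! (n - 1))" using path n by simp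
  have "(adj (T - {?e}))\<^sup>*\<^sup>* u w" if "{u, w} \<in> T" for u w
  proof (cases "{u, w} = ?e")
    case True
    then show ?thesis using * adj_rtranclp_sym[OF *] unfolding doubleton_eq_iff by blast
  next
    case False
    then have "adj (T - {?e}) u w" using that by (simp add: adj_def)
    then show ?thesis by (rule r_into_rtranclp)
  qed
  then show thesis using that[OF eT] adj_rtranclp_lift[of T "T - {?e}"] by blast
qed

text \<open>Read forwards it gives the number of edges of a Hist, read backwards the acyclicity of a
  glued or relabelled tree. If a connected graph of this size had a cycle, dropping a redundant edge
  would leave it connected with too few edges.\<close>

lemma tree_card_iff:
  assumes sg: "simple_graph V T" and ne: "V \<noteq> {}"
    and conn: "\<And>u v. u \<in> V \<Longrightarrow> v \<in> V \<Longrightarrow> (adj T)\<^sup>*\<^sup>* u v"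
  shows "(\<nexists>vs. cycle_in T vs) \<longleftrightarrow> card T + 1 = card V"
proof
  assume "\<nexists>vs. cycle_in T vs"
  then have "card T < card V" using many_edges_cycle[OF sg ne] by force
  then show "card T + 1 = card V" using connected_card[OF assms] by simp
next
  assume c: "card T + 1 = card V"
  show "\<nexists>vs. cycle_in T vs"
  proof
    assume "\<exists>vs. cycle_in T vs"
    then obtain e where e: "e \<in> T" "\<And>u w. (adj T)\<^sup>*\<^sup>* u w \<Longrightarrow> (adj (T - {e}))\<^sup>*\<^sup>* u w"
      using cycle_edge_redundant by metis
    have "card V \<le> card (T - {e}) + 1"
      using sg ne conn e(2) by (intro connected_card simple_graph_subset[OF sg]) auto
    moreover have "card (T - {e}) < card T"
      using e(1) simple_graph_finite[OF sg] by (intro card_Diff1_less)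
    ultimately show False using c by simp
  qed
qed

section \<open>Cyclic connectivity and girth of cubic graphs\<close>

text \<open>By the handshake formula \<open>3 * card S\<close> is at most twice the number of inner
  edges plus 3. From three vertices on this forces at least \<open>card S\<close> inner edges, hence
  a cycle. Two vertices span at most one edge, and 6 exceeds 2 + 3.\<close>

lemma cubic_small_cut_cycle:
  assumes cub: "cubic V E" and S: "S \<subseteq> V" "2 \<le> card S" "card (cut_edges E S) \<le> 3"
  shows "\<exists>vs. cycle_in E vs \<and> set vs \<subseteq> S"
proof -
  have sg: "simple_graph V E" using cub by (simp add: cubic_def)
  have fin: "finite S" using S sg finite_subset by (auto simp: simple_graph_def)
  let ?F = "{e \<in> E. e \<subseteq> S}"
  have sgF: "simple_graph S ?F"
    unfolding simple_graph_def
  proof (intro conjI ballI fin)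
    fix e assume e: "e \<in> ?F"
    then obtain u w where "e = {u, w}" "u \<noteq> w" using sg by (blast elim: simple_graph_edgeE)
    then show "\<exists>u v. e = {u, v} \<and> u \<noteq> v \<and> u \<in> S \<and> v \<in> S" using e by auto
  qed
  have "(\<Sum>v\<in>S. deg E v) = 3 * card S" using cub S by (simp add: cubic_def subset_eq)
  then have hs: "3 * card S = 2 * card ?F + card (cut_edges E S)" using handshake[OF sg fin] by simp
  have "card S \<noteq> 2"
  proof
    assume 2: "card S = 2"
    have "?F \<subseteq> {S}"
    proof
      fix e assume e: "e \<in> ?F"
      then obtain u w where "e = {u, w}" "u \<noteq> w" using sg by (blast elim: simple_graph_edgeE)
      then have "card e = 2" by simp
      then have "e = S" using 2 fin e by (intro card_subset_eq) auto
      then show "e \<in> {S}" by simp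
    qed
    have "card ?F \<le> card {S}" by (rule card_mono[OF _ \<open>?F \<subseteq> {S}\<close>]) simp
    then show False using hs 2 S(3) by simp
  qed
  then have "card S \<le> card ?F" using hs S(2,3) by linarith
  moreover have "S \<noteq> {}" using S(2) by auto
  ultimately obtain vs where "cycle_in ?F vs" using many_edges_cycle[OF sgF] by blast
  then show ?thesis using cycle_in_mono[of ?F vs E] cycle_in_set[OF _ sgF] by blast
qed

lemma cyc_4_edge_connected_iff:
  assumes "cubic V E"
  shows "cyc_4_edge_connected V E \<longleftrightarrow>
    (\<forall>S\<subseteq>V. 2 \<le> card S \<longrightarrow> 2 \<le> card (V - S) \<longrightarrow> 4 \<le> card (cut_edges E S))"
proof -
  have sg: "simple_graph V E" and fin: "finite V" using assms by (auto simp: cubic_def simple_graph_def)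
  have "2 \<le> card S" if "cycle_in E vs" "set vs \<subseteq> S" "S \<subseteq> V" for vs S
  proof -
    have "3 \<le> card (set vs)" using that(1) by (simp add: cycle_in_def distinct_card)
    also have "\<dots> \<le> card S" using that fin finite_subset by (intro card_mono) auto
    finally show ?thesis by simp
  qed
  moreover have "4 \<le> card (cut_edges E S)"
    if "cyc_4_edge_connected V E" "S \<subseteq> V" "2 \<le> card S" "2 \<le> card (V - S)" for S
  proof (rule ccontr)
    assume "\<not> 4 \<le> card (cut_edges E S)"
    then have "card (cut_edges E S) \<le> 3" by simp
    then have "(\<exists>vs. cycle_in E vs \<and> set vs \<subseteq> S)" "(\<exists>vs. cycle_in E vs \<and> set vs \<subseteq> V - S)"
      using cubic_small_cut_cycle[OF assms] that cut_edges_compl[OF sg] by auto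
    then show False using that \<open>\<not> _\<close> by (auto simp: cyc_4_edge_connected_def)
  qed
  ultimately show ?thesis
    unfolding cyc_4_edge_connected_def by (intro iffI allI impI) (blast, meson Diff_subset)
qed

text \<open>Triangles and quadrilaterals are excluded vertex by vertex instead of through lists, so
  that a local change of the graph is checked by asking where three or four vertices lie.\<close>

definition no_short_cycle :: "'a set set \<Rightarrow> bool" where
  "no_short_cycle E \<longleftrightarrow>
     (\<forall>a b c. distinct [a, b, c] \<longrightarrow> {a, b} \<in> E \<longrightarrow> {b, c} \<in> E \<longrightarrow> {c, a} \<notin> E) \<and>
     (\<forall>a b c d. distinct [a, b, c, d] \<longrightarrow> {a, b} \<in> E \<longrightarrow> {b, c} \<in> E \<longrightarrow> {c, d} \<in> E \<longrightarrow> {d, a} \<notin> E)"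

lemma girth_ge_5_iff: "girth_ge E 5 \<longleftrightarrow> no_short_cycle E"
proof
  assume g: "girth_ge E 5"
  have "\<not> cycle_in E [a, b, c]" "\<not> cycle_in E [a, b, c, d]" for a b c d
    using g unfolding girth_ge_def by fastforce+
  moreover have "cycle_in E [a, b, c]"
    if "distinct [a, b, c]" "{a, b} \<in> E" "{b, c} \<in> E" "{c, a} \<in> E" for a b c
    using that by (auto simp: cycle_in_def less_Suc_eq)
  moreover have "cycle_in E [a, b, c, d]"
    if "distinct [a, b, c, d]" "{a, b} \<in> E" "{b, c} \<in> E" "{c, d} \<in> E" "{d, a} \<in> E" for a b c d
    using that by (auto simp: cycle_in_def less_Suc_eq)
  ultimately show "no_short_cycle E"
    unfolding no_short_cycle_def by metis
next
  assume n: "no_short_cycle E"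
  show "girth_ge E 5"
    unfolding girth_ge_def
  proof (intro allI impI, rule ccontr)
    fix vs assume vs: "cycle_in E vs" "\<not> 5 \<le> length vs"
    then have "length vs = 3 \<or> length vs = 4" by (auto simp: cycle_in_def)
    then show False
    proof
      assume "length vs = 3"
      then obtain a b c where abc: "vs = [a, b, c]" by (auto simp: numeral_3_eq_3 length_Suc_conv)
      have "\<forall>i<3. {vs ! i, vs ! ((i + 1) mod 3)} \<in> E" "distinct vs"
        using vs abc by (auto simp: cycle_in_def)
      from this(1)[rule_format, of 0] this(1)[rule_format, of 1] this(1)[rule_format, of 2] this(2)
      show False using n abc by (auto simp: no_short_cycle_def)
    next
      assume "length vs = 4"
      then obtain a b c d where abc: "vs = [a, b, c, d]"
        by (auto simp: numeral_eq_Suc length_Suc_conv)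
      have "\<forall>i<4. {vs ! i, vs ! ((i + 1) mod 4)} \<in> E" "distinct vs"
        using vs abc by (auto simp: cycle_in_def)
      from this(1)[rule_format, of 0] this(1)[rule_format, of 1] this(1)[rule_format, of 2]
        this(1)[rule_format, of 3] this(2)
      show False using n abc by (auto simp: no_short_cycle_def)
    qed
  qed
qed

section \<open>Subdividing edges\<close>

definition subdiv :: "'a set set \<Rightarrow> 'a \<Rightarrow> 'a \<Rightarrow> 'a \<Rightarrow> 'a set set" where
  "subdiv E u w p = insert {u, p} (insert {p, w} (E - {{u, w}}))"

lemma subdiv_mono: "T \<subseteq> E \<Longrightarrow> subdiv T u w p \<subseteq> subdiv E u w p"
  by (auto simp: subdiv_def)

context
  fixes V :: "'a set" and E :: "'a set set" and u w p :: 'a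
  assumes sg: "simple_graph V E" and uw: "{u, w} \<in> E" and p: "p \<notin> V"
begin

lemma subdiv_facts: "finite E" "u \<in> V" "w \<in> V" "u \<noteq> w" "u \<noteq> p" "w \<noteq> p"
    "{u, p} \<notin> insert {p, w} (E - {{u, w}})" "{p, w} \<notin> E - {{u, w}}" "{u, p} \<notin> E" "{p, w} \<notin> E"
  using simple_graph_finite[OF sg] simple_graph_edge[OF sg uw] simple_graph_notin[OF sg p] p
  by (auto simp: doubleton_eq_iff)

lemma simple_graph_subdiv: "simple_graph (insert p V) (subdiv E u w p)"
proof -
  have "\<exists>a b. e = {a, b} \<and> a \<noteq> b \<and> a \<in> insert p V \<and> b \<in> insert p V" if "e \<in> subdiv E u w p" for e
  proof -
    consider "e = {u, p}" | "e = {p, w}" | "e \<in> E" using \<open>e \<in> subdiv E u w p\<close> by (auto simp: subdiv_def)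
    then show ?thesis
    proof cases
      case 1 then show ?thesis using subdiv_facts by blast
    next
      case 2 then show ?thesis using subdiv_facts by blast
    next
      case 3 then show ?thesis using sg by (blast elim: simple_graph_edgeE)
    qed
  qed
  then show ?thesis using sg by (simp add: simple_graph_def)
qed

lemma deg_subdiv: "z \<in> V \<Longrightarrow> deg (subdiv E u w p) z = deg E z"
  and deg_subdiv_new: "deg (subdiv E u w p) p = 2"
proof -
  have *: "deg (subdiv E u w p) z + of_bool (z \<in> {u, w}) =
      deg E z + of_bool (z \<in> {p, w}) + of_bool (z \<in> {u, p})" for z
    unfolding subdiv_def using subdiv_facts deg_remove[OF _ uw, of z]
    by (simp add: deg_insert del: insert_iff)
  show "deg (subdiv E u w p) z = deg E z" if "z \<in> V"
    using *[of z] that subdiv_facts(2-6) p by (cases "z = u"; cases "z = w") auto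
  have "deg E p = 0" using simple_graph_notin[OF sg p] by (intro deg_eq_0)
  then show "deg (subdiv E u w p) p = 2"
    using *[of p] subdiv_facts by auto
qed

text \<open>Subdividing never lowers a cut. An edge with separated ends is still cut exactly once
  wherever \<open>p\<close> lies; an edge with both ends on one side is cut twice if
  \<open>p\<close> is on the other.\<close>

lemma cut_subdiv: "card (cut_edges (subdiv E u w p) S) =
    card (cut_edges E S) + (if (u \<in> S) = (w \<in> S) \<and> (p \<in> S) \<noteq> (u \<in> S) then 2 else 0)"
proof -
  have "card (cut_edges (subdiv E u w p) S) + of_bool ((u \<in> S) \<noteq> (w \<in> S)) =
      card (cut_edges E S) + of_bool ((p \<in> S) \<noteq> (w \<in> S)) + of_bool ((u \<in> S) \<noteq> (p \<in> S))"
    unfolding subdiv_def using subdiv_facts cut_edges_remove[OF _ uw, of S]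
    by (simp add: cut_edges_insert)
  then show ?thesis by (auto simp: of_bool_def split: if_splits)
qed

lemma card_subdiv: "card (subdiv E u w p) = card E + 1"
proof -
  have "card (subdiv E u w p) = Suc (Suc (card (E - {{u, w}})))"
    unfolding subdiv_def using subdiv_facts by simp
  also have "\<dots> = card E + 1" using subdiv_facts(1) uw card_Suc_Diff1[of E "{u, w}"] by simp
  finally show ?thesis .
qed

lemma subdiv_edge_iff: "a \<noteq> p \<Longrightarrow> b \<noteq> p \<Longrightarrow> {a, b} \<in> subdiv E u w p \<longleftrightarrow> {a, b} \<in> E \<and> {a, b} \<noteq> {u, w}"
  and subdiv_new_edge_iff: "{p, b} \<in> subdiv E u w p \<longleftrightarrow> b = u \<or> b = w"
  using subdiv_facts simple_graph_notin[OF sg p] by (auto simp: subdiv_def doubleton_eq_iff)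

lemma no_short_cycle_subdiv:
  assumes n: "no_short_cycle E"
  shows "no_short_cycle (subdiv E u w p)"
proof -
  let ?S = "subdiv E u w p"
  \<comment> \<open>The two neighbours of \<open>p\<close> are \<open>u\<close> and
    \<open>w\<close>, and the edge between them is gone.\<close>
  have T0: False if "{p, b} \<in> ?S" "{b, c} \<in> ?S" "{c, p} \<in> ?S" "distinct [p, b, c]" for b c
  proof -
    have "b \<in> {u, w}" "c \<in> {u, w}" "b \<noteq> c"
      using that subdiv_new_edge_iff[of b] subdiv_new_edge_iff[of c] by (auto simp: insert_commute)
    then have "{b, c} = {u, w}" by auto
    then show False using that subdiv_edge_iff[of b c] by auto
  qed
  \<comment> \<open>A quadrilateral through \<open>p\<close> shrinks to a triangle of
    \<open>E\<close> on the edge \<open>{u, w}\<close>.\<close>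
  have Q0: False
    if "{p, b} \<in> ?S" "{b, c} \<in> ?S" "{c, d} \<in> ?S" "{d, p} \<in> ?S" "distinct [p, b, c, d]" for b c d
  proof -
    have "b \<in> {u, w}" "d \<in> {u, w}" "b \<noteq> d"
      using that subdiv_new_edge_iff[of b] subdiv_new_edge_iff[of d] by (auto simp: insert_commute)
    then have "{d, b} = {u, w}" by auto
    moreover have "{b, c} \<in> E" "{c, d} \<in> E"
      using that subdiv_edge_iff[of b c] subdiv_edge_iff[of c d] by auto
    ultimately show False using n that uw unfolding no_short_cycle_def
      by (metis distinct_length_2_or_more)
  qed
  have "{c, a} \<notin> ?S" if abc: "distinct [a, b, c]" "{a, b} \<in> ?S" "{b, c} \<in> ?S" for a b c
  proof
    assume ca: "{c, a} \<in> ?S"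
    show False
    proof (cases "p \<in> {a, b, c}")
      case True
      then show False using T0[of b c] T0[of c a] T0[of a b] abc ca by (auto simp: eq_commute)
    next
      case False
      then have "{a, b} \<in> E" "{b, c} \<in> E" "{c, a} \<in> E" using abc ca subdiv_edge_iff by auto
      then show False using n abc unfolding no_short_cycle_def by blast
    qed
  qed
  moreover have "{d, a} \<notin> ?S"
    if abc: "distinct [a, b, c, d]" "{a, b} \<in> ?S" "{b, c} \<in> ?S" "{c, d} \<in> ?S" for a b c d
  proof
    assume da: "{d, a} \<in> ?S"
    show False
    proof (cases "p \<in> {a, b, c, d}")
      case True
      then show False using Q0[of b c d] Q0[of c d a] Q0[of d a b] Q0[of a b c] abc da
        by (auto simp: eq_commute)
    next
      case False
      then have "{a, b} \<in> E" "{b, c} \<in> E" "{c, d} \<in> E" "{d, a} \<in> E"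
        using abc da subdiv_edge_iff by auto
      then show False using n abc unfolding no_short_cycle_def by blast
    qed
  qed
  ultimately show ?thesis unfolding no_short_cycle_def by blast
qed

text \<open>The new edges belong to the tree as well, so expanding tree vertices does not disturb
  the outer cycles.\<close>

lemma subdiv_diff: "T \<subseteq> E \<Longrightarrow> {u, w} \<in> T \<Longrightarrow> subdiv E u w p - subdiv T u w p = E - T"
  using subdiv_facts by (auto simp: subdiv_def)

end

lemma subdiv_connected:
  assumes "(adj T)\<^sup>*\<^sup>* a b"
  shows "(adj (subdiv T u w p))\<^sup>*\<^sup>* a b"
proof (rule adj_rtranclp_lift[OF _ assms])
  fix a b assume ab: "{a, b} \<in> T"
  let ?S = "subdiv T u w p"
  have "adj ?S u p" "adj ?S p w" by (auto simp: subdiv_def adj_def)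
  then have *: "(adj ?S)\<^sup>*\<^sup>* u w" by auto
  show "(adj ?S)\<^sup>*\<^sup>* a b"
  proof (cases "{a, b} = {u, w}")
    case True
    then show ?thesis using * adj_rtranclp_sym[OF *] unfolding doubleton_eq_iff by blast
  next
    case False
    then have "adj ?S a b" using ab by (simp add: subdiv_def adj_def)
    then show ?thesis by (rule r_into_rtranclp)
  qed
qed

section \<open>Gluing two graphs along a matching\<close>

lemma cut_edges_singleton:
  assumes "simple_graph V E"
  shows "card (cut_edges E {z}) = deg E z"
proof -
  have "cut_edges E {z} = inc E z"
  proof
    show "inc E z \<subseteq> cut_edges E {z}"
    proof
      fix e assume e: "e \<in> inc E z"
      then obtain a b where "e = {a, b}" "a \<noteq> b" using assms by (blast elim: simple_graph_edgeE)
      then show "e \<in> cut_edges E {z}" using e by (auto simp: cut_edges_def)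
    qed
  qed (auto simp: cut_edges_def)
  then show ?thesis by (simp add: deg_def)
qed

text \<open>The last condition says that collapsing everything beyond the dangling edges at \<open>P\<close> to one
  vertex leaves no small nontrivial edge cut.\<close>
definition pole :: "'a set \<Rightarrow> 'a set set \<Rightarrow> 'a set \<Rightarrow> bool" where
  "pole V E P \<longleftrightarrow> simple_graph V E \<and> P \<subseteq> V \<and> no_short_cycle E \<and>
     (\<forall>z\<in>V. deg E z + of_bool (z \<in> P) = 3) \<and>
     (\<forall>A\<subseteq>V. 2 \<le> card A \<longrightarrow> 4 \<le> card (cut_edges E A) + card (A \<inter> P))"

text \<open>One of the two sides holds at most two of the four ports. With two of them it has at
  least two vertices, and the pole bound leaves 4 - 2 cut edges; with at most one, even a single
  vertex of degree 3 leaves 3 - 1.\<close>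

lemma pole_cut_ge_2:
  assumes pole: "pole V E P" and P4: "card P = 4" and A: "A \<subseteq> V" "A \<noteq> {}" "A \<noteq> V"
  shows "2 \<le> card (cut_edges E A)"
proof -
  have sg: "simple_graph V E" and PV: "P \<subseteq> V" using pole by (auto simp: pole_def)
  have fin: "finite V" using sg by (simp add: simple_graph_def)
  have *: "3 \<le> card (cut_edges E B) + card (B \<inter> P) \<and>
      (2 \<le> card (B \<inter> P) \<longrightarrow> 4 \<le> card (cut_edges E B) + card (B \<inter> P))"
    if B: "B \<subseteq> V" "B \<noteq> {}" for B
  proof -
    have finB: "finite B" using B fin finite_subset by blast
    show ?thesis
    proof (cases "2 \<le> card B")
      case True
      moreover have "\<forall>A\<subseteq>V. 2 \<le> card A \<longrightarrow> 4 \<le> card (cut_edges E A) + card (A \<inter> P)"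
        using pole by (simp add: pole_def)
      ultimately have "4 \<le> card (cut_edges E B) + card (B \<inter> P)" using B(1) by blast
      then show ?thesis by simp
    next
      case False
      then have "card B = 1" using finB B by (metis One_nat_def Suc_1 Suc_leI card_gt_0_iff le_neq_implies_less not_le)
      then obtain z where z: "B = {z}" using card_1_singletonE by blast
      then have "card (B \<inter> P) = of_bool (z \<in> P)" by auto
      then show ?thesis using z B pole cut_edges_singleton[OF sg, of z] by (auto simp: pole_def)
    qed
  qed
  have "card P = card (A \<inter> P) + card ((V - A) \<inter> P)"
    using fin PV by (subst card_Un_disjoint[symmetric]) (auto intro: arg_cong[of _ _ card] finite_subset)
  moreover have "V - A \<noteq> {}" using A by auto
  ultimately show ?thesis
    using *[OF A(1,2)] *[of "V - A"] cut_edges_compl[OF sg, of A] P4 by auto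
qed

text \<open>The ports of the two pieces are the ends of dangling edges; \<open>f\<close> tells which
  dangling edges are joined to each other.\<close>

locale matching =
  fixes V1 V2 P :: "'a set" and f :: "'a \<Rightarrow> 'a"
  assumes disj: "V1 \<inter> V2 = {}" and P: "P \<subseteq> V1" and inj: "inj_on f P" and img: "f ` P \<subseteq> V2"
begin

lemma portD: "q \<in> P \<Longrightarrow> q \<in> V1 \<and> q \<notin> V2 \<and> f q \<in> V2 \<and> f q \<notin> V1"
  using P img disj by auto

definition cross :: "'a set \<Rightarrow> 'a set set" where
  "cross Q = (\<lambda>p. {p, f p}) ` Q"

text \<open>The set \<open>Q\<close> varies because the graph uses all connecting edges while its
  tree may use only some of them.\<close>

definition glue :: "'a set set \<Rightarrow> 'a set set \<Rightarrow> 'a set \<Rightarrow> 'a set set" where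
  "glue E1 E2 Q = E1 \<union> E2 \<union> cross Q"

lemma cross_iff: "Q \<subseteq> P \<Longrightarrow> a \<in> V1 \<Longrightarrow> b \<in> V2 \<Longrightarrow> {a, b} \<in> cross Q \<longleftrightarrow> a \<in> Q \<and> b = f a"
  using disj by (auto simp: cross_def doubleton_eq_iff dest!: subsetD portD)

context
  fixes E1 E2 :: "'a set set" and Q :: "'a set"
  assumes sg1: "simple_graph V1 E1" and sg2: "simple_graph V2 E2" and Q: "Q \<subseteq> P"
begin

lemma cross_sides: "e \<in> cross Q \<Longrightarrow> e \<inter> V1 \<noteq> {} \<and> e \<inter> V2 \<noteq> {}"
  using Q P img by (auto simp: cross_def)

lemma side1: "e \<in> E1 \<Longrightarrow> e \<subseteq> V1 \<and> e \<noteq> {}"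
  using sg1 by (blast elim: simple_graph_edgeE)

lemma side2: "e \<in> E2 \<Longrightarrow> e \<subseteq> V2 \<and> e \<noteq> {}"
  using sg2 by (blast elim: simple_graph_edgeE)

lemma glue_disjoint: "E1 \<inter> E2 = {}" "(E1 \<union> E2) \<inter> cross Q = {}"
  using side1 side2 cross_sides disj by blast+

lemma glue_finite: "finite E1" "finite E2" "finite (cross Q)"
proof -
  have "finite V1" using sg1 by (simp add: simple_graph_def)
  then have "finite Q" using Q P by (meson finite_subset)
  then show "finite (cross Q)" by (simp add: cross_def)
qed (rule simple_graph_finite[OF sg1] simple_graph_finite[OF sg2])+

lemma glue_simple: "simple_graph (V1 \<union> V2) (glue E1 E2 Q)"
proof -
  have "\<exists>a b. e = {a, b} \<and> a \<noteq> b \<and> a \<in> V1 \<union> V2 \<and> b \<in> V1 \<union> V2" if e: "e \<in> glue E1 E2 Q" for e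
  proof -
    consider "e \<in> E1" | "e \<in> E2" | q where "q \<in> Q" "e = {q, f q}"
      using e by (auto simp: glue_def cross_def)
    then show ?thesis
    proof cases
      case 1 then show ?thesis using sg1 by (blast elim: simple_graph_edgeE)
    next
      case 2 then show ?thesis using sg2 by (blast elim: simple_graph_edgeE)
    next
      case 3
      then have "q \<in> V1" "f q \<in> V2" "q \<noteq> f q" using Q P img disj by auto
      then show ?thesis using 3(2) by (intro exI[of _ q] exI[of _ "f q"]) auto
    qed
  qed
  then show ?thesis using sg1 sg2 by (simp add: simple_graph_def)
qed

lemma deg_glue: "deg (glue E1 E2 Q) z = deg E1 z + deg E2 z + deg (cross Q) z"
  unfolding glue_def using glue_finite glue_disjoint by (simp add: deg_Un)

lemma cut_glue: "card (cut_edges (glue E1 E2 Q) S) =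
    card (cut_edges E1 S) + card (cut_edges E2 S) + card (cut_edges (cross Q) S)"
  unfolding glue_def using glue_finite glue_disjoint by (simp add: cut_edges_Un)

lemma deg_glue_left:
  assumes z: "z \<in> V1"
  shows "deg (glue E1 E2 Q) z = deg E1 z + of_bool (z \<in> Q)"
proof -
  have "inc (cross Q) z = (if z \<in> Q then {{z, f z}} else {})"
    using z subsetD[OF Q] portD by (auto simp: cross_def)
  then have "deg (cross Q) z = of_bool (z \<in> Q)" by (simp add: deg_def)
  moreover have "deg E2 z = 0" using side2 z disj by (intro deg_eq_0) auto
  ultimately show ?thesis by (simp add: deg_glue)
qed

lemma deg_glue_right:
  assumes z: "z \<in> V2"
  shows "deg (glue E1 E2 Q) z = deg E2 z + of_bool (z \<in> f ` Q)"
proof -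
  have "inc (cross Q) z = (\<lambda>p. {p, f p}) ` {q \<in> Q. f q = z}"
    using z disj Q P img by (auto simp: cross_def)
  moreover have "card ((\<lambda>p. {p, f p}) ` {q \<in> Q. f q = z}) = of_bool (z \<in> f ` Q)"
  proof (cases "z \<in> f ` Q")
    case True
    then obtain q where q: "q \<in> Q" "z = f q" by blast
    then have "{q \<in> Q. f q = z} = {q}" using inj_on_subset[OF inj Q] by (blast dest: inj_onD)
    then show ?thesis using True by simp
  next
    case False
    then have "{q \<in> Q. f q = z} = {}" by blast
    then show ?thesis using False by (simp only:) simp
  qed
  ultimately have "deg (cross Q) z = of_bool (z \<in> f ` Q)" by (simp add: deg_def)
  moreover have "deg E1 z = 0" using side1 z disj by (intro deg_eq_0) auto
  ultimately show ?thesis by (simp add: deg_glue)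
qed

lemma card_glue: "card (glue E1 E2 Q) = card E1 + card E2 + card Q"
proof -
  have "inj_on (\<lambda>p. {p, f p}) Q"
    using disj Q P img by (fastforce simp: inj_on_def doubleton_eq_iff)
  then have "card (cross Q) = card Q" by (simp add: cross_def card_image)
  then show ?thesis unfolding glue_def using glue_finite glue_disjoint by (simp add: card_Un_disjoint)
qed

lemma glue_edge_iff:
  "a \<in> V1 \<Longrightarrow> b \<in> V1 \<Longrightarrow> {a, b} \<in> glue E1 E2 Q \<longleftrightarrow> {a, b} \<in> E1"
  "a \<in> V2 \<Longrightarrow> b \<in> V2 \<Longrightarrow> {a, b} \<in> glue E1 E2 Q \<longleftrightarrow> {a, b} \<in> E2"
  "a \<in> V1 \<Longrightarrow> b \<in> V2 \<Longrightarrow> {a, b} \<in> glue E1 E2 Q \<longleftrightarrow> a \<in> Q \<and> b = f a"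
  "b \<in> V1 \<Longrightarrow> a \<in> V2 \<Longrightarrow> {a, b} \<in> glue E1 E2 Q \<longleftrightarrow> b \<in> Q \<and> a = f b"
proof -
  show "{a, b} \<in> glue E1 E2 Q \<longleftrightarrow> {a, b} \<in> E1" if "a \<in> V1" "b \<in> V1"
    using that side2[of "{a, b}"] cross_sides[of "{a, b}"] disj by (auto simp: glue_def)
  show "{a, b} \<in> glue E1 E2 Q \<longleftrightarrow> {a, b} \<in> E2" if "a \<in> V2" "b \<in> V2"
    using that side1[of "{a, b}"] cross_sides[of "{a, b}"] disj by (auto simp: glue_def)
  have *: "{a, b} \<in> glue E1 E2 Q \<longleftrightarrow> a \<in> Q \<and> b = f a" if "a \<in> V1" "b \<in> V2" for a b
    using that side1[of "{a, b}"] side2[of "{a, b}"] cross_iff[OF Q that] disj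
    by (auto simp: glue_def)
  show "a \<in> V1 \<Longrightarrow> b \<in> V2 \<Longrightarrow> {a, b} \<in> glue E1 E2 Q \<longleftrightarrow> a \<in> Q \<and> b = f a" by (rule *)
  show "b \<in> V1 \<Longrightarrow> a \<in> V2 \<Longrightarrow> {a, b} \<in> glue E1 E2 Q \<longleftrightarrow> b \<in> Q \<and> a = f b"
    using *[of b a] by (simp add: insert_commute)
qed

text \<open>The connecting edges form a matching, so a closed walk that changes sides spends at
  least one edge on either side between two crossings. This excludes triangles, and a quadrilateral
  would need an edge between two ports of the second piece.\<close>

lemma no_short_cycle_glue:
  assumes n1: "no_short_cycle E1" and n2: "no_short_cycle E2"
    and ind: "\<And>p q. p \<in> Q \<Longrightarrow> q \<in> Q \<Longrightarrow> {f p, f q} \<notin> E2"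
  shows "no_short_cycle (glue E1 E2 Q)"
proof -
  let ?G = "glue E1 E2 Q"
  have V: "a \<in> V1 \<or> a \<in> V2" "b \<in> V1 \<or> b \<in> V2" if "{a, b} \<in> ?G" for a b
    using simple_graph_edge[OF glue_simple that] by auto
  have inj': "f p = f q \<longleftrightarrow> p = q" if "p \<in> Q" "q \<in> Q" for p q
    using that inj Q by (meson inj_on_eq_iff subsetD)
  have "{c, a} \<notin> ?G" if abc: "distinct [a, b, c]" "{a, b} \<in> ?G" "{b, c} \<in> ?G" for a b c
  proof
    assume ca: "{c, a} \<in> ?G"
    have "\<not> ({a, b} \<in> E1 \<and> {b, c} \<in> E1 \<and> {c, a} \<in> E1)" "\<not> ({a, b} \<in> E2 \<and> {b, c} \<in> E2 \<and> {c, a} \<in> E2)"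
      using n1 n2 abc(1) unfolding no_short_cycle_def by blast+
    moreover have "{b, a} \<in> ?G" "{c, b} \<in> ?G" "{a, c} \<in> ?G"
      using abc ca by (simp_all add: insert_commute)
    ultimately show False using V[OF abc(2)] V[OF ca] abc ca glue_edge_iff inj'
      by (metis distinct_length_2_or_more)
  qed
  moreover have "{d, a} \<notin> ?G"
    if abc: "distinct [a, b, c, d]" "{a, b} \<in> ?G" "{b, c} \<in> ?G" "{c, d} \<in> ?G" for a b c d
  proof
    assume da: "{d, a} \<in> ?G"
    have "\<not> ({a, b} \<in> E1 \<and> {b, c} \<in> E1 \<and> {c, d} \<in> E1 \<and> {d, a} \<in> E1)"
      "\<not> ({a, b} \<in> E2 \<and> {b, c} \<in> E2 \<and> {c, d} \<in> E2 \<and> {d, a} \<in> E2)"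
      using n1 n2 abc(1) unfolding no_short_cycle_def by blast+
    then show False using V[OF abc(2)] V[OF abc(4)] abc da
      by (elim disjE) (auto simp: glue_edge_iff inj' dest: ind)
  qed
  ultimately show ?thesis unfolding no_short_cycle_def by blast
qed

text \<open>The second piece may be disconnected, as a tree is after losing two vertices; each of
  its fragments is tied to the connected first piece by a connecting edge of its own.\<close>

lemma glue_connected:
  assumes c1: "\<And>a b. a \<in> V1 \<Longrightarrow> b \<in> V1 \<Longrightarrow> (adj E1)\<^sup>*\<^sup>* a b"
    and c2: "\<And>z. z \<in> V2 \<Longrightarrow> \<exists>q\<in>Q. (adj E2)\<^sup>*\<^sup>* (f q) z"
    and ab: "a \<in> V1 \<union> V2" "b \<in> V1 \<union> V2"
  shows "(adj (glue E1 E2 Q))\<^sup>*\<^sup>* a b"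
proof -
  let ?R = "(adj (glue E1 E2 Q))\<^sup>*\<^sup>*"
  have to1: "\<exists>p\<in>V1. ?R p z" if z: "z \<in> V1 \<union> V2" for z
  proof (cases "z \<in> V1")
    case False
    then obtain q where q: "q \<in> Q" "(adj E2)\<^sup>*\<^sup>* (f q) z" using c2 z by blast
    have "adj (glue E1 E2 Q) q (f q)" using q by (auto simp: adj_def glue_def cross_def)
    moreover have "?R (f q) z" using q(2) by (rule adj_rtranclp_mono[rotated]) (auto simp: glue_def)
    ultimately have "?R q z" by (rule converse_rtranclp_into_rtranclp)
    then show ?thesis using q Q P by auto
  qed auto
  obtain p q where "p \<in> V1" "?R p a" "q \<in> V1" "?R q b" using to1 ab by metis
  moreover from this have "?R p q"
    by (intro adj_rtranclp_mono[OF _ c1]) (auto simp: glue_def)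
  ultimately show ?thesis using adj_rtranclp_sym by (meson rtranclp_trans)
qed

end

lemma cut_cross_right:
  assumes "S \<subseteq> V2"
  shows "card (cut_edges (cross P) S) = card (S \<inter> f ` P)"
proof -
  have "cut_edges (cross P) S = (\<lambda>p. {p, f p}) ` {p \<in> P. f p \<in> S}"
    using assms portD by (auto simp: cut_edges_def cross_def)
  moreover have "inj_on (\<lambda>p. {p, f p}) {p \<in> P. f p \<in> S}"
    using disj P img by (fastforce simp: inj_on_def doubleton_eq_iff)
  moreover have "S \<inter> f ` P = f ` {p \<in> P. f p \<in> S}" by auto
  moreover have "inj_on f {p \<in> P. f p \<in> S}" using inj by (auto simp: inj_on_def)
  ultimately show ?thesis by (simp add: card_image)
qed

lemma cut_cross_left:
  assumes "S \<subseteq> V1"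
  shows "card (cut_edges (cross P) S) = card (S \<inter> P)"
proof -
  have "cut_edges (cross P) S = (\<lambda>p. {p, f p}) ` (S \<inter> P)"
  proof -
    have "f p \<notin> S" if "p \<in> P" for p using portD[OF that] assms by auto
    then show ?thesis by (auto simp: cut_edges_def cross_def)
  qed
  moreover have "inj_on (\<lambda>p. {p, f p}) (S \<inter> P)"
    using disj P img by (fastforce simp: inj_on_def doubleton_eq_iff)
  ultimately show ?thesis by (simp add: card_image)
qed

lemma cut_glue_V2:
  assumes "simple_graph V1 E1" "simple_graph V2 E2"
  shows "cut_edges (glue E1 E2 P) V2 = cross P"
  using side1[OF assms subset_refl] side2[OF assms subset_refl] cross_sides[OF assms subset_refl] disj
  by (fastforce simp: cut_edges_def glue_def)

text \<open>For a set inside one piece the dangling edges have become connecting edges, so the pole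
  bound applies to the set or to its complement as it stands. A set that splits both pieces gets two
  cut edges from each of them.\<close>

lemma glue_poles:
  assumes p1: "pole V1 E1 P" and p2: "pole V2 E2 (f ` P)" and P4: "card P = 4"
    and ind: "\<And>p q. p \<in> P \<Longrightarrow> q \<in> P \<Longrightarrow> {f p, f q} \<notin> E2"
  shows "cubic (V1 \<union> V2) (glue E1 E2 P)"
    and "cyc_4_edge_connected (V1 \<union> V2) (glue E1 E2 P)"
    and "girth_ge (glue E1 E2 P) 5"
proof -
  let ?G = "glue E1 E2 P"
  have sg1: "simple_graph V1 E1" and sg2: "simple_graph V2 E2" using p1 p2 by (auto simp: pole_def)
  note sg = glue_simple[OF sg1 sg2 subset_refl]
  show cub: "cubic (V1 \<union> V2) ?G"
    using p1 p2 sg deg_glue_left[OF sg1 sg2 subset_refl] deg_glue_right[OF sg1 sg2 subset_refl]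
    by (auto simp: cubic_def pole_def)
  show "girth_ge ?G 5"
    using p1 p2 no_short_cycle_glue[OF sg1 sg2 subset_refl _ _ ind] by (simp add: girth_ge_5_iff pole_def)
  have fP4: "card (f ` P) = 4" using P4 inj by (simp add: card_image)
  note cg = cut_glue[OF sg1 sg2 subset_refl]
  have one_sided: "4 \<le> card (cut_edges ?G S)" if "2 \<le> card S" "S \<subseteq> V1 \<or> S \<subseteq> V2" for S
    using that(2)
  proof
    assume "S \<subseteq> V1"
    moreover from this have "4 \<le> card (cut_edges E1 S) + card (S \<inter> P)"
      using that(1) p1 unfolding pole_def by blast
    ultimately show ?thesis using cut_cross_left[of S] cg[of S] by simp
  next
    assume "S \<subseteq> V2"
    moreover from this have "4 \<le> card (cut_edges E2 S) + card (S \<inter> f ` P)"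
      using that(1) p2 unfolding pole_def by blast
    ultimately show ?thesis using cut_cross_right[of S] cg[of S] by simp
  qed
  show "cyc_4_edge_connected (V1 \<union> V2) ?G"
    unfolding cyc_4_edge_connected_iff[OF cub]
  proof (intro allI impI)
    fix S assume S: "S \<subseteq> V1 \<union> V2" "2 \<le> card S" "2 \<le> card (V1 \<union> V2 - S)"
    let ?S' = "V1 \<union> V2 - S"
    consider "S \<subseteq> V1 \<or> S \<subseteq> V2" | "?S' \<subseteq> V1 \<or> ?S' \<subseteq> V2"
      | "S \<inter> V1 \<noteq> {}" "S \<inter> V1 \<noteq> V1" "S \<inter> V2 \<noteq> {}" "S \<inter> V2 \<noteq> V2"
      using S(1) by blast
    then show "4 \<le> card (cut_edges ?G S)"
    proof cases
      case 1 then show ?thesis using one_sided S by blast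
    next
      case 2
      then have "4 \<le> card (cut_edges ?G ?S')" using one_sided S by blast
      then show ?thesis by (simp add: cut_edges_compl[OF sg])
    next
      case 3
      have "2 \<le> card (cut_edges E1 S)"
        using pole_cut_ge_2[OF p1 P4, of "S \<inter> V1"] 3 by (simp add: cut_edges_Int[OF sg1])
      moreover have "2 \<le> card (cut_edges E2 S)"
        using pole_cut_ge_2[OF p2 fP4, of "S \<inter> V2"] 3 by (simp add: cut_edges_Int[OF sg2])
      ultimately show ?thesis using cg[of S] by simp
    qed
  qed
qed

end

section \<open>Poles obtained from cyclically 4-edge-connected cubic graphs\<close>

text \<open>The set \<open>A\<close> is not confined to \<open>V\<close>: it will be a vertex set of
  a graph obtained from \<open>E\<close> by subdividing, of which only the trace on \<open>V\<close>
  matters. The first four cases are the degenerate traces, for which the cut of \<open>E\<close>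
  alone does not reach 4.\<close>

lemma cubic_cut_cases:
  assumes cub: "cubic V E" and cyc: "cyc_4_edge_connected V E"
  obtains "A \<inter> V = {}" | "V \<subseteq> A"
    | z where "z \<in> V" "A \<inter> V = {z}" "card (cut_edges E A) = 3"
    | z where "z \<in> V" "V - A = {z}" "card (cut_edges E A) = 3"
    | "4 \<le> card (cut_edges E A)"
proof -
  have sg: "simple_graph V E" and d: "\<And>z. z \<in> V \<Longrightarrow> deg E z = 3" using cub by (auto simp: cubic_def)
  have fin: "finite V" using sg by (simp add: simple_graph_def)
  have card: "card B = 0 \<or> card B = 1 \<or> 2 \<le> card B" for B :: "'a set" by auto
  have 4: "4 \<le> card (cut_edges E A)" if "2 \<le> card (A \<inter> V)" "2 \<le> card (V - A)"
  proof -
    have "V - A \<inter> V = V - A" by auto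
    then have "4 \<le> card (cut_edges E (A \<inter> V))"
      using cyc that unfolding cyc_4_edge_connected_iff[OF cub] by (metis Int_lower2)
    then show ?thesis by (simp add: cut_edges_Int[OF sg])
  qed
  have 1: "card (cut_edges E A) = 3" if "A \<inter> V = {z}" "z \<in> V" for z
    using that cut_edges_singleton[OF sg, of z] d cut_edges_Int[OF sg, of A] by simp
  have 2: "card (cut_edges E A) = 3" if "V - A = {z}" "z \<in> V" for z
    using that cut_edges_singleton[OF sg, of z] d cut_edges_compl[OF sg, of A] by simp
  from card[of "A \<inter> V"] show thesis
  proof (elim disjE)
    assume "card (A \<inter> V) = 0" then show thesis using that(1) fin by simp
  next
    assume "card (A \<inter> V) = 1"
    then obtain z where "A \<inter> V = {z}" by (rule card_1_singletonE)
    then show thesis using that(3)[of z] 1[of z] by blast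
  next
    assume A2: "2 \<le> card (A \<inter> V)"
    from card[of "V - A"] show thesis
    proof (elim disjE)
      assume "card (V - A) = 0" then show thesis using that(2) fin by auto
    next
      assume "card (V - A) = 1"
      then obtain z where "V - A = {z}" by (rule card_1_singletonE)
      then show thesis using that(4)[of z] 2[of z] by blast
    next
      assume "2 \<le> card (V - A)" then show thesis using that(5) 4 A2 by blast
    qed
  qed
qed

lemma card_Int_insert:
  "finite P \<Longrightarrow> x \<notin> P \<Longrightarrow> card (A \<inter> insert x P) = of_bool (x \<in> A) + card (A \<inter> P)"
  by (cases "x \<in> A") auto

lemma no_short_cycle_subset: "no_short_cycle E \<Longrightarrow> F \<subseteq> E \<Longrightarrow> no_short_cycle F"
  unfolding no_short_cycle_def by (meson subsetD)

lemma subdiv_edge_old: "{a, b} \<in> E \<Longrightarrow> {a, b} \<noteq> {u, w} \<Longrightarrow> {a, b} \<in> subdiv E u w p"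
  by (simp add: subdiv_def)

lemma no_triangle:
  "no_short_cycle E \<Longrightarrow> {a, b} \<in> E \<Longrightarrow> {b, c} \<in> E \<Longrightarrow> {c, a} \<in> E \<Longrightarrow> a \<noteq> b \<Longrightarrow> b \<noteq> c \<Longrightarrow> c \<noteq> a \<Longrightarrow> False"
  unfolding no_short_cycle_def by (metis distinct_length_2_or_more distinct_singleton)

text \<open>Deleting \<open>cd\<close> costs a cut edge only when \<open>A\<close> separates
  \<open>c\<close> from \<open>d\<close>, and then the one in \<open>A\<close> is a port and repays
  it. So a cut of \<open>E\<close> with four edges suffices, and only the degenerate traces of
  \<open>A\<close> on \<open>V\<close> need an argument.\<close>

lemma pole_subdivide_delete:
  assumes cub: "cubic V E" and cyc: "cyc_4_edge_connected V E" and ns: "no_short_cycle E"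
    and e: "{v, w1} \<in> E" "{v, w2} \<in> E" "w1 \<noteq> w2" and cd: "{c, d} \<in> E" "c \<noteq> v" "d \<noteq> v"
    and p: "p1 \<notin> V" "p2 \<notin> V" "p1 \<noteq> p2"
  shows "pole (insert p2 (insert p1 V)) (subdiv (subdiv (E - {{c, d}}) v w1 p1) v w2 p2) {p1, p2, c, d}"
    (is "pole ?V ?E ?P")
proof -
  have sg: "simple_graph V E" and d: "\<And>z. z \<in> V \<Longrightarrow> deg E z = 3" using cub by (auto simp: cubic_def)
  have fin: "finite E" "finite V" using simple_graph_finite[OF sg] sg by (auto simp: simple_graph_def)
  let ?D = "E - {{c, d}}" let ?E1 = "subdiv ?D v w1 p1"
  have mem: "c \<in> V" "d \<in> V" "c \<noteq> d" "v \<in> V" "w1 \<in> V" "w2 \<in> V" "v \<noteq> w1" "v \<noteq> w2"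
    using simple_graph_edge[OF sg cd(1)] simple_graph_edge[OF sg e(1)] simple_graph_edge[OF sg e(2)] by auto
  have s0: "simple_graph V ?D" by (rule simple_graph_subset[OF sg]) auto
  have e0: "{v, w1} \<in> ?D" "{v, w2} \<in> ?D" using e cd by (auto simp: doubleton_eq_iff)
  have e1: "{v, w2} \<in> ?E1" using e0(2) e(3) mem by (intro subdiv_edge_old) (auto simp: doubleton_eq_iff)
  note s1 = simple_graph_subdiv[OF s0 e0(1) p(1)]
  have p2': "p2 \<notin> insert p1 V" using p by auto
  note s2 = simple_graph_subdiv[OF s1 e1 p2']
  have deg0: "deg ?D z + of_bool (z \<in> {c, d}) = 3" if "z \<in> V" for z
    using deg_remove[OF fin(1) cd(1), of z] d[OF that] by simp
  have "deg ?E z + of_bool (z \<in> ?P) = 3" if "z \<in> ?V" for z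
  proof -
    consider "z = p2" | "z = p1" | "z \<in> V" using \<open>z \<in> ?V\<close> by auto
    then show ?thesis
    proof cases
      case 1 then show ?thesis using deg_subdiv_new[OF s1 e1 p2'] by simp
    next
      case 2
      then show ?thesis using deg_subdiv[OF s1 e1 p2', of z] deg_subdiv_new[OF s0 e0(1) p(1)] by simp
    next
      case 3
      then show ?thesis
        using deg_subdiv[OF s1 e1 p2', of z] deg_subdiv[OF s0 e0(1) p(1), of z] deg0[of z] p by auto
    qed
  qed
  moreover have "no_short_cycle ?E"
    by (intro no_short_cycle_subdiv[OF s1 e1 p2'] no_short_cycle_subdiv[OF s0 e0(1) p(1)]
        no_short_cycle_subset[OF ns]) auto
  moreover have "4 \<le> card (cut_edges ?E A) + card (A \<inter> ?P)" if A: "A \<subseteq> ?V" "2 \<le> card A" for A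
  proof -
    have PA: "card (A \<inter> ?P) = of_bool (p1 \<in> A) + of_bool (p2 \<in> A) + of_bool (c \<in> A) + of_bool (d \<in> A)"
      using p mem by (subst card_Int_insert, simp, force)+ simp
    have cA: "card A = of_bool (p2 \<in> A) + of_bool (p1 \<in> A) + card (A \<inter> V)"
    proof -
      have "card A = card (A \<inter> ?V)" using A(1) by (simp add: Int_absorb2)
      then show ?thesis using p fin by (simp add: card_Int_insert)
    qed
    have cut: "card (cut_edges ?E A) + of_bool ((c \<in> A) \<noteq> (d \<in> A)) = card (cut_edges E A) +
        (if (v \<in> A) = (w1 \<in> A) \<and> (p1 \<in> A) \<noteq> (v \<in> A) then 2 else 0) +
        (if (v \<in> A) = (w2 \<in> A) \<and> (p2 \<in> A) \<noteq> (v \<in> A) then 2 else 0)"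
      unfolding cut_subdiv[OF s1 e1 p2'] cut_subdiv[OF s0 e0(1) p(1)]
      using cut_edges_remove[OF fin(1) cd(1), of A] by simp
    from cubic_cut_cases[OF cub cyc, of A] show ?thesis
    proof cases
      \<comment> \<open>Here \<open>A\<close> consists of both new vertices: four cut edges and two
        ports.\<close>
      case 1
      then have "u \<notin> A" if "u \<in> V" for u using that by auto
      then show ?thesis using cA PA cut A(2) 1 mem by (auto simp: of_bool_def split: if_splits)
    next
      case 2
      then show ?thesis using PA cut mem by (auto simp: of_bool_def split: if_splits)
    next
      case (3 z)
      then have "u \<in> A \<longleftrightarrow> u = z" if "u \<in> V" for u using that by auto
      then have "c \<in> A \<longleftrightarrow> c = z" "d \<in> A \<longleftrightarrow> d = z" using mem by auto
      \<comment> \<open>Since \<open>A\<close> has two vertices but only one in \<open>V\<close>, it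
        contains a new one, and this port raises the 3 of the single vertex to 4.\<close>
      moreover have "p1 \<in> A \<or> p2 \<in> A" using cA A(2) 3(2) by (auto simp: of_bool_def split: if_splits)
      ultimately show ?thesis using PA cut 3(3) mem by (auto simp: of_bool_def split: if_splits)
    next
      case (4 z)
      then have "u \<in> A \<longleftrightarrow> u \<noteq> z" if "u \<in> V" for u using that by auto
      then have "c \<in> A \<longleftrightarrow> c \<noteq> z" "d \<in> A \<longleftrightarrow> d \<noteq> z" "v \<in> A \<longleftrightarrow> v \<noteq> z"
        "w1 \<in> A \<longleftrightarrow> w1 \<noteq> z" "w2 \<in> A \<longleftrightarrow> w2 \<noteq> z" using mem by auto
      \<comment> \<open>If \<open>z\<close> is an end of the deleted edge, then \<open>v\<close> and
        one of \<open>w1\<close>, \<open>w2\<close> lie in \<open>A\<close>; the new vertex between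
        them is a port in \<open>A\<close> or is cut off by two edges. Otherwise \<open>c\<close>
        and \<open>d\<close> are two ports in \<open>A\<close>.\<close>
      then show ?thesis using PA cut 4(3) mem e(3) cd by (auto simp: of_bool_def split: if_splits)
    next
      case 5
      then show ?thesis using PA cut by (auto simp: of_bool_def split: if_splits)
    qed
  qed
  ultimately show ?thesis using s2 mem by (auto simp: pole_def)
qed

text \<open>Each new vertex in \<open>A\<close> is a port, and each one outside \<open>A\<close>
  adds two cut edges once both ends of its edge are in \<open>A\<close>. The inequalities on
  \<open>v\<close> keep the four subdivided edges distinct, while \<open>v\<close> and
  \<open>v'\<close> themselves may be adjacent.\<close>

lemma pole_subdivide4:
  assumes cub: "cubic V E" and cyc: "cyc_4_edge_connected V E" and ns: "no_short_cycle E"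
    and e: "{v, w1} \<in> E" "{v, w2} \<in> E" "w1 \<noteq> w2"
    and e': "{v', w1'} \<in> E" "{v', w2'} \<in> E" "w1' \<noteq> w2'"
    and ne: "v \<noteq> v'" "v \<noteq> w1'" "v \<noteq> w2'"
    and p: "distinct [p1, p2, q1, q2]" "{p1, p2, q1, q2} \<inter> V = {}"
  shows "pole ({p1, p2, q1, q2} \<union> V)
    (subdiv (subdiv (subdiv (subdiv E v w1 p1) v w2 p2) v' w1' q1) v' w2' q2) {p1, p2, q1, q2}"
    (is "pole ?V ?E ?P")
proof -
  have sg: "simple_graph V E" and d: "\<And>z. z \<in> V \<Longrightarrow> deg E z = 3" using cub by (auto simp: cubic_def)
  have fin: "finite E" "finite V" using simple_graph_finite[OF sg] sg by (auto simp: simple_graph_def)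
  have mem: "v \<in> V" "w1 \<in> V" "w2 \<in> V" "v \<noteq> w1" "v \<noteq> w2" "v' \<in> V" "w1' \<in> V" "w2' \<in> V" "v' \<noteq> w1'" "v' \<noteq> w2'"
    using simple_graph_edge[OF sg e'(1)] simple_graph_edge[OF sg e'(2)]
      simple_graph_edge[OF sg e(1)] simple_graph_edge[OF sg e(2)] by auto
  let ?E1 = "subdiv E v w1 p1" let ?E2 = "subdiv ?E1 v w2 p2" let ?E3 = "subdiv ?E2 v' w1' q1"
  let ?V1 = "insert p1 V" let ?V2 = "insert p2 ?V1" let ?V3 = "insert q1 ?V2"
  have dj: "{v, w2} \<noteq> {v, w1}" "{v', w1'} \<noteq> {v, w1}" "{v', w1'} \<noteq> {v, w2}"
    "{v', w2'} \<noteq> {v, w1}" "{v', w2'} \<noteq> {v, w2}" "{v', w2'} \<noteq> {v', w1'}"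
    using e(3) e'(3) ne by (auto simp: doubleton_eq_iff)
  have n: "p1 \<notin> V" "p2 \<notin> ?V1" "q1 \<notin> ?V2" "q2 \<notin> ?V3" using p by auto
  have e1: "{v, w2} \<in> ?E1" using e dj by (intro subdiv_edge_old)
  have e2: "{v', w1'} \<in> ?E2" using e' dj by (intro subdiv_edge_old)
  have e3: "{v', w2'} \<in> ?E3" using e' dj by (intro subdiv_edge_old)
  note s1 = simple_graph_subdiv[OF sg e(1) n(1)]
  note s2 = simple_graph_subdiv[OF s1 e1 n(2)]
  note s3 = simple_graph_subdiv[OF s2 e2 n(3)]
  note s4 = simple_graph_subdiv[OF s3 e3 n(4)]
  have V: "?V = insert q2 ?V3" by auto
  note ds = deg_subdiv[OF s3 e3 n(4)] deg_subdiv[OF s2 e2 n(3)] deg_subdiv[OF s1 e1 n(2)]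
    deg_subdiv[OF sg e(1) n(1)]
    deg_subdiv_new[OF s3 e3 n(4)] deg_subdiv_new[OF s2 e2 n(3)] deg_subdiv_new[OF s1 e1 n(2)]
    deg_subdiv_new[OF sg e(1) n(1)]
  have "deg ?E z + of_bool (z \<in> ?P) = 3" if "z \<in> ?V" for z
  proof -
    consider "z = p1" | "z = p2" | "z = q1" | "z = q2" | "z \<in> V" using \<open>z \<in> ?V\<close> by auto
    then show ?thesis
    proof cases
      case 5
      then have "z \<notin> ?P" using p by auto
      then show ?thesis using 5 ds d by simp
    qed (simp_all add: ds)
  qed
  moreover have "no_short_cycle ?E"
    by (intro no_short_cycle_subdiv[OF s3 e3 n(4)] no_short_cycle_subdiv[OF s2 e2 n(3)]
        no_short_cycle_subdiv[OF s1 e1 n(2)] no_short_cycle_subdiv[OF sg e(1) n(1)] ns)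
  moreover have "4 \<le> card (cut_edges ?E A) + card (A \<inter> ?P)" if A: "A \<subseteq> ?V" "2 \<le> card A" for A
  proof -
    have PA: "card (A \<inter> ?P) = of_bool (p1 \<in> A) + of_bool (p2 \<in> A) + of_bool (q1 \<in> A) + of_bool (q2 \<in> A)"
      using p by (subst card_Int_insert, simp, force)+ simp
    have cA: "card A = card (A \<inter> ?P) + card (A \<inter> V)"
    proof -
      have "A = (A \<inter> ?P) \<union> (A \<inter> V)" using A(1) by auto
      then have "card A = card ((A \<inter> ?P) \<union> (A \<inter> V))" by simp
      also have "\<dots> = card (A \<inter> ?P) + card (A \<inter> V)" using fin p by (intro card_Un_disjoint) auto
      finally show ?thesis .
    qed
    have cut: "card (cut_edges ?E A) = card (cut_edges E A) +
        (if (v \<in> A) = (w1 \<in> A) \<and> (p1 \<in> A) \<noteq> (v \<in> A) then 2 else 0) +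
        (if (v \<in> A) = (w2 \<in> A) \<and> (p2 \<in> A) \<noteq> (v \<in> A) then 2 else 0) +
        (if (v' \<in> A) = (w1' \<in> A) \<and> (q1 \<in> A) \<noteq> (v' \<in> A) then 2 else 0) +
        (if (v' \<in> A) = (w2' \<in> A) \<and> (q2 \<in> A) \<noteq> (v' \<in> A) then 2 else 0)"
      unfolding cut_subdiv[OF s3 e3 n(4)] cut_subdiv[OF s2 e2 n(3)] cut_subdiv[OF s1 e1 n(2)]
        cut_subdiv[OF sg e(1) n(1)] by simp
    from cubic_cut_cases[OF cub cyc, of A] show ?thesis
    proof cases
      case 1
      then have "v \<notin> A" "w1 \<notin> A" "w2 \<notin> A" "v' \<notin> A" "w1' \<notin> A" "w2' \<notin> A" using mem by auto
      then show ?thesis using cA PA cut A(2) 1 by (auto simp: of_bool_def split: if_splits)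
    next
      case 2
      then have "v \<in> A" "w1 \<in> A" "w2 \<in> A" "v' \<in> A" "w1' \<in> A" "w2' \<in> A" using mem by auto
      then show ?thesis using PA cut by (auto simp: of_bool_def split: if_splits)
    next
      case (3 z)
      then have "1 \<le> card (A \<inter> ?P)" using cA A(2) by simp
      then show ?thesis using cut 3(3) by linarith
    next
      case (4 z)
      show ?thesis
      proof (cases "p1 \<in> A \<or> p2 \<in> A \<or> q1 \<in> A \<or> q2 \<in> A")
        case True
        then have "1 \<le> card (A \<inter> ?P)" using PA by auto
        then show ?thesis using cut 4(3) by linarith
      next
        case False
        have *: "u \<in> A \<longleftrightarrow> u \<noteq> z" if "u \<in> V" for u using that 4 by auto
        \<comment> \<open>The only vertex of \<open>V\<close> outside \<open>A\<close> cannot meet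
          all subdivided edges: if it is \<open>v\<close>, the edge from \<open>v'\<close> to
          \<open>w1'\<close> avoids it, and otherwise one of the two edges at \<open>v\<close> does.
          That edge adds two.\<close>
        have "(v \<in> A \<and> w1 \<in> A) \<or> (v \<in> A \<and> w2 \<in> A) \<or> (v' \<in> A \<and> w1' \<in> A)"
          using * mem e(3) ne by metis
        then show ?thesis using False cut 4(3) by auto
      qed
    next
      case 5
      then show ?thesis using cut by linarith
    qed
  qed
  ultimately show ?thesis using s4 unfolding pole_def V by auto
qed

section \<open>Deleting two adjacent vertices\<close>

definition del2 :: "'a set set \<Rightarrow> 'a \<Rightarrow> 'a \<Rightarrow> 'a set set" where
  "del2 F x y = {e \<in> F. x \<notin> e \<and> y \<notin> e}"

lemma deg_del2:
  assumes sg: "simple_graph V F" and z: "z \<noteq> x" "z \<noteq> y" and xy: "x \<noteq> y"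
    and tri: "\<not> ({z, x} \<in> F \<and> {z, y} \<in> F)"
  shows "deg F z = deg (del2 F x y) z + of_bool ({z, x} \<in> F \<or> {z, y} \<in> F)"
proof -
  have fin: "finite F" by (rule simple_graph_finite[OF sg])
  have e: "e = {z, t}" if "e \<in> F" "z \<in> e" "t \<in> e" "t \<noteq> z" for e t
  proof -
    obtain a b where "e = {a, b}" using sg \<open>e \<in> F\<close> by (blast elim: simple_graph_edgeE)
    then show ?thesis using that by auto
  qed
  let ?D = "{e. e = {z, x} \<and> e \<in> F \<or> e = {z, y} \<and> e \<in> F}"
  have D: "inc F z = inc (del2 F x y) z \<union> ?D"
    using e[of _ x] e[of _ y] z by (auto simp: del2_def)
  have cD: "card ?D = of_bool ({z, x} \<in> F \<or> {z, y} \<in> F)"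
  proof (cases "{z, x} \<in> F")
    case True
    then have "?D = {{z, x}}" using tri by auto
    then show ?thesis using True by simp
  next
    case False
    then have "?D = (if {z, y} \<in> F then {{z, y}} else {})" by auto
    then show ?thesis using False by simp
  qed
  have fD: "finite ?D" using fin by (rule rev_finite_subset) auto
  show ?thesis
    unfolding deg_def D using fin fD by (subst card_Un_disjoint) (auto simp: cD del2_def)
qed

definition ends2 :: "'a set \<Rightarrow> 'a set set \<Rightarrow> 'a \<Rightarrow> 'a \<Rightarrow> 'a set" where
  "ends2 V F x y = {z \<in> V - {x, y}. {z, x} \<in> F \<or> {z, y} \<in> F}"

lemma simple_graph_del2: "simple_graph V F \<Longrightarrow> simple_graph (V - {x, y}) (del2 F x y)"
  unfolding simple_graph_def del2_def by blast

text \<open>For a set avoiding \<open>x\<close> and \<open>y\<close>, the remaining cut edges and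
  the dangling edges together are exactly its cut in \<open>E\<close>; its complement contains both
  deleted vertices, so this cut has four edges. Two adjacent ports would close a triangle with a
  common deleted neighbour, or a quadrilateral through the edge \<open>xy\<close>.\<close>

lemma pole_del2:
  assumes cub: "cubic V E" and cyc: "cyc_4_edge_connected V E" and ns: "no_short_cycle E"
    and xy: "{x, y} \<in> E"
  shows "pole (V - {x, y}) (del2 E x y) (ends2 V E x y)" (is "pole ?V ?E ?P")
    and "a \<in> ends2 V E x y \<Longrightarrow> b \<in> ends2 V E x y \<Longrightarrow> {a, b} \<notin> del2 E x y"
proof -
  have sg: "simple_graph V E" and d: "\<And>z. z \<in> V \<Longrightarrow> deg E z = 3" using cub by (auto simp: cubic_def)
  have fin: "finite E" "finite V" using simple_graph_finite[OF sg] sg by (auto simp: simple_graph_def)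
  note s0 = simple_graph_del2[OF sg, of x y]
  have xyV: "x \<noteq> y" "x \<in> V" "y \<in> V" using simple_graph_edge[OF sg xy] by auto
  have tri: "\<not> ({z, x} \<in> E \<and> {z, y} \<in> E)" if "z \<noteq> x" "z \<noteq> y" for z
    using no_triangle[OF ns xy, of z] that xyV by (auto simp: insert_commute)
  have dg: "deg E z = deg ?E z + of_bool (z \<in> ?P)" if "z \<in> ?V" for z
    using deg_del2[OF sg, of z x y] that xyV tri[of z] by (auto simp: ends2_def)
  have cut: "card (cut_edges E A) = card (cut_edges ?E A) + card (A \<inter> ?P)" if A: "A \<subseteq> ?V" for A
  proof -
    have finA: "finite A" using A fin finite_subset by blast
    have "{e \<in> E. e \<subseteq> A} = {e \<in> ?E. e \<subseteq> A}" using A by (auto simp: del2_def)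
    moreover have "(\<Sum>z\<in>A. deg E z) = (\<Sum>z\<in>A. deg ?E z) + (\<Sum>z\<in>A. of_bool (z \<in> ?P))"
      using A dg by (simp add: sum.distrib[symmetric] subset_eq)
    moreover have "(\<Sum>z\<in>A. of_bool (z \<in> ?P)) = card (A \<inter> ?P)"
      using finA by (simp add: of_bool_def sum.If_cases)
    ultimately show ?thesis using handshake[OF sg finA] handshake[OF s0 finA] by simp
  qed
  have "4 \<le> card (cut_edges ?E A) + card (A \<inter> ?P)" if A: "A \<subseteq> ?V" "2 \<le> card A" for A
  proof -
    have "card {x, y} \<le> card (V - A)" using A xyV fin by (intro card_mono) auto
    then have "4 \<le> card (cut_edges E A)"
      using cyc A xyV unfolding cyc_4_edge_connected_iff[OF cub] by (simp add: subset_iff)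
    then show ?thesis using cut[OF A(1)] by simp
  qed
  moreover have "?P \<subseteq> ?V" by (auto simp: ends2_def)
  moreover have "no_short_cycle ?E" by (rule no_short_cycle_subset[OF ns]) (auto simp: del2_def)
  moreover have "\<forall>z\<in>?V. deg ?E z + of_bool (z \<in> ?P) = 3"
  proof
    fix z assume z: "z \<in> ?V"
    show "deg ?E z + of_bool (z \<in> ?P) = 3" using dg[OF z] d[of z] z by simp
  qed
  ultimately show "pole ?V ?E ?P" using s0 unfolding pole_def by blast
  show "{a, b} \<notin> ?E" if ab: "a \<in> ?P" "b \<in> ?P"
  proof
    assume "{a, b} \<in> ?E"
    then have E: "{a, b} \<in> E" "a \<noteq> b" using simple_graph_edge(1)[OF s0, of a b] by (auto simp: del2_def)
    have n: "a \<noteq> x" "a \<noteq> y" "b \<noteq> x" "b \<noteq> y" using ab by (auto simp: ends2_def)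
    have "{a, x} \<in> E \<or> {a, y} \<in> E" "{b, x} \<in> E \<or> {b, y} \<in> E" using ab by (auto simp: ends2_def)
    moreover have "\<not> ({a, t} \<in> E \<and> {b, t} \<in> E)" if "t \<noteq> a" "t \<noteq> b" for t
      using no_triangle[OF ns E(1), of t] E(2) that by (auto simp: insert_commute)
    moreover have "\<not> ({a, x} \<in> E \<and> {b, y} \<in> E)" "\<not> ({a, y} \<in> E \<and> {b, x} \<in> E)"
    proof -
      have *: "\<not> ({a, s} \<in> E \<and> {b, t} \<in> E)" if "{s, t} \<in> E" "distinct [a, s, t, b]" for s t
      proof
        assume h: "{a, s} \<in> E \<and> {b, t} \<in> E"
        then have "{t, b} \<in> E" "{b, a} \<in> E" using E by (simp_all add: insert_commute)
        then show False using h that ns unfolding no_short_cycle_def by blast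
      qed
      show "\<not> ({a, x} \<in> E \<and> {b, y} \<in> E)" using *[of x y] xy n xyV E by auto
      show "\<not> ({a, y} \<in> E \<and> {b, x} \<in> E)" using *[of y x] xy n xyV E by (auto simp: insert_commute)
    qed
    ultimately show False using n by metis
  qed
qed

section \<open>Three-edge-colourings\<close>

text \<open>In a cubic graph a colouring is proper exactly if every vertex sees all three colours.
  This form carries over to dangling edges: their colours at \<open>z\<close> are collected in a set
  \<open>g z\<close> and united with those of the actual edges.\<close>

lemma colourable_vertexwise:
  assumes "cubic V E" "three_edge_colourable E"
  obtains c :: "'a set \<Rightarrow> nat" where "\<And>z. z \<in> V \<Longrightarrow> c ` inc E z = {..<3}"
proof -
  obtain c :: "'a set \<Rightarrow> nat" where c: "\<And>e. e \<in> E \<Longrightarrow> c e < 3"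
    "\<And>e f. e \<in> E \<Longrightarrow> f \<in> E \<Longrightarrow> e \<noteq> f \<Longrightarrow> e \<inter> f \<noteq> {} \<Longrightarrow> c e \<noteq> c f"
    using assms(2) unfolding three_edge_colourable_def by metis
  have "c ` inc E z = {..<3}" if "z \<in> V" for z
  proof -
    have "inj_on c (inc E z)"
    proof (rule inj_onI)
      fix e f assume ef: "e \<in> inc E z" "f \<in> inc E z" "c e = c f"
      then have "e \<inter> f \<noteq> {}" by auto
      then show "e = f" using c(2)[of e f] ef by auto
    qed
    then have "card (c ` inc E z) = 3" using assms(1) that by (simp add: card_image cubic_def deg_def)
    moreover have "c ` inc E z \<subseteq> {..<3}" using c(1) by auto
    ultimately show ?thesis by (intro card_subset_eq) auto
  qed
  then show thesis using that by blast
qed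

lemma colourableI:
  fixes c :: "'a set \<Rightarrow> nat"
  assumes "cubic V E" "\<And>z. z \<in> V \<Longrightarrow> c ` inc E z = {..<3}"
  shows "three_edge_colourable E"
  unfolding three_edge_colourable_def
proof (intro exI[of _ c] conjI ballI impI)
  have sg: "simple_graph V E" using assms(1) by (simp add: cubic_def)
  fix e assume e: "e \<in> E"
  then obtain a b where "e = {a, b}" "a \<in> V" using sg by (blast elim: simple_graph_edgeE)
  then have "c e \<in> c ` inc E a" using e by auto
  then show "c e < 3" using assms(2) \<open>a \<in> V\<close> by auto
  fix f assume f: "f \<in> E" "e \<noteq> f \<and> e \<inter> f \<noteq> {}"
  then obtain z where z: "z \<in> e" "z \<in> f" by auto
  have "z \<in> V" using simple_graph_notin[OF sg _ e, of z] z by blast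
  then have "card (c ` inc E z) = card (inc E z)"
    using assms by (simp add: cubic_def deg_def)
  moreover have "finite (inc E z)" using simple_graph_finite[OF sg] by simp
  ultimately have "inj_on c (inc E z)" by (intro eq_card_imp_inj_on)
  then show "c e \<noteq> c f" using e f z by (auto dest: inj_onD)
qed

lemma not_all_colours: "{a, b} \<noteq> {..<3 :: nat}"
proof
  assume "{a, b} = {..<3 :: nat}"
  then have "card {a, b} = 3" by simp
  then show False using card_insert_le_m1[of 2 "{b}" a] by (cases "a = b") auto
qed

text \<open>The two subdivision vertices see the same dangling colour, so contracting them back amounts
  to interchanging the colours of the two subdivided edges at \<open>v\<close>.\<close>
lemma unsubdivide_colouring:
  fixes c :: "'a set \<Rightarrow> nat"
  assumes sg: "simple_graph V E" and e: "{v, w1} \<in> E" "{v, w2} \<in> E" "w1 \<noteq> w2" and deg: "deg E v = 3"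
    and p: "p1 \<notin> V" "p2 \<notin> V" "p1 \<noteq> p2"
    and c: "\<And>z. z \<in> insert p2 (insert p1 V) \<Longrightarrow>
      c ` inc (subdiv (subdiv E v w1 p1) v w2 p2) z \<union> g z = {..<3}"
    and g: "g v = {}" "g p1 = {k}" "g p2 = {k}"
  obtains c' :: "'a set \<Rightarrow> nat" where "\<And>z. z \<in> V \<Longrightarrow> c' ` inc E z \<union> g z = {..<3}"
proof -
  define E0 where "E0 = E - {{v, w1}, {v, w2}}"
  let ?S = "subdiv (subdiv E v w1 p1) v w2 p2"
  have mem: "v \<in> V" "w1 \<in> V" "w2 \<in> V" "v \<noteq> w1" "v \<noteq> w2"
    using simple_graph_edge[OF sg e(1)] simple_graph_edge[OF sg e(2)] by auto
  have ne: "p1 \<noteq> v" "p1 \<noteq> w1" "p1 \<noteq> w2" "p2 \<noteq> v" "p2 \<noteq> w1" "p2 \<noteq> w2" using mem p by auto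
  have S: "?S = {{v, p1}, {p1, w1}, {v, p2}, {p2, w2}} \<union> E0"
    using ne p e mem unfolding subdiv_def E0_def by (auto simp: doubleton_eq_iff)
  have E: "E = {{v, w1}, {v, w2}} \<union> E0" using e by (auto simp: E0_def)
  have pE0: "p1 \<notin> f" "p2 \<notin> f" if "f \<in> E0" for f
    using that p simple_graph_notin[OF sg] by (auto simp: E0_def)
  have "inc ?S p1 = {{v, p1}, {p1, w1}}" unfolding S using pE0 ne p by auto
  then have c1: "{c {v, p1}, c {p1, w1}, k} = {..<3}" using c[of p1] g by (simp add: insert_commute)
  have "inc ?S p2 = {{v, p2}, {p2, w2}}" unfolding S using pE0 ne p by auto
  then have c2: "{c {v, p2}, c {p2, w2}, k} = {..<3}" using c[of p2] g by (simp add: insert_commute)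
  have iv: "inc ?S v = {{v, p1}, {v, p2}} \<union> inc E0 v" unfolding S using ne mem by auto
  \<comment> \<open>Otherwise \<open>v\<close> would see only this colour and that of its one
    remaining edge.\<close>
  have "c {v, p1} \<noteq> c {v, p2}"
  proof
    assume eq: "c {v, p1} = c {v, p2}"
    have "inc E v = {{v, w1}, {v, w2}} \<union> inc E0 v" using E by auto
    moreover have "{v, w1} \<notin> inc E0 v" "{v, w2} \<notin> inc E0 v" "{v, w1} \<noteq> {v, w2}"
      using e by (auto simp: E0_def doubleton_eq_iff)
    moreover have "finite (inc E0 v)" using simple_graph_finite[OF sg] by (simp add: E0_def)
    ultimately have "card (inc E0 v) = 1" using deg by (simp add: deg_def)
    then obtain f where "inc E0 v = {f}" by (rule card_1_singletonE)
    then have "c ` inc ?S v = {c {v, p1}, c f}" using iv eq by auto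
    then show False using c[of v] g(1) mem not_all_colours by simp
  qed
  \<comment> \<open>At each of \<open>p1\<close> and \<open>p2\<close> the two actual edges carry
    the two colours other than \<open>k\<close>. As the edges towards \<open>v\<close> differ in
    colour, each outer edge has the colour of the other inner one.\<close>
  then have sw: "c {p1, w1} = c {v, p2}" "c {p2, w2} = c {v, p1}"
  proof -
    have "c {v, p1} \<noteq> k" using c1 not_all_colours[of "c {p1, w1}" k] by (auto simp: insert_commute)
    moreover have "c {v, p2} \<noteq> k"
      using c2 not_all_colours[of "c {p2, w2}" k] by (auto simp: insert_commute)
    moreover have "c {v, p2} \<in> {c {v, p1}, c {p1, w1}, k}" "c {v, p1} \<in> {c {v, p2}, c {p2, w2}, k}"
      by (simp only: c1 c2[symmetric], simp) (simp only: c2 c1[symmetric], simp)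
    ultimately show "c {p1, w1} = c {v, p2}" "c {p2, w2} = c {v, p1}"
      using \<open>c {v, p1} \<noteq> c {v, p2}\<close> by auto
  qed
  define c' where "c' = c({v, w1} := c {p1, w1}, {v, w2} := c {p2, w2})"
  have c'0: "c' ` inc E0 z = c ` inc E0 z" for z
    by (intro image_cong) (auto simp: c'_def E0_def)
  have c'1: "c' {v, w1} = c {p1, w1}" "c' {v, w2} = c {p2, w2}"
    using e by (auto simp: c'_def doubleton_eq_iff)
  have "c' ` inc E z = c ` inc ?S z" if z: "z \<in> V" for z
  proof (cases "z = v")
    case True
    then have "inc E z = {{v, w1}, {v, w2}} \<union> inc E0 z" unfolding E by auto
    then have "c' ` inc E z = {c {p1, w1}, c {p2, w2}} \<union> c ` inc E0 z"
      by (simp add: image_Un c'0 c'1)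
    also have "\<dots> = c ` inc ?S z" unfolding True iv by (auto simp: sw)
    finally show ?thesis .
  next
    case False
    have "inc E z = (if z = w1 then {{v, w1}} else {}) \<union> (if z = w2 then {{v, w2}} else {}) \<union> inc E0 z"
      unfolding E using False by auto
    moreover have "inc ?S z =
        (if z = w1 then {{p1, w1}} else {}) \<union> (if z = w2 then {{p2, w2}} else {}) \<union> inc E0 z"
      unfolding S using False z p by auto
    ultimately show ?thesis using e(3) by (simp add: image_Un c'0 c'1)
  qed
  then show thesis using that[of c'] c by auto
qed

text \<open>The common dangling colour at the two ends becomes the colour of the restored
  edge.\<close>

lemma undelete_colouring:
  fixes c :: "'a set \<Rightarrow> nat"
  assumes ab: "{a, b} \<in> E" and c: "\<And>z. z \<in> V \<Longrightarrow> c ` inc (E - {{a, b}}) z \<union> g z = {..<3}"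
    and g: "g a = {k}" "g b = {k}" "\<And>z. z \<notin> {a, b} \<Longrightarrow> g z = {}"
  obtains c' :: "'a set \<Rightarrow> nat" where "\<And>z. z \<in> V \<Longrightarrow> c' ` inc E z = {..<3}"
proof -
  define c' where "c' = c({a, b} := k)"
  have "c' ` inc E z = c ` inc (E - {{a, b}}) z \<union> g z" for z
  proof -
    have "inc E z = inc (E - {{a, b}}) z \<union> (if z \<in> {a, b} then {{a, b}} else {})" using ab by auto
    moreover have "c' ` inc (E - {{a, b}}) z = c ` inc (E - {{a, b}}) z"
      by (intro image_cong) (auto simp: c'_def)
    moreover have "g z = (if z \<in> {a, b} then {k} else {})" using g by (cases "z \<in> {a, b}") auto
    moreover have "c' {a, b} = k" by (simp add: c'_def)
    ultimately show ?thesis by (simp only: image_Un) simp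
  qed
  then show thesis using that[of c'] c by simp
qed

text \<open>A colour class meets every vertex exactly once, so the vertices of \<open>S\<close> not
  matched inside \<open>S\<close> are as many as the crossing edges of that colour; the others come
  in pairs.\<close>

lemma colour_parity:
  fixes c :: "'a set \<Rightarrow> nat"
  assumes cub: "cubic V E" and c: "\<And>z. z \<in> V \<Longrightarrow> c ` inc E z = {..<3}"
    and S: "S \<subseteq> V" "even (card S)" and i: "i < 3"
  shows "even (card {e \<in> cut_edges E S. c e = i})"
proof -
  have sg: "simple_graph V E" using cub by (simp add: cubic_def)
  let ?F = "{e \<in> E. c e = i}"
  have sgF: "simple_graph V ?F" by (rule simple_graph_subset[OF sg]) auto
  have finS: "finite S" using S sg finite_subset by (auto simp: simple_graph_def)
  have "deg ?F z = 1" if z: "z \<in> V" for z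
  proof -
    have "card (c ` inc E z) = card (inc E z)" using c[OF z] cub z by (simp add: cubic_def deg_def)
    moreover have "finite (inc E z)" using simple_graph_finite[OF sg] by simp
    ultimately have inj: "inj_on c (inc E z)" by (intro eq_card_imp_inj_on)
    have "i \<in> c ` inc E z" using c[OF z] i by simp
    then obtain e where e: "e \<in> inc E z" "c e = i" by auto
    then have "inc ?F z = {e}" using inj by (auto dest: inj_onD)
    then show ?thesis by (simp add: deg_def)
  qed
  then have "(\<Sum>z\<in>S. deg ?F z) = card S" using S by (simp add: subset_eq)
  moreover have "cut_edges ?F S = {e \<in> cut_edges E S. c e = i}" by (auto simp: cut_edges_def)
  ultimately have "card S = 2 * card {e \<in> ?F. e \<subseteq> S} + card {e \<in> cut_edges E S. c e = i}"
    using handshake[OF sgF finS] by simp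
  then show ?thesis using S(2) by presburger
qed

lemma cubic_even_card:
  assumes "cubic V E"
  shows "even (card V)"
proof -
  have sg: "simple_graph V E" and fin: "finite V" using assms by (auto simp: cubic_def simple_graph_def)
  have "even (\<Sum>v\<in>V. deg E v)"
    using simple_graph_edge(3)[OF sg] by (intro even_sum_deg_closed[OF sg fin]) auto
  moreover have "(\<Sum>v\<in>V. deg E v) = 3 * card V" using assms by (simp add: cubic_def)
  ultimately show ?thesis by simp
qed

text \<open>Both pairs of dangling colours miss the same colour \<open>m\<close>, which is therefore
  free for the edge \<open>xy\<close> at both of its ends.\<close>

lemma del2_colouring:
  fixes c :: "'a set \<Rightarrow> nat"
  assumes sg: "simple_graph V E"
    and x: "inc E x = {{x, y}, {x, r}, {x, s}}" and y: "inc E y = {{x, y}, {y, t}, {y, u}}"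
    and dist: "distinct [x, y, r, s, t, u]"
    and c: "\<And>z. z \<in> V - {x, y} \<Longrightarrow> c ` inc (del2 E x y) z \<union> g z = {..<3}"
    and g: "g r = {kr}" "g s = {ks}" "g t = {kt}" "g u = {ku}"
      "\<And>z. z \<in> V - {x, y, r, s, t, u} \<Longrightarrow> g z = {}"
    and k: "{kr, ks} = {kt, ku}" "kr \<noteq> ks" "kr < 3" "ks < 3"
  obtains c' :: "'a set \<Rightarrow> nat" where "\<And>z. z \<in> V \<Longrightarrow> c' ` inc E z = {..<3}"
proof -
  have "card {kr, ks} = 2" using k(2) by simp
  moreover have sub: "{kr, ks} \<subseteq> {..<3}" using k(3,4) by simp
  ultimately have "card ({..<3} - {kr, ks}) = 1" by (subst card_Diff_subset) simp_all
  then obtain m where m: "{..<3} - {kr, ks} = {m}" by (rule card_1_singletonE)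
  then have all: "{m, kr, ks} = {..<3}" using m sub by blast
  define c' where "c' = c({x, y} := m, {x, r} := kr, {x, s} := ks, {y, t} := kt, {y, u} := ku)"
  have ne: "distinct [{x, y}, {x, r}, {x, s}, {y, t}, {y, u}]"
    using dist by (auto simp: doubleton_eq_iff)
  have c'v: "c' {x, y} = m" "c' {x, r} = kr" "c' {x, s} = ks" "c' {y, t} = kt" "c' {y, u} = ku"
    using ne by (auto simp: c'_def)
  have c'0: "c' ` inc (del2 E x y) z = c ` inc (del2 E x y) z" for z
    by (intro image_cong) (auto simp: c'_def del2_def)
  have E: "E = {{x, y}, {x, r}, {x, s}, {y, t}, {y, u}} \<union> del2 E x y"
  proof -
    have "E = inc E x \<union> inc E y \<union> del2 E x y" by (auto simp: del2_def)
    also have "\<dots> = {{x, y}, {x, r}, {x, s}, {y, t}, {y, u}} \<union> del2 E x y" unfolding x y by auto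
    finally show ?thesis .
  qed
  have "c' ` inc E z = {..<3}" if z: "z \<in> V" for z
  proof -
    consider "z = x" | "z = y" | "z \<in> V - {x, y}" using z by blast
    then show ?thesis
    proof cases
      case 1 then show ?thesis using x all c'v by simp
    next
      case 2 then show ?thesis using y all k(1) c'v by simp
    next
      case 3
      have "inc E z = (if z = r then {{x, r}} else {}) \<union> (if z = s then {{x, s}} else {}) \<union>
          (if z = t then {{y, t}} else {}) \<union> (if z = u then {{y, u}} else {}) \<union> inc (del2 E x y) z"
        using 3 by (subst E) auto
      then have "c' ` inc E z = (if z = r then {kr} else {}) \<union> (if z = s then {ks} else {}) \<union>
          (if z = t then {kt} else {}) \<union> (if z = u then {ku} else {}) \<union> c ` inc (del2 E x y) z"
        using dist by (simp add: image_Un c'v c'0)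
      also have "(if z = r then {kr} else {}) \<union> (if z = s then {ks} else {}) \<union>
          (if z = t then {kt} else {}) \<union> (if z = u then {ku} else {}) = g z"
        using g dist 3 by auto
      finally show ?thesis using c[OF 3] by (simp add: Un_commute)
    qed
  qed
  then show thesis using that by blast
qed

lemma card_filter_insert:
  "finite X \<Longrightarrow> e \<notin> X \<Longrightarrow> card {f \<in> insert e X. Q f} = of_bool (Q e) + card {f \<in> X. Q f}"
proof -
  assume *: "finite X" "e \<notin> X"
  have "{f \<in> insert e X. Q f} = (if Q e then insert e {f \<in> X. Q f} else {f \<in> X. Q f})" by auto
  then show ?thesis using * by simp
qed

text \<open>Entries that each occur an even number of times form two equal pairs. The statement
  separates the pairing by position, which the construction wants, from the pattern that would
  extend over the deleted vertices.\<close>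

lemma four_parity:
  fixes a b c d :: nat
  assumes "\<And>i. i < 3 \<Longrightarrow> even (of_bool (a = i) + of_bool (b = i) + of_bool (c = i) + of_bool (d = i) :: nat)"
    and "a < 3" "b < 3" "c < 3" "d < 3"
  shows "a = b \<and> c = d \<or> a \<noteq> b \<and> {a, b} = {c, d}"
proof (cases "a = b")
  case True
  then show ?thesis using assms(1)[OF assms(4)] by (cases "c = d") auto
next
  case False
  then have "a = c \<or> a = d" "b = c \<or> b = d"
    using assms(1)[OF assms(2)] assms(1)[OF assms(3)] by (auto simp: of_bool_def split: if_splits)
  then show ?thesis using False assms(1)[OF assms(2)] by auto
qed

text \<open>Parity is applied to the side of \<open>VH\<close>, which has even order because two
  vertices were taken from a cubic graph. Of the two patterns left, the crossed one would extend
  over \<open>x\<close> and \<open>y\<close> to a colouring of \<open>EH\<close>. In the other one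
  each pair of connecting edges has a single colour, recorded by \<open>g\<close> as the dangling
  colour at its ports.\<close>

lemma (in matching) glue_colouring_left:
  assumes sg1: "simple_graph V1 E1" and cubH: "cubic VH EH" and nH: "\<not> three_edge_colourable EH"
    and x: "inc EH x = {{x, y}, {x, r}, {x, s}}" and y: "inc EH y = {{x, y}, {y, t}, {y, u}}"
    and dist: "distinct [x, y, r, s, t, u]"
    and V2: "V2 = VH - {x, y}"
    and Ps: "P = {p1, p2, q1, q2}" "distinct [p1, p2, q1, q2]"
    and f: "f p1 = r" "f p2 = s" "f q1 = t" "f q2 = u"
    and cub: "cubic (V1 \<union> V2) (glue E1 (del2 EH x y) P)"
    and col: "three_edge_colourable (glue E1 (del2 EH x y) P)"
  obtains c :: "'a set \<Rightarrow> nat" and g k1 k2 where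
    "\<And>z. z \<in> V1 \<Longrightarrow> c ` inc E1 z \<union> g z = {..<3}"
    "g p1 = {k1}" "g p2 = {k1}" "g q1 = {k2}" "g q2 = {k2}" "\<And>z. z \<notin> P \<Longrightarrow> g z = {}"
proof -
  let ?E2 = "del2 EH x y" let ?G = "glue E1 ?E2 P"
  have sgH: "simple_graph VH EH" using cubH by (simp add: cubic_def)
  have sg2: "simple_graph V2 ?E2" unfolding V2 by (rule simple_graph_del2[OF sgH])
  note s1 = side1[OF sg1 sg2 subset_refl] and s2 = side2[OF sg1 sg2 subset_refl]
  obtain c :: "'a set \<Rightarrow> nat" where c: "\<And>z. z \<in> V1 \<union> V2 \<Longrightarrow> c ` inc ?G z = {..<3}"
    using colourable_vertexwise[OF cub col] by blast
  have cr: "cross P = {{p1, r}, {p2, s}, {q1, t}, {q2, u}}" by (simp add: cross_def Ps f)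
  have pV: "p1 \<in> V1" "p2 \<in> V1" "q1 \<in> V1" "q2 \<in> V1" "r \<in> V2" "s \<in> V2" "t \<in> V2" "u \<in> V2"
    using portD[of p1] portD[of p2] portD[of q1] portD[of q2] by (auto simp: Ps f)
  have pr: "a \<noteq> b" if "a \<in> V1" "b \<in> V2" for a b using that disj by auto
  have xyV: "x \<in> VH" "y \<in> VH"
  proof -
    have "{x, y} \<in> EH" using x by blast
    then show "x \<in> VH" "y \<in> VH" using simple_graph_edge[OF sgH] by auto
  qed
  have evn: "even (card V2)"
  proof -
    have "card V2 = card VH - 2"
      using xyV dist sgH unfolding V2 by (simp add: card_Diff_subset simple_graph_def)
    then show ?thesis using cubic_even_card[OF cubH] by simp
  qed
  have par: "even (of_bool (c {p1, r} = i) + of_bool (c {p2, s} = i) + of_bool (c {q1, t} = i)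
      + of_bool (c {q2, u} = i) :: nat)" if "i < 3" for i
  proof -
    have "even (card {e \<in> cross P. c e = i})"
      using colour_parity[OF cub c _ evn that] cut_glue_V2[OF sg1 sg2] by simp
    moreover have "card {e \<in> cross P. c e = i} = of_bool (c {p1, r} = i) + (of_bool (c {p2, s} = i)
      + (of_bool (c {q1, t} = i) + (of_bool (c {q2, u} = i) + 0)))"
    proof -
      have ne: "{p1, r} \<notin> {{p2, s}, {q1, t}, {q2, u}}" "{p2, s} \<notin> {{q1, t}, {q2, u}}"
        "{q1, t} \<notin> {{q2, u}}" "{q2, u} \<notin> {}"
        using pV pr Ps(2) by (auto simp: doubleton_eq_iff)
      show ?thesis unfolding cr
        by (simp only: card_filter_insert[OF _ ne(1)] card_filter_insert[OF _ ne(2)]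
            card_filter_insert[OF _ ne(3)] card_filter_insert[OF _ ne(4)] finite.intros) simp
    qed
    ultimately show ?thesis by (simp add: add.assoc)
  qed
  have lt: "c e < 3" if "e \<in> cross P" for e
  proof -
    have "e \<in> ?G" using that by (simp add: glue_def)
    moreover from that obtain z where "z \<in> e" "z \<in> V1" using cr pV by auto
    ultimately show ?thesis using c[of z] by auto
  qed
  have lts: "c {p1, r} < 3" "c {p2, s} < 3" "c {q1, t} < 3" "c {q2, u} < 3" using cr by (auto intro!: lt)
  have "c {p1, r} = c {p2, s} \<and> c {q1, t} = c {q2, u}"
  proof (rule ccontr)
    assume "\<not> ?thesis"
    then have k: "{c {p1, r}, c {p2, s}} = {c {q1, t}, c {q2, u}}" "c {p1, r} \<noteq> c {p2, s}"
      using four_parity[OF par lts] by auto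
    \<comment> \<open>Here \<open>g\<close> collects dangling colours on the side of
      \<open>VH\<close>; after this contradiction it is defined anew for the side of
      \<open>V1\<close>.\<close>
    define g where "g z = c ` inc (cross P) z" for z
    have cz: "c ` inc ?E2 z \<union> g z = {..<3}" if z: "z \<in> VH - {x, y}" for z
    proof -
      have "inc ?G z = inc ?E2 z \<union> inc (cross P) z" using s1 disj z by (auto simp: glue_def V2)
      then show ?thesis using c[of z] z by (simp add: g_def image_Un V2)
    qed
    have "inc (cross P) r = {{p1, r}}" "inc (cross P) s = {{p2, s}}" "inc (cross P) t = {{q1, t}}"
        "inc (cross P) u = {{q2, u}}"
      unfolding cr using pV pr dist by auto
    then have gs: "g r = {c {p1, r}}" "g s = {c {p2, s}}" "g t = {c {q1, t}}" "g u = {c {q2, u}}"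
      by (simp_all add: g_def)
    have g0: "g z = {}" if "z \<in> VH - {x, y, r, s, t, u}" for z
    proof -
      have "z \<in> V2" using that by (simp add: V2)
      then have "inc (cross P) z = {}" unfolding cr using pV pr that by auto
      then show ?thesis by (simp add: g_def)
    qed
    obtain c' :: "'a set \<Rightarrow> nat" where "\<And>z. z \<in> VH \<Longrightarrow> c' ` inc EH z = {..<3}"
      using del2_colouring[OF sgH x y dist cz gs g0 k lts(1,2)] by blast
    then show False using colourableI[OF cubH] nH by blast
  qed
  then have eq: "c {p1, r} = c {p2, s}" "c {q1, t} = c {q2, u}" by auto
  define g where "g z = (if z \<in> V1 then c ` inc (cross P) z else {})" for z
  have "c ` inc E1 z \<union> g z = {..<3}" if z: "z \<in> V1" for z
  proof -
    have "inc ?G z = inc E1 z \<union> inc (cross P) z" using s2 disj z by (auto simp: glue_def)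
    then show ?thesis using c[of z] z by (simp add: g_def image_Un)
  qed
  moreover have "inc (cross P) p1 = {{p1, r}}" "inc (cross P) p2 = {{p2, s}}"
      "inc (cross P) q1 = {{q1, t}}" "inc (cross P) q2 = {{q2, u}}"
    unfolding cr using pV pr Ps(2) by auto
  moreover have "g z = {}" if "z \<notin> P" for z
  proof (cases "z \<in> V1")
    case True
    then have "inc (cross P) z = {}" unfolding cr using pV pr that Ps by auto
    then show ?thesis by (simp add: g_def)
  next
    case False then show ?thesis by (simp add: g_def)
  qed
  ultimately show thesis using that[of c g "c {p1, r}" "c {q1, t}"] eq pV by (simp add: g_def)
qed

section \<open>Outer cycles\<close>

text \<open>The outer cycles as a function of a vertex set and an edge set alone, so that they can
  be united and merged without mentioning a tree.\<close>

definition classes :: "'a set \<Rightarrow> 'a set set \<Rightarrow> 'a set set" where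
  "classes L F = {{w \<in> L. (adj F)\<^sup>*\<^sup>* v w} | v. v \<in> L}"

lemma outer_cycles_classes: "outer_cycles V E T = classes (leaves V T) (E - T)"
  by (simp add: outer_cycles_def classes_def)

lemma class_eqI:
  assumes "u \<in> C" "C \<subseteq> L" "\<And>a b. {a, b} \<in> F \<Longrightarrow> a \<in> C \<Longrightarrow> b \<in> C" "\<And>w. w \<in> C \<Longrightarrow> (adj F)\<^sup>*\<^sup>* u w"
  shows "{w \<in> L. (adj F)\<^sup>*\<^sup>* u w} = C"
  using assms adj_rtranclp_closed[of F C u] by blast

section \<open>Connected components\<close>

definition component :: "'a set set \<Rightarrow> 'a \<Rightarrow> 'a set" where
  "component F u = {w. (adj F)\<^sup>*\<^sup>* u w}"

lemma component_closed: "{a, b} \<in> F \<Longrightarrow> a \<in> component F u \<Longrightarrow> b \<in> component F u"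
  unfolding component_def by (auto simp: adj_def intro: rtranclp.rtrancl_into_rtrancl)

lemma component_self: "u \<in> component F u"
  by (simp add: component_def)

lemma component_eq: "w \<in> component F u \<Longrightarrow> component F w = component F u"
  unfolding component_def by (auto intro: rtranclp_trans adj_rtranclp_sym)

lemma component_eq_iff: "component F u = component F w \<longleftrightarrow> u \<in> component F w"
  using component_eq[of u F w] component_self[of u F] by auto

lemma component_image_Diff: "component F ` (L - component F w) = component F ` L - {component F w}"
proof (intro equalityI subsetI)
  fix C assume "C \<in> component F ` (L - component F w)"
  then obtain u where "C = component F u" "u \<in> L" "u \<notin> component F w" by blast
  then show "C \<in> component F ` L - {component F w}" by (auto simp: component_eq_iff)
next
  fix C assume "C \<in> component F ` L - {component F w}"
  then obtain u where "C = component F u" "u \<in> L" "C \<noteq> component F w" by blast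
  then show "C \<in> component F ` (L - component F w)" by (auto simp: component_eq_iff)
qed

lemma component_subset:
  assumes "simple_graph L F" "u \<in> L"
  shows "component F u \<subseteq> L"
  using adj_rtranclp_closed[of F L u] simple_graph_edge(3)[OF assms(1)] assms(2)
  by (auto simp: component_def)

lemma classes_component:
  assumes "simple_graph L F"
  shows "classes L F = component F ` L"
proof -
  have "{w \<in> L. (adj F)\<^sup>*\<^sup>* v w} = component F v" if "v \<in> L" for v
    using component_subset[OF assms that] by (auto simp: component_def)
  then show ?thesis unfolding classes_def by (auto simp: image_iff)
qed

lemma component_mono_edges:
  assumes "\<And>a b. {a, b} \<in> F \<Longrightarrow> a \<in> component F u \<Longrightarrow> {a, b} \<in> F'"
  shows "w \<in> component F u \<Longrightarrow> (adj F')\<^sup>*\<^sup>* u w"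
proof -
  assume "w \<in> component F u"
  then have "(adj F)\<^sup>*\<^sup>* u w" by (simp add: component_def)
  then show ?thesis
  proof (induction rule: rtranclp_induct)
    case (step a b)
    then have "adj F' a b" using assms[of a b] by (auto simp: adj_def component_def)
    then show ?case using step by auto
  qed simp
qed

lemma classes_Un:
  assumes s1: "simple_graph L1 F1" and s2: "simple_graph L2 F2" and dj: "L1 \<inter> L2 = {}"
  shows "classes (L1 \<union> L2) (F1 \<union> F2) = classes L1 F1 \<union> classes L2 F2"
proof -
  have c: "component (F1 \<union> F2) u = component F1 u"
    if "simple_graph L1 F1" "simple_graph L2 F2" "L1 \<inter> L2 = {}" "u \<in> L1" for L1 L2 F1 F2 and u :: 'a
  proof
    show "component F1 u \<subseteq> component (F1 \<union> F2) u"
      by (auto simp: component_def intro: adj_rtranclp_mono[of F1])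
    have "{a, b} \<in> F1" if "{a, b} \<in> F1 \<union> F2" "a \<in> component F1 u" for a b
      using that component_subset[OF \<open>simple_graph L1 F1\<close> \<open>u \<in> L1\<close>]
        simple_graph_edge[OF \<open>simple_graph L2 F2\<close>, of a b] \<open>L1 \<inter> L2 = {}\<close> by auto
    then have "w \<in> component F1 u" if "(adj (F1 \<union> F2))\<^sup>*\<^sup>* u w" for w
      using that component_closed[of _ _ F1 u] component_self[of u F1]
      by (intro adj_rtranclp_closed[of "F1 \<union> F2" "component F1 u" u w]) blast+
    then show "component (F1 \<union> F2) u \<subseteq> component F1 u" by (auto simp: component_def)
  qed
  have "simple_graph (L1 \<union> L2) (F1 \<union> F2)"
    unfolding simple_graph_def
  proof (intro conjI ballI)
    show "finite (L1 \<union> L2)" using s1 s2 by (simp add: simple_graph_def)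
    fix e assume "e \<in> F1 \<union> F2"
    then show "\<exists>u v. e = {u, v} \<and> u \<noteq> v \<and> u \<in> L1 \<union> L2 \<and> v \<in> L1 \<union> L2"
      using simple_graph_edgeE[OF s1, of e] simple_graph_edgeE[OF s2, of e] by (metis UnE UnI1 UnI2)
  qed
  moreover have "component (F1 \<union> F2) u = component F2 u" if "u \<in> L2" for u
    using c[OF s2 s1 _ that] dj by (simp add: Un_commute Int_commute)
  ultimately show ?thesis
    using c[OF s1 s2 dj] by (simp add: classes_component[OF s1] classes_component[OF s2] classes_component image_Un)
qed

text \<open>Deleting the two edges at \<open>x\<close> makes the degrees of \<open>r\<close> and
  \<open>s\<close> odd and leaves the others even. The degrees in a component have an even sum, so
  the component of \<open>r\<close> needs a second odd vertex, and only \<open>s\<close> is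
  available. On a cycle this says that the rest stays connected once \<open>x\<close> is
  removed.\<close>

lemma even_deg_connected:
  assumes sg: "simple_graph L F" and d: "\<And>z. z \<in> L \<Longrightarrow> even (deg F z)"
    and x: "inc F x = {{x, r}, {x, s}}" "r \<noteq> s"
  shows "s \<in> component (F - {{x, r}, {x, s}}) r"
proof (rule ccontr)
  let ?F = "F - {{x, r}, {x, s}}" let ?C = "component ?F r"
  assume s: "s \<notin> ?C"
  have fin: "finite F" by (rule simple_graph_finite[OF sg])
  have e: "{x, r} \<in> F" "{x, s} \<in> F" using x(1) by auto
  have mem: "x \<in> L" "r \<in> L" "s \<in> L" "x \<noteq> r" "x \<noteq> s"
    using simple_graph_edge[OF sg e(1)] simple_graph_edge[OF sg e(2)] by auto
  have sgF: "simple_graph L ?F" by (rule simple_graph_subset[OF sg]) auto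
  have CL: "?C \<subseteq> L" by (rule component_subset[OF sgF mem(2)])
  have finC: "finite ?C" using CL sg finite_subset by (auto simp: simple_graph_def)
  have xC: "x \<notin> ?C"
  proof -
    have x0: "x \<notin> f" if "f \<in> ?F" for f using that x(1) by auto
    have "w \<noteq> x" if "w \<in> ?C" for w
    proof -
      have "(adj ?F)\<^sup>*\<^sup>* r w" using that by (simp add: component_def)
      then show "w \<noteq> x"
      proof (induction rule: rtranclp_induct)
        case base then show ?case using mem by auto
      next
        case (step a b) then show ?case using x0 by (auto simp: adj_def)
      qed
    qed
    then show ?thesis by blast
  qed
  have dF: "deg ?F z + of_bool (z \<in> {x, r}) + of_bool (z \<in> {x, s}) = deg F z" for z
  proof -
    have F: "?F = (F - {{x, r}}) - {{x, s}}" by auto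
    have "{x, s} \<in> F - {{x, r}}" using e x(2) by (auto simp: doubleton_eq_iff)
    then have "deg ?F z + of_bool (z \<in> {x, s}) = deg (F - {{x, r}}) z"
      unfolding F using fin by (intro deg_remove) auto
    then show ?thesis using deg_remove[OF fin e(1), of z] by linarith
  qed
  have rC: "r \<in> ?C" by (rule component_self)
  have "even (deg ?F z)" if "z \<in> ?C - {r}" for z
  proof -
    have "z \<noteq> x" "z \<noteq> s" "z \<noteq> r" using that xC s by blast+
    then have "deg ?F z = deg F z" using dF[of z] by simp
    then show ?thesis using d[of z] that CL by auto
  qed
  then have "even (\<Sum>z\<in>?C - {r}. deg ?F z)" by (rule dvd_sum)
  moreover have "odd (deg ?F r)"
  proof -
    have "deg ?F r + 1 = deg F r" using dF[of r] mem x(2) by simp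
    then show ?thesis using d[OF mem(2)] by presburger
  qed
  moreover have "(\<Sum>z\<in>?C. deg ?F z) = deg ?F r + (\<Sum>z\<in>?C - {r}. deg ?F z)"
    using finC rC by (rule sum.remove)
  moreover have "even (\<Sum>z\<in>?C. deg ?F z)"
    by (rule even_sum_deg_closed[OF sgF finC]) (rule component_closed)
  ultimately show False by simp
qed

section \<open>Merging two components at a deleted vertex\<close>

context
  fixes L1 L2 :: "'a set" and F1 F2 :: "'a set set" and c d x r s :: 'a
  assumes s1: "simple_graph L1 F1" and s2: "simple_graph L2 F2" and dj: "L1 \<inter> L2 = {}"
    and ev: "\<And>z. z \<in> L2 \<Longrightarrow> even (deg F2 z)"
    and x: "inc F2 x = {{x, r}, {x, s}}" "r \<noteq> s" and cd: "{c, d} \<in> F1"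
begin

text \<open>The vertices \<open>r\<close> and \<open>s\<close> remain joined once \<open>x\<close>
  is gone, so the walk \<open>c\<close>, \<open>r\<close>, \<open>s\<close>, \<open>d\<close> is a
  detour for the deleted edge \<open>cd\<close>. Thus the two components fuse, without
  \<open>x\<close>, and all others keep their edges.\<close>

lemma classes_merge:
  shows "classes (L1 \<union> L2 - {x}) ((F1 - {{c, d}}) \<union> (F2 - {{x, r}, {x, s}}) \<union> {{c, r}, {d, s}}) =
    insert (component F1 c \<union> component F2 x - {x}) ((classes L1 F1 - {component F1 c}) \<union> (classes L2 F2 - {component F2 x}))"
    (is "classes ?L ?F = insert ?D _")
proof -
  let ?K = "component F1 c" let ?M = "component F2 x" let ?R = "(adj ?F)\<^sup>*\<^sup>*"
  have e: "{x, r} \<in> F2" "{x, s} \<in> F2" using x(1) by auto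
  have mem: "c \<in> L1" "d \<in> L1" "x \<in> L2" "r \<in> L2" "s \<in> L2" "c \<noteq> d" "x \<noteq> r" "x \<noteq> s"
    using simple_graph_edge[OF s1 cd] simple_graph_edge[OF s2 e(1)] simple_graph_edge[OF s2 e(2)] by auto
  have KL: "?K \<subseteq> L1" and ML2: "?M \<subseteq> L2"
    using component_subset[OF s1 mem(1)] component_subset[OF s2 mem(3)] by auto
  have dK: "d \<in> ?K" using component_closed[OF cd component_self] .
  have rM: "r \<in> ?M" "s \<in> ?M" using component_closed[OF e(1) component_self] component_closed[OF e(2) component_self] .
  have F1L: "a \<in> L1 \<and> b \<in> L1" if "{a, b} \<in> F1" for a b using simple_graph_edge[OF s1 that] by simp
  have F2L: "a \<in> L2 \<and> b \<in> L2" if "{a, b} \<in> F2" for a b using simple_graph_edge[OF s2 that] by simp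
  have xF: "x \<notin> f" if "f \<in> ?F" for f
  proof -
    have "x \<notin> f" if "f \<in> F1" using that simple_graph_notin[OF s1, of x f] mem dj by auto
    moreover have "x \<notin> f" if "f \<in> F2 - {{x, r}, {x, s}}" using that x(1) by auto
    ultimately show ?thesis using that mem dj by auto
  qed
  have Fcases: "({a, b} \<in> F1 \<and> {a, b} \<noteq> {c, d}) \<or> ({a, b} \<in> F2 \<and> a \<noteq> x \<and> b \<noteq> x) \<or> (a = c \<and> b = r) \<or> (a = r \<and> b = c)
      \<or> (a = d \<and> b = s) \<or> (a = s \<and> b = d)" if "{a, b} \<in> ?F" for a b
    using that xF[OF that] by (auto simp: doubleton_eq_iff)
  have rs: "?R r s"
  proof -
    have "s \<in> component (F2 - {{x, r}, {x, s}}) r" using even_deg_connected[OF s2 ev x] .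
    then have "(adj (F2 - {{x, r}, {x, s}}))\<^sup>*\<^sup>* r s" by (simp add: component_def)
    then show ?thesis by (rule adj_rtranclp_mono[rotated]) auto
  qed
  have cr: "?R c r" "?R d s" by (auto intro!: r_into_rtranclp simp: adj_def)
  have Rcd: "?R c d" using cr rs adj_rtranclp_sym by (meson rtranclp_trans)
  have Dc: "?R c w" if w: "w \<in> ?D" for w
  proof -
    consider "w \<in> ?K" | "w \<in> ?M" "w \<noteq> x" using w by auto
    then show ?thesis
    proof cases
      case 1
      have "?R a b" if "{a, b} \<in> F1" for a b
      proof (cases "{a, b} = {c, d}")
        case True
        then show ?thesis using Rcd adj_rtranclp_sym[OF Rcd] unfolding doubleton_eq_iff by blast
      next
        case False
        then have "adj ?F a b" using that by (simp add: adj_def)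
        then show ?thesis by (rule r_into_rtranclp)
      qed
      then show ?thesis using 1 adj_rtranclp_lift[of F1 ?F c w] by (simp add: component_def)
    next
      case 2
      have "(adj F2)\<^sup>*\<^sup>* x w" using 2 by (simp add: component_def)
      \<comment> \<open>The alternative \<open>w = x\<close> lets the path return to the deleted
        vertex; it leaves \<open>x\<close> again towards \<open>r\<close> or \<open>s\<close>, both
        of which are already reached from \<open>c\<close>.\<close>
      then have "w = x \<or> ?R c w"
      proof (induction rule: rtranclp_induct)
        case (step a b)
        show ?case
        proof (cases "a = x \<or> b = x")
          case True
          show ?thesis
          proof (cases "b = x")
            case False
            then have "{x, b} \<in> inc F2 x" using True step(2) by (auto simp: adj_def)
            then have "b = r \<or> b = s" using x(1) by (auto simp: doubleton_eq_iff)
            then show ?thesis using cr rs by (meson rtranclp_trans)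
          qed simp
        next
          case False
          then have "{a, b} \<noteq> {x, r}" "{a, b} \<noteq> {x, s}" by (auto simp: doubleton_eq_iff)
          then have "adj ?F a b" using step(2) by (simp add: adj_def)
          then show ?thesis using step False by auto
        qed
      qed simp
      then show ?thesis using 2 by simp
    qed
  qed
  have Dcl: "b \<in> ?D" if ab: "{a, b} \<in> ?F" "a \<in> ?D" for a b
    using Fcases[OF ab(1)]
  proof (elim disjE conjE)
    assume h: "{a, b} \<in> F1"
    then have "a \<in> ?K" using ab(2) F1L[OF h] ML2 dj by auto
    then have "b \<in> ?K" using component_closed[OF h] by blast
    then show ?thesis using KL mem dj by auto
  next
    assume h: "{a, b} \<in> F2" "b \<noteq> x"
    then have "a \<in> ?M" using ab(2) F2L[OF h(1)] KL dj by auto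
    then show ?thesis using component_closed[OF h(1)] h(2) by blast
  qed (use dK rM component_self[of c F1] mem dj in auto)
  have DL: "?D \<subseteq> ?L" using KL ML2 by auto
  define Cl where "Cl u = {w \<in> ?L. ?R u w}" for u
  have 1: "Cl u = ?D" if u: "u \<in> ?D" for u
    unfolding Cl_def
  proof (rule class_eqI[OF u DL])
    show "?R u w" if "w \<in> ?D" for w
      using Dc[OF u] Dc[OF that] adj_rtranclp_sym by (meson rtranclp_trans)
  qed (rule Dcl)
  have 2: "Cl u = component F1 u" if u: "u \<in> L1 - ?K" for u
    unfolding Cl_def
  proof (rule class_eqI[OF component_self])
    have sub: "component F1 u \<subseteq> L1" using component_subset[OF s1] u by blast
    have nK: "w \<notin> ?K" if "w \<in> component F1 u" for w
      using that u component_eq[of w F1 u] component_eq[of w F1 c] component_self[of u F1] by auto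
    show "component F1 u \<subseteq> ?L" using sub mem dj by auto
    show "b \<in> component F1 u" if ab: "{a, b} \<in> ?F" "a \<in> component F1 u" for a b
    proof -
      have "a \<in> L1" "a \<noteq> c" "a \<noteq> d" using ab(2) sub nK[OF ab(2)] dK component_self[of c F1] by auto
      then have "{a, b} \<in> F1" using Fcases[OF ab(1)] F2L[of a b] mem dj by auto
      then show ?thesis using component_closed ab(2) by metis
    qed
    show "?R u w" if "w \<in> component F1 u" for w
    proof (rule component_mono_edges[OF _ that])
      fix a b assume ab: "{a, b} \<in> F1" "a \<in> component F1 u"
      then have "a \<noteq> c" "a \<noteq> d" using nK[OF ab(2)] dK component_self[of c F1] by auto
      then show "{a, b} \<in> ?F" using ab by (auto simp: doubleton_eq_iff)
    qed
  qed
  have 3: "Cl u = component F2 u" if u: "u \<in> L2 - ?M" for u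
    unfolding Cl_def
  proof (rule class_eqI[OF component_self])
    have sub: "component F2 u \<subseteq> L2" using component_subset[OF s2] u by blast
    have nM: "w \<notin> ?M" if "w \<in> component F2 u" for w
      using that u component_eq[of w F2 u] component_eq[of w F2 x] component_self[of u F2] by auto
    have nx: "w \<noteq> x" "w \<noteq> r" "w \<noteq> s" if "w \<in> component F2 u" for w
      using nM[OF that] rM component_self[of x F2] by auto
    show "component F2 u \<subseteq> ?L" using sub nx by auto
    show "b \<in> component F2 u" if ab: "{a, b} \<in> ?F" "a \<in> component F2 u" for a b
    proof -
      have "a \<in> L2" using ab(2) sub by auto
      then have "{a, b} \<in> F2" using Fcases[OF ab(1)] F1L[of a b] nx[OF ab(2)] mem dj by auto
      then show ?thesis using component_closed ab(2) by metis
    qed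
    show "?R u w" if "w \<in> component F2 u" for w
    proof (rule component_mono_edges[OF _ that])
      fix a b assume ab: "{a, b} \<in> F2" "a \<in> component F2 u"
      then have "{a, b} \<noteq> {x, r}" "{a, b} \<noteq> {x, s}" using nx[OF ab(2)] by (auto simp: doubleton_eq_iff)
      then show "{a, b} \<in> ?F" using ab by auto
    qed
  qed
  have L: "?L = ?D \<union> (L1 - ?K) \<union> (L2 - ?M)"
    using KL ML2 mem dj component_self[of x F2] by auto
  have "classes ?L ?F = Cl ` ?L" unfolding Cl_def classes_def by auto
  also have "\<dots> = Cl ` (?D \<union> (L1 - ?K) \<union> (L2 - ?M))" using L by (rule arg_cong)
  also have "\<dots> = Cl ` ?D \<union> Cl ` (L1 - ?K) \<union> Cl ` (L2 - ?M)" by (simp only: image_Un)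
  also have "Cl ` ?D = (\<lambda>u. ?D) ` ?D" using 1 by (rule image_cong[OF refl])
  also have "Cl ` (L1 - ?K) = component F1 ` (L1 - ?K)" using 2 by (rule image_cong[OF refl])
  also have "Cl ` (L2 - ?M) = component F2 ` (L2 - ?M)" using 3 by (rule image_cong[OF refl])
  finally have cl: "classes ?L ?F =
      (\<lambda>u. ?D) ` ?D \<union> component F1 ` (L1 - ?K) \<union> component F2 ` (L2 - ?M)" .
  have "c \<in> ?D" using component_self[of c F1] mem dj by auto
  then have "(\<lambda>u. ?D) ` ?D = {?D}" by auto
  moreover have "component F1 ` (L1 - ?K) = classes L1 F1 - {?K}"
    unfolding classes_component[OF s1] by (rule component_image_Diff)
  moreover have "component F2 ` (L2 - ?M) = classes L2 F2 - {?M}"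
    unfolding classes_component[OF s2] by (rule component_image_Diff)
  ultimately show ?thesis using cl by simp
qed

end

lemma classes_finite: "finite L \<Longrightarrow> finite (classes L F)"
  unfolding classes_def by (rule finite_subset[of _ "Pow L"]) auto

lemma classes_disjoint:
  assumes "L1 \<inter> L2 = {}"
  shows "classes L1 F1 \<inter> classes L2 F2 = {}"
proof -
  have *: "C \<subseteq> L \<and> C \<noteq> {}" if "C \<in> classes L F" for C L :: "'a set" and F
    using that by (auto simp: classes_def)
  have False if "C \<in> classes L1 F1" "C \<in> classes L2 F2" for C
    using *[OF that(1)] *[OF that(2)] assms by auto
  then show ?thesis by blast
qed

section \<open>Local structure of Hists\<close>

lemma simple_graph_deg_neighbours:
  assumes sg: "simple_graph V F"
  shows "inc F z = (\<lambda>a. {z, a}) ` {a. {z, a} \<in> F}" "card {a. {z, a} \<in> F} = deg F z"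
proof -
  show *: "inc F z = (\<lambda>a. {z, a}) ` {a. {z, a} \<in> F}"
  proof (intro equalityI subsetI)
    fix e assume e: "e \<in> inc F z"
    then obtain a b where "e = {a, b}" using sg by (blast elim: simple_graph_edgeE)
    then show "e \<in> (\<lambda>a. {z, a}) ` {a. {z, a} \<in> F}" using e by (auto simp: insert_commute)
  qed auto
  have "inj_on (\<lambda>a. {z, a}) {a. {z, a} \<in> F}" by (auto simp: inj_on_def doubleton_eq_iff)
  then show "card {a. {z, a} \<in> F} = deg F z" unfolding deg_def * by (simp add: card_image)
qed

lemma deg1_neighbour:
  assumes sg: "simple_graph V F" and "deg F z = 1"
  obtains a where "inc F z = {{z, a}}"
proof -
  obtain a where "{a. {z, a} \<in> F} = {a}"
    using assms(2) simple_graph_deg_neighbours(2)[OF sg, of z] card_1_singletonE by metis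
  then show thesis using that simple_graph_deg_neighbours(1)[OF sg, of z] by simp
qed

lemma deg3_neighbours:
  assumes sg: "simple_graph V F" and "deg F z = 3" and "{z, a} \<in> F"
  obtains b c where "inc F z = {{z, a}, {z, b}, {z, c}}" "distinct [z, a, b, c]"
proof -
  let ?N = "{a. {z, a} \<in> F}"
  have "card (?N - {a}) = 2"
    using assms simple_graph_deg_neighbours(2)[OF sg, of z] by (simp add: card_Diff_singleton)
  then obtain b c where bc: "?N - {a} = {b, c}" "b \<noteq> c" by (auto simp: card_2_iff)
  then have N: "?N = {a, b, c}" using assms(3) by auto
  have "z \<notin> ?N" using simple_graph_edge(1)[OF sg, of z z] by auto
  then have "distinct [z, a, b, c]" using bc N by auto
  moreover have "inc F z = {{z, a}, {z, b}, {z, c}}"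
    unfolding simple_graph_deg_neighbours(1)[OF sg, of z] N by simp
  ultimately show thesis using that by blast
qed

context
  fixes V :: "'a set" and E T :: "'a set set"
  assumes cub: "cubic V E" and ns: "no_short_cycle E" and hist: "hist V E T"
begin

lemma hist_simple: "simple_graph V E" "simple_graph V T" "T \<subseteq> E"
  using cub hist simple_graph_subset by (auto simp: cubic_def hist_def spanning_tree_def)

lemma hist_closed:
  assumes "S \<noteq> {}" "S \<subseteq> V" "\<And>a b. {a, b} \<in> T \<Longrightarrow> a \<in> S \<Longrightarrow> b \<in> S"
  shows "S = V"
proof -
  obtain a where a: "a \<in> S" using assms(1) by auto
  have "b \<in> S" if "b \<in> V" for b
  proof -
    have "(adj T)\<^sup>*\<^sup>* a b" using hist a that assms(2) by (auto simp: hist_def spanning_tree_def)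
    then show ?thesis using adj_rtranclp_closed[of T S a b] assms(3) a by blast
  qed
  then show ?thesis using assms(2) by blast
qed

lemma hist_deg: "z \<in> V \<Longrightarrow> deg T z = 1 \<or> deg T z = 3" "z \<in> V \<Longrightarrow> deg E z = 3"
  using hist cub by (auto simp: hist_def cubic_def)

text \<open>Two leaves adjacent in the tree would be the whole tree, but a vertex of a cubic graph
  has three neighbours.\<close>

lemma leaf_parent:
  assumes x: "x \<in> V" "deg T x = 1" "{x, y} \<in> T"
  shows "deg T y = 3"
proof (rule ccontr)
  have xy: "y \<in> V" "x \<noteq> y" using simple_graph_edge[OF hist_simple(2) x(3)] by auto
  assume "deg T y \<noteq> 3"
  then have "deg T y = 1" using hist_deg(1)[OF xy(1)] by simp
  then obtain b where b: "inc T y = {{y, b}}" using deg1_neighbour[OF hist_simple(2)] by metis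
  obtain a where a: "inc T x = {{x, a}}" using deg1_neighbour[OF hist_simple(2) x(2)] by metis
  have ix: "{x, y} \<in> inc T x" "{x, y} \<in> inc T y" using x(3) by auto
  then have ixy: "inc T x = {{x, y}}" "inc T y = {{x, y}}" using a b by auto
  have "{x, y} = V"
  proof (rule hist_closed)
    fix p q assume pq: "{p, q} \<in> T" "p \<in> {x, y}"
    then have "{p, q} \<in> inc T p" by simp
    moreover have "inc T p = {{x, y}}" using pq(2) ixy by blast
    ultimately have "{p, q} = {x, y}" by simp
    then show "q \<in> {x, y}" by blast
  qed (use x xy in auto)
  moreover obtain p q where pq: "inc E x = {{x, y}, {x, p}, {x, q}}" "distinct [x, y, p, q]"
    using deg3_neighbours[OF hist_simple(1) hist_deg(2)[OF x(1)], of y] x(3) hist_simple(3) by blast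
  moreover have "{x, p} \<in> E" using pq(1) by auto
  then have "p \<in> V" using simple_graph_edge[OF hist_simple(1)] by blast
  ultimately show False by auto
qed

text \<open>An inner vertex \<open>y\<close> whose three tree neighbours are all leaves would make
  the tree a star on four vertices. The edges outside the tree then join leaves of the star, and any
  of them closes a triangle with \<open>y\<close>.\<close>

lemma inner_edge:
  assumes ne: "V \<noteq> {}"
  obtains x y where "{x, y} \<in> T" "deg T x = 3" "deg T y = 3"
proof -
  obtain z where z: "z \<in> V" using ne by auto
  obtain y where y: "y \<in> V" "deg T y = 3"
  proof (cases "deg T z = 1")
    case True
    then obtain a where "inc T z = {{z, a}}" using deg1_neighbour[OF hist_simple(2)] by metis
    then have "{z, a} \<in> T" by auto
    then show thesis using that leaf_parent[OF z True] simple_graph_edge[OF hist_simple(2)] by blast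
  next
    case False then show thesis using that z hist_deg(1)[OF z] by blast
  qed
  have "card {a. {y, a} \<in> T} \<noteq> 0" using y simple_graph_deg_neighbours(2)[OF hist_simple(2), of y] by simp
  then have "{a. {y, a} \<in> T} \<noteq> {}" by (metis card.empty)
  then obtain a where a: "{y, a} \<in> T" by blast
  then obtain b c where abc: "inc T y = {{y, a}, {y, b}, {y, c}}" "distinct [y, a, b, c]"
    using deg3_neighbours[OF hist_simple(2) y(2)] by metis
  have T: "{y, a} \<in> T" "{y, b} \<in> T" "{y, c} \<in> T" using abc(1) by auto
  have V: "a \<in> V" "b \<in> V" "c \<in> V" using T simple_graph_edge[OF hist_simple(2)] by blast+
  show thesis
  proof (cases "deg T a = 3 \<or> deg T b = 3 \<or> deg T c = 3")
    case True
    then show ?thesis using that T y by blast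
  next
    case False
    have leaf: "inc T w = {{y, w}}" if "w \<in> {a, b, c}" for w
    proof -
      have "deg T w = 1" using that False hist_deg(1) V by blast
      then obtain v where v: "inc T w = {{w, v}}" using deg1_neighbour[OF hist_simple(2)] by metis
      have "{y, w} \<in> inc T w" using that T by auto
      then show ?thesis using v by auto
    qed
    have "{y, a, b, c} = V"
    proof (rule hist_closed)
      fix p q assume pq: "{p, q} \<in> T" "p \<in> {y, a, b, c}"
      show "q \<in> {y, a, b, c}"
      proof (cases "p = y")
        case True
        then have "{y, q} \<in> inc T y" using pq by auto
        then show ?thesis using abc(1) by (auto simp: doubleton_eq_iff)
      next
        case False
        then have "{p, q} \<in> inc T p" "p \<in> {a, b, c}" using pq by auto
        then have "{p, q} = {y, p}" unfolding leaf[OF \<open>p \<in> {a, b, c}\<close>] by simp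
        then show ?thesis using False by (auto simp: doubleton_eq_iff)
      qed
    qed (use V y in auto)
    moreover have aE: "{a, y} \<in> E" using T hist_simple(3) by (auto simp: insert_commute)
    obtain p q where pq: "inc E a = {{a, y}, {a, p}, {a, q}}" "distinct [a, y, p, q]"
      using deg3_neighbours[OF hist_simple(1) hist_deg(2)[OF V(1)] aE] by blast
    have ap: "{a, p} \<in> E" using pq(1) by auto
    then have "p \<in> V" using simple_graph_edge[OF hist_simple(1)] by blast
    ultimately have "p = b \<or> p = c" using pq(2) by auto
    then have "{y, p} \<in> T" using T by auto
    then have "{y, p} \<in> E" using hist_simple(3) by auto
    then have False using no_triangle[OF ns ap, of y] aE pq(2) by (auto simp: insert_commute)
    then show ?thesis ..
  qed
qed

text \<open>At a vertex of tree degree 3 the tree already uses all edges.\<close>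

lemma nontree_leaves:
  assumes "{a, b} \<in> E - T"
  shows "a \<in> leaves V T"
proof -
  have a: "a \<in> V" using simple_graph_edge[OF hist_simple(1)] assms by blast
  have "inc T a \<subset> inc E a" using assms hist_simple(3) by auto
  then have "deg T a < deg E a"
    unfolding deg_def using simple_graph_finite[OF hist_simple(1)] by (intro psubset_card_mono) auto
  then show ?thesis using hist_deg[OF a] a by (simp add: leaves_def)
qed

lemma nontree_simple: "simple_graph (leaves V T) (E - T)"
  unfolding simple_graph_def
proof (intro conjI ballI)
  show "finite (leaves V T)" using hist_simple(1) by (simp add: leaves_def simple_graph_def)
  fix e assume e: "e \<in> E - T"
  then obtain a b where ab: "e = {a, b}" "a \<noteq> b" using hist_simple(1) by (blast elim: simple_graph_edgeE)
  then show "\<exists>u v. e = {u, v} \<and> u \<noteq> v \<and> u \<in> leaves V T \<and> v \<in> leaves V T"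
    using e nontree_leaves[of a b] nontree_leaves[of b a] by (auto simp: insert_commute)
qed

lemma nontree_deg: "z \<in> V \<Longrightarrow> deg (E - T) z + deg T z = 3"
proof -
  assume z: "z \<in> V"
  have "E = (E - T) \<union> T" using hist_simple(3) by auto
  then have "deg E z = deg (E - T) z + deg T z"
    using deg_Un[of "E - T" T z] simple_graph_finite[OF hist_simple(1)]
      simple_graph_finite[OF hist_simple(2)] by auto
  then show ?thesis using hist_deg(2)[OF z] by simp
qed

lemma hist_card:
  assumes "V \<noteq> {}"
  shows "card T + 1 = card V"
proof -
  have "(adj T)\<^sup>*\<^sup>* u v" if "u \<in> V" "v \<in> V" for u v
    using hist that by (auto simp: hist_def spanning_tree_def)
  then show ?thesis
    using tree_card_iff[OF hist_simple(2) assms] hist by (auto simp: hist_def spanning_tree_def)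
qed

end

section \<open>Relabelling\<close>

context
  fixes V :: "'a set" and f :: "'a \<Rightarrow> 'b"
  assumes inj: "inj_on f V"
begin

lemma relabel_edge_iff:
  assumes "simple_graph V F" "a \<in> V" "b \<in> V"
  shows "{f a, f b} \<in> (`) f ` F \<longleftrightarrow> {a, b} \<in> F"
proof
  assume "{f a, f b} \<in> (`) f ` F"
  then obtain e where e: "e \<in> F" "f ` e = f ` {a, b}" by auto
  have "e \<subseteq> V" using assms(1) e(1) by (blast elim: simple_graph_edgeE)
  then have "e = {a, b}" using e(2) inj_on_image_eq_iff[OF inj, of e "{a, b}"] assms by simp
  then show "{a, b} \<in> F" using e by simp
next
  assume "{a, b} \<in> F"
  then have "f ` {a, b} \<in> (`) f ` F" by (rule imageI)
  then show "{f a, f b} \<in> (`) f ` F" by simp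
qed

lemma relabel_inj:
  assumes "simple_graph V F"
  shows "inj_on ((`) f) F"
proof (rule inj_on_subset[OF inj_on_image_Pow[OF inj]])
  show "F \<subseteq> Pow V" using assms by (auto simp: simple_graph_def)
qed

lemma relabel_simple:
  assumes sg: "simple_graph V F"
  shows "simple_graph (f ` V) ((`) f ` F)"
  unfolding simple_graph_def
proof (intro conjI ballI)
  show "finite (f ` V)" using sg by (simp add: simple_graph_def)
  fix e assume "e \<in> (`) f ` F"
  then obtain e0 where e0: "e0 \<in> F" "e = f ` e0" by auto
  then obtain a b where "e0 = {a, b}" "a \<noteq> b" "a \<in> V" "b \<in> V"
    using sg by (blast elim: simple_graph_edgeE)
  then have "e = {f a, f b}" "f a \<noteq> f b" "f a \<in> f ` V" "f b \<in> f ` V"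
    using e0(2) inj by (auto dest: inj_onD)
  then show "\<exists>u v. e = {u, v} \<and> u \<noteq> v \<and> u \<in> f ` V \<and> v \<in> f ` V" by blast
qed

lemma relabel_edgeE:
  assumes sg: "simple_graph V F" and e: "{a, b} \<in> (`) f ` F"
  obtains a0 b0 where "a = f a0" "b = f b0" "a0 \<in> V" "b0 \<in> V" "{a0, b0} \<in> F"
proof -
  obtain a0 b0 where "a = f a0" "b = f b0" "a0 \<in> V" "b0 \<in> V"
    using simple_graph_edge[OF relabel_simple[OF sg] e] by auto
  moreover from this have "{a0, b0} \<in> F" using relabel_edge_iff[OF sg] e by simp
  ultimately show thesis using that by blast
qed

lemma relabel_deg:
  assumes sg: "simple_graph V F" and z: "z \<in> V"
  shows "deg ((`) f ` F) (f z) = deg F z"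
proof -
  have "f z \<in> f ` e \<longleftrightarrow> z \<in> e" if "e \<in> F" for e
  proof -
    have "e \<subseteq> V" using sg that by (auto simp: simple_graph_def)
    then show ?thesis using inj z by (meson inj_on_image_mem_iff)
  qed
  then have "inc ((`) f ` F) (f z) = (`) f ` inc F z" by auto
  moreover have "inj_on ((`) f) (inc F z)" using relabel_inj[OF sg] by (rule inj_on_subset) auto
  ultimately show ?thesis by (simp add: deg_def card_image)
qed

lemma relabel_cut:
  assumes sg: "simple_graph V F" and S: "S \<subseteq> V"
  shows "card (cut_edges ((`) f ` F) (f ` S)) = card (cut_edges F S)"
proof -
  have *: "f ` e \<inter> f ` S \<noteq> {} \<longleftrightarrow> e \<inter> S \<noteq> {}" "f ` e - f ` S \<noteq> {} \<longleftrightarrow> e - S \<noteq> {}" if "e \<in> F" for e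
  proof -
    have e: "e \<subseteq> V" using sg that by (auto simp: simple_graph_def)
    have "f ` e \<inter> f ` S = f ` (e \<inter> S)" using inj_on_image_Int[OF inj e S] by simp
    then show "f ` e \<inter> f ` S \<noteq> {} \<longleftrightarrow> e \<inter> S \<noteq> {}" by auto
    have "f ` e - f ` S = f ` (e - S)"
      using e S by (intro inj_on_image_set_diff[OF inj, symmetric]) auto
    then show "f ` e - f ` S \<noteq> {} \<longleftrightarrow> e - S \<noteq> {}" by auto
  qed
  have "cut_edges ((`) f ` F) (f ` S) = (`) f ` {e \<in> F. f ` e \<inter> f ` S \<noteq> {} \<and> f ` e - f ` S \<noteq> {}}"
    unfolding cut_edges_def by blast
  also have "{e \<in> F. f ` e \<inter> f ` S \<noteq> {} \<and> f ` e - f ` S \<noteq> {}} = cut_edges F S"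
    unfolding cut_edges_def using * by (intro Collect_cong) metis
  finally have "cut_edges ((`) f ` F) (f ` S) = (`) f ` cut_edges F S" .
  moreover have "inj_on ((`) f) (cut_edges F S)"
    using relabel_inj[OF sg] by (rule inj_on_subset) (auto simp: cut_edges_def)
  ultimately show ?thesis by (simp add: card_image)
qed

lemma relabel_no_short_cycle:
  assumes sg: "simple_graph V F" and ns: "no_short_cycle F"
  shows "no_short_cycle ((`) f ` F)"
proof -
  have "{c, a} \<notin> (`) f ` F" if t: "distinct [a, b, c]" "{a, b} \<in> (`) f ` F" "{b, c} \<in> (`) f ` F" for a b c
  proof
    assume ca: "{c, a} \<in> (`) f ` F"
    obtain a0 b0 where 1: "a = f a0" "b = f b0" "a0 \<in> V" "b0 \<in> V" "{a0, b0} \<in> F"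
      using relabel_edgeE[OF sg t(2)] .
    obtain c0 a1 where 2: "c = f c0" "a = f a1" "c0 \<in> V" using relabel_edgeE[OF sg ca] .
    have "{b0, c0} \<in> F" "{c0, a0} \<in> F" using 1 2 t ca relabel_edge_iff[OF sg] by auto
    moreover have "distinct [a0, b0, c0]" using 1 2 t(1) by auto
    ultimately show False using ns 1(5) unfolding no_short_cycle_def by blast
  qed
  moreover have "{d, a} \<notin> (`) f ` F"
    if t: "distinct [a, b, c, d]" "{a, b} \<in> (`) f ` F" "{b, c} \<in> (`) f ` F" "{c, d} \<in> (`) f ` F" for a b c d
  proof
    assume da: "{d, a} \<in> (`) f ` F"
    obtain a0 b0 where 1: "a = f a0" "b = f b0" "a0 \<in> V" "b0 \<in> V" "{a0, b0} \<in> F"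
      using relabel_edgeE[OF sg t(2)] .
    obtain c0 d0 where 2: "c = f c0" "d = f d0" "c0 \<in> V" "d0 \<in> V" "{c0, d0} \<in> F"
      using relabel_edgeE[OF sg t(4)] .
    have "{b0, c0} \<in> F" "{d0, a0} \<in> F" using 1 2 t da relabel_edge_iff[OF sg] by auto
    moreover have "distinct [a0, b0, c0, d0]" using 1 2 t(1) by auto
    ultimately show False using ns 1(5) 2(5) unfolding no_short_cycle_def by blast
  qed
  ultimately show ?thesis unfolding no_short_cycle_def by blast
qed

text \<open>Connectivity is transferred in its form with cuts and cardinalities: every vertex set of
  the image is the image of a set of the same size, so cycles on the two sides need not be pulled
  back.\<close>

lemma relabel_snark:
  assumes sn: "snark V E"
  shows "snark (f ` V) ((`) f ` E)"
proof -
  let ?E = "(`) f ` E" let ?V = "f ` V"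
  have cub: "cubic V E" using sn by (simp add: snark_def)
  have sg: "simple_graph V E" using cub by (simp add: cubic_def)
  have cub': "cubic ?V ?E" using cub relabel_simple[OF sg] relabel_deg[OF sg] by (auto simp: cubic_def)
  have star: "\<And>S. S \<subseteq> V \<Longrightarrow> 2 \<le> card S \<Longrightarrow> 2 \<le> card (V - S) \<Longrightarrow> 4 \<le> card (cut_edges E S)"
    using sn cyc_4_edge_connected_iff[OF cub] by (simp add: snark_def)
  have "cyc_4_edge_connected ?V ?E"
    unfolding cyc_4_edge_connected_iff[OF cub']
  proof (intro allI impI)
    fix S assume S: "S \<subseteq> ?V" "2 \<le> card S" "2 \<le> card (?V - S)"
    then obtain S0 where S0: "S0 \<subseteq> V" "S = f ` S0" by (auto elim: subset_imageE)
    have "?V - S = f ` (V - S0)" unfolding S0(2)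
      using S0(1) by (intro inj_on_image_set_diff[OF inj, symmetric]) auto
    then have "card (?V - S) = card (V - S0)"
      using card_image[OF inj_on_subset[OF inj, of "V - S0"]] by auto
    moreover have "card S = card S0" using S0 card_image[OF inj_on_subset[OF inj S0(1)]] by simp
    ultimately have "4 \<le> card (cut_edges E S0)" using star S0(1) S by simp
    then show "4 \<le> card (cut_edges ?E S)" using relabel_cut[OF sg S0(1)] S0(2) by simp
  qed
  moreover have "girth_ge ?E 5"
    using relabel_no_short_cycle[OF sg] sn by (simp add: snark_def girth_ge_5_iff)
  moreover have "\<not> three_edge_colourable ?E"
  proof
    assume "three_edge_colourable ?E"
    then obtain c :: "'b set \<Rightarrow> nat" where c: "\<And>e. e \<in> ?E \<Longrightarrow> c e < 3"
      "\<And>e e'. e \<in> ?E \<Longrightarrow> e' \<in> ?E \<Longrightarrow> e \<noteq> e' \<Longrightarrow> e \<inter> e' \<noteq> {} \<Longrightarrow> c e \<noteq> c e'"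
      unfolding three_edge_colourable_def by metis
    have "three_edge_colourable E"
      unfolding three_edge_colourable_def
    proof (intro exI[of _ "\<lambda>e. c (f ` e)"] conjI ballI impI)
      fix e assume e: "e \<in> E"
      then show "c (f ` e) < 3" using c(1) by blast
      fix e' assume e': "e' \<in> E" "e \<noteq> e' \<and> e \<inter> e' \<noteq> {}"
      have "f ` e \<noteq> f ` e'" using relabel_inj[OF sg] e e' by (meson inj_onD)
      moreover have "f ` e \<inter> f ` e' \<noteq> {}" using e'(2) by auto
      ultimately show "c (f ` e) \<noteq> c (f ` e')" using c(2) e e' by blast
    qed
    then show False using sn by (simp add: snark_def)
  qed
  ultimately show ?thesis using cub' by (simp add: snark_def)
qed

lemma relabel_path:
  "(adj F)\<^sup>*\<^sup>* u w \<Longrightarrow> (adj ((`) f ` F))\<^sup>*\<^sup>* (f u) (f w)"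
proof (induction rule: rtranclp_induct)
  case (step a b)
  have "adj ((`) f ` F) (f a) (f b)" using step(2) by (auto simp: adj_def intro: rev_image_eqI)
  then show ?case using step by auto
qed simp

text \<open>Acyclicity is transferred through the numbers of edges and vertices, which an injective
  renaming preserves.\<close>

lemma relabel_hist:
  assumes sg: "simple_graph V E" and ne: "V \<noteq> {}" and h: "hist V E T"
  shows "hist (f ` V) ((`) f ` E) ((`) f ` T)"
proof -
  have T: "T \<subseteq> E" "\<And>u v. u \<in> V \<Longrightarrow> v \<in> V \<Longrightarrow> (adj T)\<^sup>*\<^sup>* u v" "\<nexists>vs. cycle_in T vs"
    "\<And>v. v \<in> V \<Longrightarrow> deg T v = 1 \<or> deg T v = 3"
    using h by (auto simp: hist_def spanning_tree_def)
  have sT: "simple_graph V T" by (rule simple_graph_subset[OF sg T(1)])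
  have conn: "(adj ((`) f ` T))\<^sup>*\<^sup>* u v" if "u \<in> f ` V" "v \<in> f ` V" for u v
    using that T(2) relabel_path by auto
  have "card T + 1 = card V" using tree_card_iff[OF sT ne T(2)] T(3) by simp
  then have "card ((`) f ` T) + 1 = card (f ` V)"
    using card_image[OF inj] card_image[OF relabel_inj[OF sT]] by simp
  then have "\<nexists>vs. cycle_in ((`) f ` T) vs"
    using tree_card_iff[OF relabel_simple[OF sT] _ conn] ne by simp
  then show ?thesis
    using conn T(1,4) relabel_deg[OF sT] unfolding hist_def spanning_tree_def by (auto simp: image_mono)
qed

lemma relabel_oc:
  assumes cub: "cubic V E" and ns: "no_short_cycle E" and h: "hist V E T"
  shows "oc (f ` V) ((`) f ` E) ((`) f ` T) = oc V E T"
proof -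
  let ?L = "leaves V T" let ?F = "E - T" let ?F' = "(`) f ` (E - T)"
  note hs = hist_simple[OF cub ns h]
  have LV: "?L \<subseteq> V" by (auto simp: leaves_def)
  have sL: "simple_graph ?L ?F" by (rule nontree_simple[OF cub ns h])
  have sF: "simple_graph V ?F" by (rule simple_graph_subset[OF hs(1)]) auto
  have L': "leaves (f ` V) ((`) f ` T) = f ` ?L"
    using relabel_deg[OF hs(2)] by (auto simp: leaves_def)
  have F': "(`) f ` E - (`) f ` T = ?F'"
    using hs(3) by (intro inj_on_image_set_diff[OF relabel_inj[OF hs(1)], symmetric]) auto
  have sL': "simple_graph (f ` ?L) ?F'"
    unfolding simple_graph_def
  proof (intro conjI ballI)
    show "finite (f ` ?L)" using sL by (simp add: simple_graph_def)
    fix e assume "e \<in> ?F'"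
    then obtain e0 where e0: "e0 \<in> ?F" "e = f ` e0" by auto
    then obtain a b where "e0 = {a, b}" "a \<noteq> b" "a \<in> ?L" "b \<in> ?L"
      using sL by (blast elim: simple_graph_edgeE)
    then have "e = {f a, f b}" "f a \<noteq> f b" "f a \<in> f ` ?L" "f b \<in> f ` ?L"
      using e0(2) inj LV by (auto dest: inj_onD)
    then show "\<exists>u v. e = {u, v} \<and> u \<noteq> v \<and> u \<in> f ` ?L \<and> v \<in> f ` ?L" by blast
  qed
  have comp: "component ?F' (f u) = f ` component ?F u" if u: "u \<in> ?L" for u
  proof
    show "f ` component ?F u \<subseteq> component ?F' (f u)" using relabel_path by (auto simp: component_def)
    have cV: "component ?F u \<subseteq> V" using component_subset[OF sL u] LV by auto
    have cl: "b \<in> f ` component ?F u" if ab: "{a, b} \<in> ?F'" "a \<in> f ` component ?F u" for a b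
    proof -
      obtain a0 b0 where 1: "a = f a0" "b = f b0" "a0 \<in> V" "b0 \<in> V" "{a0, b0} \<in> ?F"
        using relabel_edgeE[OF sF ab(1)] .
      obtain a1 where a1: "a = f a1" "a1 \<in> component ?F u" using ab(2) by blast
      then have "a0 = a1" using 1(1,3) cV inj by (metis inj_onD subsetD)
      then have "a0 \<in> component ?F u" using a1 by simp
      then have "b0 \<in> component ?F u" using component_closed[OF 1(5)] by blast
      then show ?thesis using 1 by blast
    qed
    have "f u \<in> f ` component ?F u" by (rule imageI[OF component_self])
    then show "component ?F' (f u) \<subseteq> f ` component ?F u"
      using adj_rtranclp_closed[of ?F' "f ` component ?F u" "f u"] cl by (auto simp: component_def)
  qed
  have cl: "classes (f ` ?L) ?F' = (`) f ` classes ?L ?F"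
    unfolding classes_component[OF sL] classes_component[OF sL'] image_image
    using comp by (rule image_cong[OF refl])
  have sub: "C \<subseteq> V" if "C \<in> classes ?L ?F" for C using that LV by (auto simp: classes_def)
  \<comment> \<open>Distinct classes must keep distinct images, or the multiset of lengths would
    lose a copy.\<close>
  have injc: "inj_on ((`) f) (classes ?L ?F)"
    by (rule inj_on_subset[OF inj_on_image_Pow[OF inj]]) (use sub in auto)
  have "image_mset card (mset_set ((`) f ` classes ?L ?F)) =
      image_mset (\<lambda>C. card (f ` C)) (mset_set (classes ?L ?F))"
    by (simp add: image_mset_mset_set[OF injc, symmetric] multiset.map_comp comp_def)
  also have "\<dots> = image_mset card (mset_set (classes ?L ?F))"
  proof (rule image_mset_cong)
    fix C assume "C \<in># mset_set (classes ?L ?F)"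
    then have "C \<in> classes ?L ?F" by (metis elem_mset_set empty_iff mset_set.infinite set_mset_empty)
    then show "card (f ` C) = card C" using sub inj by (meson card_image inj_on_subset)
  qed
  finally show ?thesis unfolding oc_def outer_cycles_classes L' F' cl .
qed

end

section \<open>Hists of glued graphs\<close>

definition subdiv2 :: "'a set set \<Rightarrow> 'a \<Rightarrow> 'a \<Rightarrow> 'a \<Rightarrow> 'a \<Rightarrow> 'a \<Rightarrow> 'a set set" where
  "subdiv2 F v w1 w2 p1 p2 = subdiv (subdiv F v w1 p1) v w2 p2"

lemma subdiv_connected_all:
  assumes "\<And>a b. a \<in> V \<Longrightarrow> b \<in> V \<Longrightarrow> (adj T)\<^sup>*\<^sup>* a b" "u \<in> V"
    and ab: "a \<in> insert p V" "b \<in> insert p V"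
  shows "(adj (subdiv T u w p))\<^sup>*\<^sup>* a b"
proof -
  let ?R = "(adj (subdiv T u w p))\<^sup>*\<^sup>*"
  have up: "?R u p" by (intro r_into_rtranclp) (simp add: adj_def subdiv_def)
  have "?R u z" if "z \<in> insert p V" for z
    using that up assms(1,2) subdiv_connected[of T u z u w p] by auto
  then show ?thesis using ab adj_rtranclp_sym by (meson rtranclp_trans)
qed

context
  fixes V :: "'a set" and F :: "'a set set" and v w1 w2 p1 p2 :: 'a
  assumes sg: "simple_graph V F" and e: "{v, w1} \<in> F" "{v, w2} \<in> F" "w1 \<noteq> w2"
    and p: "p1 \<notin> V" "p2 \<notin> V" "p1 \<noteq> p2"
begin

lemma subdiv2_step: "simple_graph (insert p1 V) (subdiv F v w1 p1)" "{v, w2} \<in> subdiv F v w1 p1"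
    "p2 \<notin> insert p1 V" "v \<in> V"
  using simple_graph_subdiv[OF sg e(1) p(1)] e p simple_graph_edge[OF sg e(1)]
  by (auto intro!: subdiv_edge_old simp: doubleton_eq_iff)

lemma subdiv2_simple: "simple_graph (insert p2 (insert p1 V)) (subdiv2 F v w1 w2 p1 p2)"
  unfolding subdiv2_def by (rule simple_graph_subdiv[OF subdiv2_step(1-3)])

lemma subdiv2_deg: "z \<in> V \<Longrightarrow> deg (subdiv2 F v w1 w2 p1 p2) z = deg F z"
    "deg (subdiv2 F v w1 w2 p1 p2) p1 = 2" "deg (subdiv2 F v w1 w2 p1 p2) p2 = 2"
  unfolding subdiv2_def
  using deg_subdiv[OF subdiv2_step(1-3)] deg_subdiv_new[OF subdiv2_step(1-3)]
    deg_subdiv[OF sg e(1) p(1)] deg_subdiv_new[OF sg e(1) p(1)] by simp_all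

lemma subdiv2_card: "card (subdiv2 F v w1 w2 p1 p2) = card F + 2"
  unfolding subdiv2_def using card_subdiv[OF subdiv2_step(1-3)] card_subdiv[OF sg e(1) p(1)] by simp

lemma subdiv2_connected:
  assumes "\<And>a b. a \<in> V \<Longrightarrow> b \<in> V \<Longrightarrow> (adj F)\<^sup>*\<^sup>* a b"
    and "a \<in> insert p2 (insert p1 V)" "b \<in> insert p2 (insert p1 V)"
  shows "(adj (subdiv2 F v w1 w2 p1 p2))\<^sup>*\<^sup>* a b"
  unfolding subdiv2_def
proof (rule subdiv_connected_all[OF _ _ assms(2,3)])
  show "v \<in> insert p1 V" using subdiv2_step(4) by simp
  show "(adj (subdiv F v w1 p1))\<^sup>*\<^sup>* a b" if "a \<in> insert p1 V" "b \<in> insert p1 V" for a b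
    by (rule subdiv_connected_all[OF assms(1) subdiv2_step(4) that])
qed

lemma subdiv2_diff:
  assumes "T \<subseteq> F" "{v, w1} \<in> T" "{v, w2} \<in> T"
  shows "subdiv2 F v w1 w2 p1 p2 - subdiv2 T v w1 w2 p1 p2 = F - T"
proof -
  have "{v, w2} \<in> subdiv T v w1 p1" using assms(3) e(3) by (intro subdiv_edge_old) (auto simp: doubleton_eq_iff)
  then show ?thesis
    unfolding subdiv2_def using subdiv_diff[OF subdiv2_step(1-3) subdiv_mono[OF assms(1)]]
      subdiv_diff[OF sg e(1) p(1) assms(1,2)] by simp
qed

end

lemma subdiv2_mono: "T \<subseteq> E \<Longrightarrow> subdiv2 T v w1 w2 p1 p2 \<subseteq> subdiv2 E v w1 w2 p1 p2"
  by (simp add: subdiv2_def subdiv_mono)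

lemma subdiv2_edge_old:
  "{a, b} \<in> E \<Longrightarrow> {a, b} \<noteq> {v, w1} \<Longrightarrow> {a, b} \<noteq> {v, w2} \<Longrightarrow> {a, b} \<in> subdiv2 E v w1 w2 p1 p2"
  by (simp add: subdiv2_def subdiv_edge_old)

text \<open>The edge \<open>xy\<close> is counted in both degrees, hence the
  \<open>+ 1\<close>.\<close>

lemma card_del2:
  assumes sg: "simple_graph V F" and xy: "{x, y} \<in> F"
  shows "card (del2 F x y) + deg F x + deg F y = card F + 1"
proof -
  have fin: "finite F" by (rule simple_graph_finite[OF sg])
  have ne: "x \<noteq> y" using simple_graph_edge[OF sg xy] by simp
  have i: "inc F x \<inter> inc F y = {{x, y}}"
  proof (intro equalityI subsetI)
    fix e assume e: "e \<in> inc F x \<inter> inc F y"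
    then obtain a b where "e = {a, b}" using sg by (blast elim: simple_graph_edgeE)
    then show "e \<in> {{x, y}}" using e ne by auto
  qed (use xy in auto)
  have "F = del2 F x y \<union> (inc F x \<union> inc F y)" by (auto simp: del2_def)
  then have "card F = card (del2 F x y \<union> (inc F x \<union> inc F y))" by simp
  also have "\<dots> = card (del2 F x y) + card (inc F x \<union> inc F y)"
    using fin by (intro card_Un_disjoint) (auto simp: del2_def)
  finally have "card F = card (del2 F x y) + card (inc F x \<union> inc F y)" .
  moreover have "deg F x + deg F y = card (inc F x \<union> inc F y) + 1"
    unfolding deg_def using fin card_Un_Int[of "inc F x" "inc F y"] i by simp
  ultimately show ?thesis by simp
qed

text \<open>On a path towards \<open>x\<close>, the vertex just before the first entry into
  \<open>x\<close> or \<open>y\<close> is an end of a deleted edge, and the path up to it is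
  intact.\<close>

lemma del2_reach:
  assumes sg: "simple_graph V F" and p: "(adj F)\<^sup>*\<^sup>* z x" and z: "z \<in> V - {x, y}"
  shows "\<exists>w\<in>ends2 V F x y. (adj (del2 F x y))\<^sup>*\<^sup>* w z"
proof -
  have "z = x \<or> z = y \<or> (\<exists>w\<in>ends2 V F x y. (adj (del2 F x y))\<^sup>*\<^sup>* w z)"
    using p
  proof (induction rule: converse_rtranclp_induct)
    case (step a b)
    have ab: "{a, b} \<in> F" "a \<in> V" "b \<in> V" using step(1) simple_graph_edge[OF sg, of a b] by (auto simp: adj_def)
    show ?case
    proof (cases "a = x \<or> a = y")
      case False
      show ?thesis
      proof (cases "b = x \<or> b = y")
        case True
        then have "a \<in> ends2 V F x y" using False ab by (auto simp: ends2_def)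
        then show ?thesis by blast
      next
        case b: False
        then obtain w where w: "w \<in> ends2 V F x y" "(adj (del2 F x y))\<^sup>*\<^sup>* w b" using step by blast
        have "adj (del2 F x y) b a" using ab False b by (auto simp: adj_def del2_def insert_commute)
        then show ?thesis using w by (meson rtranclp.rtrancl_into_rtrancl)
      qed
    qed auto
  qed simp
  then show ?thesis using z by blast
qed

text \<open>Connectivity and the count of edges against vertices make the result a tree. A
  connecting edge taken into the tree raises the tree degree of its two ports; the remaining ones,
  in \<open>cross (P - Q)\<close>, become edges of outer cycles.\<close>

lemma (in matching) glue_hist:
  assumes sg: "simple_graph V1 E1" "simple_graph V2 E2" and T: "T1 \<subseteq> E1" "T2 \<subseteq> E2" and Q: "Q \<subseteq> P"
    and conn: "\<And>a b. a \<in> V1 \<Longrightarrow> b \<in> V1 \<Longrightarrow> (adj T1)\<^sup>*\<^sup>* a b"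
      "\<And>z. z \<in> V2 \<Longrightarrow> \<exists>w\<in>f ` Q. (adj T2)\<^sup>*\<^sup>* w z"
    and card: "card T1 + card T2 + card Q + 1 = card V1 + card V2" and ne: "V1 \<noteq> {}"
    and d: "\<And>z. z \<in> V1 \<Longrightarrow> deg T1 z + of_bool (z \<in> Q) = 1 \<or> deg T1 z + of_bool (z \<in> Q) = 3"
      "\<And>z. z \<in> V2 \<Longrightarrow> deg T2 z + of_bool (z \<in> f ` Q) = 1 \<or> deg T2 z + of_bool (z \<in> f ` Q) = 3"
  shows "hist (V1 \<union> V2) (glue E1 E2 P) (glue T1 T2 Q)"
    and "glue E1 E2 P - glue T1 T2 Q = (E1 - T1) \<union> (E2 - T2) \<union> cross (P - Q)"
    and "leaves (V1 \<union> V2) (glue T1 T2 Q) =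
      {z \<in> V1. deg T1 z + of_bool (z \<in> Q) = 1} \<union> {z \<in> V2. deg T2 z + of_bool (z \<in> f ` Q) = 1}"
proof -
  have s1: "simple_graph V1 T1" and s2: "simple_graph V2 T2"
    using sg T simple_graph_subset by blast+
  let ?T = "glue T1 T2 Q"
  note sT = glue_simple[OF s1 s2 Q]
  have conn': "(adj ?T)\<^sup>*\<^sup>* a b" if "a \<in> V1 \<union> V2" "b \<in> V1 \<union> V2" for a b
    using glue_connected[OF s1 s2 Q conn(1) _ that] conn(2) by blast
  have "card (V1 \<union> V2) = card V1 + card V2"
    using sg disj by (intro card_Un_disjoint) (auto simp: simple_graph_def)
  then have "card ?T + 1 = card (V1 \<union> V2)" using card_glue[OF s1 s2 Q] card by simp
  then have "\<nexists>vs. cycle_in ?T vs" using tree_card_iff[OF sT _ conn'] ne by simp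
  moreover have "?T \<subseteq> glue E1 E2 P" using T Q by (auto simp: glue_def cross_def)
  moreover have "deg ?T z = 1 \<or> deg ?T z = 3" if "z \<in> V1 \<union> V2" for z
    using that
  proof
    assume "z \<in> V1" then show ?thesis using deg_glue_left[OF s1 s2 Q, of z] d(1)[of z] by simp
  next
    assume "z \<in> V2" then show ?thesis using deg_glue_right[OF s1 s2 Q, of z] d(2)[of z] by simp
  qed
  ultimately show "hist (V1 \<union> V2) (glue E1 E2 P) ?T"
    using conn' unfolding hist_def spanning_tree_def by blast
  show "leaves (V1 \<union> V2) ?T =
      {z \<in> V1. deg T1 z + of_bool (z \<in> Q) = 1} \<union> {z \<in> V2. deg T2 z + of_bool (z \<in> f ` Q) = 1}"
    unfolding leaves_def using deg_glue_left[OF s1 s2 Q] deg_glue_right[OF s1 s2 Q] by auto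
  have "inj_on (\<lambda>p. {p, f p}) P"
    using disj P img by (fastforce simp: inj_on_def doubleton_eq_iff)
  then have "cross P - cross Q = cross (P - Q)"
    unfolding cross_def using Q by (intro inj_on_image_set_diff[symmetric]) auto
  moreover have "E1 \<inter> E2 = {}" "(E1 \<union> E2) \<inter> cross P = {}"
    using glue_disjoint[OF sg subset_refl] by auto
  moreover have "cross Q \<subseteq> cross P" using Q by (auto simp: cross_def)
  ultimately show "glue E1 E2 P - ?T = (E1 - T1) \<union> (E2 - T2) \<union> cross (P - Q)"
    using T unfolding glue_def by blast
qed

section \<open>The two constructions\<close>

lemma snark_nonempty: "snark V E \<Longrightarrow> V \<noteq> {}"
proof
  assume "snark V E" "V = {}"
  then have "E = {}" by (auto simp: snark_def cubic_def simple_graph_def)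
  then show False using \<open>snark V E\<close> by (simp add: snark_def three_edge_colourable_def)
qed

lemma inc_eq_of_deg_eq:
  assumes "simple_graph V E" "T \<subseteq> E" "deg T z = deg E z"
  shows "inc T z = inc E z"
  using assms simple_graph_finite[OF assms(1)] by (intro card_subset_eq) (auto simp: deg_def)

text \<open>A common neighbour of \<open>x\<close> and \<open>y\<close> would close a triangle on
  the edge \<open>xy\<close>.\<close>

lemma neighbours_distinct:
  assumes ns: "no_short_cycle E"
    and x: "inc E x = {{x, y}, {x, r}, {x, s}}" "distinct [x, y, r, s]"
    and y: "inc E y = {{x, y}, {y, t}, {y, u}}" "distinct [y, x, t, u]"
  shows "distinct [x, y, r, s, t, u]"
proof -
  have xy: "{x, y} \<in> E" using x by auto
  have "a \<noteq> b" if "{x, a} \<in> E" "{y, b} \<in> E" "a \<notin> {x, y}" for a b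
    using no_triangle[OF ns xy, of a] that x(2) by (auto simp: insert_commute)
  moreover have "{x, r} \<in> E" "{x, s} \<in> E" using x(1) by auto
  moreover have "{y, t} \<in> E" "{y, u} \<in> E" using y(1) by auto
  ultimately show ?thesis using x(2) y(2) by auto
qed

lemma inc_member: "inc F x = X \<Longrightarrow> {z, x} \<in> F \<longleftrightarrow> {z, x} \<in> X"
  by auto

text \<open>Stated for any simple graph because it serves for \<open>EH\<close> and, when
  \<open>x\<close> and \<open>y\<close> are both inner, also for the tree \<open>TH\<close>.\<close>

lemma ends2_eq:
  assumes sg: "simple_graph V E" and dist: "distinct [x, y, r, s, t, u]"
    and x: "inc E x = {{x, y}, {x, r}, {x, s}}" and y: "inc E y = {{x, y}, {y, t}, {y, u}}"
  shows "ends2 V E x y = {r, s, t, u}"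
proof -
  have "{r, s, t, u} \<subseteq> V"
  proof -
    have "{x, r} \<in> E" "{x, s} \<in> E" using x by auto
    moreover have "{y, t} \<in> E" "{y, u} \<in> E" using y by auto
    ultimately show ?thesis using simple_graph_edge(3)[OF sg] by blast
  qed
  moreover have "{z, x} \<in> E \<longleftrightarrow> z \<in> {y, r, s}" for z
    unfolding inc_member[OF x] using dist by (auto simp: doubleton_eq_iff)
  moreover have "{z, y} \<in> E \<longleftrightarrow> z \<in> {x, t, u}" for z
    unfolding inc_member[OF y] using dist by (auto simp: doubleton_eq_iff)
  ultimately show ?thesis using dist by (auto simp: ends2_def)
qed

context
  fixes V :: "'a set" and E T :: "'a set set" and x y :: 'a
  assumes cub: "cubic V E" and ns: "no_short_cycle E" and hist: "hist V E T" and xy: "{x, y} \<in> T"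
begin

lemma hist_del2_deg:
  assumes z: "z \<in> V - {x, y}"
  shows "deg T z = deg (del2 T x y) z + of_bool (z \<in> ends2 V T x y)"
proof -
  note hs = hist_simple[OF cub ns hist]
  have ne: "x \<noteq> y" using simple_graph_edge[OF hs(2) xy] by simp
  have "\<not> ({z, x} \<in> T \<and> {z, y} \<in> T)"
  proof
    assume "{z, x} \<in> T \<and> {z, y} \<in> T"
    then have "{x, y} \<in> E" "{y, z} \<in> E" "{z, x} \<in> E" using xy hs(3) by (auto simp: insert_commute)
    then show False using no_triangle[OF ns] z ne by auto
  qed
  then show ?thesis using deg_del2[OF hs(2), of z x y] z ne by (auto simp: ends2_def)
qed

lemma hist_del2_reach:
  assumes z: "z \<in> V - {x, y}"
  shows "\<exists>w\<in>ends2 V T x y. (adj (del2 T x y))\<^sup>*\<^sup>* w z"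
proof (rule del2_reach[OF hist_simple(2)[OF cub ns hist] _ z])
  have "x \<in> V" using simple_graph_edge[OF hist_simple(2)[OF cub ns hist] xy] by simp
  then show "(adj T)\<^sup>*\<^sup>* z x" using hist z by (auto simp: hist_def spanning_tree_def)
qed

text \<open>The remnant of a tree has \<open>deg T x + deg T y - 2\<close> edges fewer than
  vertices, which is its number of subtrees: four for two inner vertices, two for a leaf and its
  parent. This matches the connecting edges put into the new tree.\<close>

lemma hist_del2_card:
  "card (del2 T x y) + deg T x + deg T y + 1 = card (V - {x, y}) + 3"
  "finite V" "x \<in> V" "y \<in> V" "x \<noteq> y"
proof -
  note hs = hist_simple[OF cub ns hist]
  show m: "finite V" "x \<in> V" "y \<in> V" "x \<noteq> y"
    using simple_graph_edge[OF hs(2) xy] hs(1) by (auto simp: simple_graph_def)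
  have "card {x, y} \<le> card V" using m by (intro card_mono) auto
  then have "card (V - {x, y}) + 2 = card V" using m by (simp add: card_Diff_subset)
  moreover have "card T + 1 = card V" using hist_card[OF cub ns hist] m by auto
  ultimately show "card (del2 T x y) + deg T x + deg T y + 1 = card (V - {x, y}) + 3"
    using card_del2[OF hs(2) xy] by simp
qed

end

lemma oc_disjoint_Un:
  assumes "finite L1" "finite L2" "L1 \<inter> L2 = {}"
  shows "image_mset card (mset_set (classes L1 F1 \<union> classes L2 F2)) =
    image_mset card (mset_set (classes L1 F1)) + image_mset card (mset_set (classes L2 F2))"
  using assms classes_disjoint[OF assms(3)] by (simp add: mset_set_Union classes_finite)

lemma Collect_eq_on: "(\<And>z. z \<in> A \<Longrightarrow> h z = h' z) \<Longrightarrow> {z \<in> A. h z = n} = {z \<in> A. h' z = n}"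
  by auto

text \<open>Every edge that is subdivided or lies at a deleted vertex is a tree edge, and every new
  vertex ends with tree degree 3. So neither the leaves nor the edges outside the trees change, and
  the outer cycles of both graphs are put side by side.\<close>

lemma glue_at_inner_edges:
  fixes VG VH :: "'a set"
  assumes snG: "snark VG EG" and hG: "hist VG EG TG" and snH: "snark VH EH" and hH: "hist VH EH TH"
    and dj: "VG \<inter> VH = {}"
    and p: "distinct [p1, p2, q1, q2]" "{p1, p2, q1, q2} \<inter> (VG \<union> VH) = {}"
  shows "\<exists>(V' :: 'a set) E' T'. snark V' E' \<and> hist V' E' T' \<and> oc V' E' T' = oc VG EG TG + oc VH EH TH"
proof -
  have cubG: "cubic VG EG" and cycG: "cyc_4_edge_connected VG EG" and nsG: "no_short_cycle EG"
    and ncG: "\<not> three_edge_colourable EG" using snG by (auto simp: snark_def girth_ge_5_iff)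
  have cubH: "cubic VH EH" and cycH: "cyc_4_edge_connected VH EH" and nsH: "no_short_cycle EH"
    and ncH: "\<not> three_edge_colourable EH" using snH by (auto simp: snark_def girth_ge_5_iff)
  note hsG = hist_simple[OF cubG nsG hG] and hsH = hist_simple[OF cubH nsH hH]
  obtain x y where xy: "{x, y} \<in> TH" "deg TH x = 3" "deg TH y = 3"
    using inner_edge[OF cubH nsH hH snark_nonempty[OF snH]] .
  have xyV: "x \<in> VH" "y \<in> VH" using simple_graph_edge[OF hsH(2) xy(1)] by auto
  obtain r s where xT: "inc TH x = {{x, y}, {x, r}, {x, s}}" "distinct [x, y, r, s]"
    using deg3_neighbours[OF hsH(2) xy(2,1)] .
  have yx: "{y, x} \<in> TH" using xy(1) by (simp add: insert_commute)
  obtain t u where yT': "inc TH y = {{y, x}, {y, t}, {y, u}}" and yd: "distinct [y, x, t, u]"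
    using deg3_neighbours[OF hsH(2) xy(3) yx] .
  have "{y, x} = {x, y}" by auto
  note yT = yT'[unfolded this] yd
  \<comment> \<open>All edges at an inner vertex are tree edges, so \<open>x\<close> and
    \<open>y\<close> have the same neighbours in the graph as in its tree.\<close>
  have xE: "inc EH x = inc TH x" and yE: "inc EH y = inc TH y"
    using inc_eq_of_deg_eq[OF hsH(1,3)] xy hist_deg(2)[OF cubH nsH hH] xyV by auto
  note xE' = xE[unfolded xT(1)] and yE' = yE[unfolded yT(1)]
  have dist: "distinct [x, y, r, s, t, u]" by (rule neighbours_distinct[OF nsH xE' xT(2) yE' yT(2)])
  \<comment> \<open>The edge between \<open>v\<close> and \<open>v'\<close> stays whole: at each of
    them the two other edges are subdivided, so that these four are distinct.\<close>
  obtain v v' where v: "{v, v'} \<in> TG" "deg TG v = 3" "deg TG v' = 3"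
    using inner_edge[OF cubG nsG hG snark_nonempty[OF snG]] .
  have vV: "v \<in> VG" "v' \<in> VG" "v \<noteq> v'" using simple_graph_edge[OF hsG(2) v(1)] by auto
  obtain w1 w2 where vT: "inc TG v = {{v, v'}, {v, w1}, {v, w2}}" "distinct [v, v', w1, w2]"
    using deg3_neighbours[OF hsG(2) v(2,1)] .
  have v'v: "{v', v} \<in> TG" using v(1) by (simp add: insert_commute)
  obtain w1' w2' where vT': "inc TG v' = {{v', v}, {v', w1'}, {v', w2'}}" "distinct [v', v, w1', w2']"
    using deg3_neighbours[OF hsG(2) v(3) v'v] .
  have eT: "{v, w1} \<in> TG" "{v, w2} \<in> TG" using vT(1) by auto
  have eT': "{v', w1'} \<in> TG" "{v', w2'} \<in> TG" using vT'(1) by auto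
  have eE: "{v, w1} \<in> EG" "{v, w2} \<in> EG" "{v', w1'} \<in> EG" "{v', w2'} \<in> EG"
    using eT eT' hsG(3) by auto
  have w: "w1 \<noteq> w2" "w1' \<noteq> w2'" using vT vT' by auto
  have dje: "{v', w1'} \<noteq> {v, w1}" "{v', w1'} \<noteq> {v, w2}" "{v', w2'} \<noteq> {v, w1}" "{v', w2'} \<noteq> {v, w2}"
    using vT(2) vT'(2) by (auto simp: doubleton_eq_iff)

  let ?Vm = "insert p2 (insert p1 VG)"
  let ?Em = "subdiv2 EG v w1 w2 p1 p2" let ?Tm = "subdiv2 TG v w1 w2 p1 p2"
  let ?V1 = "insert q2 (insert q1 ?Vm)"
  let ?E1 = "subdiv2 ?Em v' w1' w2' q1 q2" let ?T1 = "subdiv2 ?Tm v' w1' w2' q1 q2"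
  let ?V2 = "VH - {x, y}" let ?E2 = "del2 EH x y" let ?T2 = "del2 TH x y"
  let ?P = "{p1, p2, q1, q2}"
  define f where "f = (\<lambda>z. if z = p1 then r else if z = p2 then s else if z = q1 then t else u)"
  have f: "f p1 = r" "f p2 = s" "f q1 = t" "f q2 = u" using p(1) by (auto simp: f_def)
  have pn: "p1 \<notin> VG" "p2 \<notin> VG" "p1 \<noteq> p2" and qn: "q1 \<notin> ?Vm" "q2 \<notin> ?Vm" "q1 \<noteq> q2" using p by auto
  have emE: "{v', w1'} \<in> ?Em" "{v', w2'} \<in> ?Em"
    by (rule subdiv2_edge_old[OF eE(3) dje(1,2)], rule subdiv2_edge_old[OF eE(4) dje(3,4)])
  have emT: "{v', w1'} \<in> ?Tm" "{v', w2'} \<in> ?Tm"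
    by (rule subdiv2_edge_old[OF eT'(1) dje(1,2)], rule subdiv2_edge_old[OF eT'(2) dje(3,4)])
  note mE = hsG(1) eE(1,2) w(1) pn
  note mT = hsG(2) eT w(1) pn
  note sEm = subdiv2_simple[OF mE] and sTm = subdiv2_simple[OF mT]
  note nE = sEm emE w(2) qn
  note nT = sTm emT w(2) qn
  note sE1 = subdiv2_simple[OF nE] and sT1 = subdiv2_simple[OF nT]
  note sE2 = simple_graph_del2[OF hsH(1), of x y]
  have fP: "f ` ?P = {r, s, t, u}" by (simp add: f)
  have eE2: "ends2 VH EH x y = f ` ?P" unfolding fP by (rule ends2_eq[OF hsH(1) dist xE' yE'])
  have eT2: "ends2 VH TH x y = f ` ?P" unfolding fP by (rule ends2_eq[OF hsH(2) dist xT(1) yT(1)])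
  have V1: "?V1 = ?P \<union> VG" by auto
  interpret M: matching ?V1 ?V2 ?P f
  proof
    show "?V1 \<inter> ?V2 = {}" using p(2) dj by auto
    show "inj_on f ?P" using dist f by (auto simp: inj_on_def)
    have "ends2 VH EH x y \<subseteq> ?V2" by (auto simp: ends2_def)
    then show "f ` ?P \<subseteq> ?V2" using eE2 by simp
  qed auto
  have pole1: "pole ?V1 ?E1 ?P"
    using pole_subdivide4[OF cubG cycG nsG eE(1,2) w(1) eE(3,4) w(2) vV(3), of p1 p2 q1 q2] vT'(2) p
    unfolding V1 subdiv2_def by auto
  have xyE: "{x, y} \<in> EH" using xy(1) hsH(3) by auto
  note pole2 = pole_del2[OF cubH cycH nsH xyE, unfolded eE2]
  have cP: "card ?P = 4" using p(1) by simp
  let ?G = "M.glue ?E1 ?E2 ?P" let ?T = "M.glue ?T1 ?T2 ?P" let ?V = "?V1 \<union> ?V2"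
  have ind: "{f a, f b} \<notin> ?E2" if "a \<in> ?P" "b \<in> ?P" for a b
    using pole2(2) that by blast
  note gp = M.glue_poles[OF pole1 pole2(1) cP ind]
  have "\<not> three_edge_colourable ?G"
  proof
    assume col: "three_edge_colourable ?G"
    obtain c g k1 k2 where c: "\<And>z. z \<in> ?V1 \<Longrightarrow> c ` inc ?E1 z \<union> g z = {..<3 :: nat}"
      and g: "g p1 = {k1}" "g p2 = {k1}" "g q1 = {k2}" "g q2 = {k2}" "\<And>z. z \<notin> ?P \<Longrightarrow> g z = {}"
      using M.glue_colouring_left[OF sE1 cubH ncH xE' yE' dist refl refl p(1) f gp(1) col] by blast
    have g0: "g z = {}" if "z \<in> VG" for z
    proof -
      have "z \<notin> ?P" using that p(2) by auto
      then show ?thesis by (rule g(5))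
    qed
    \<comment> \<open>The expansions are undone in reverse order, first at \<open>v'\<close>;
      meanwhile \<open>g\<close> keeps the colours dangling at \<open>p1\<close> and
      \<open>p2\<close> for the second step.\<close>
    have dm: "deg ?Em v' = 3" using subdiv2_deg(1)[OF mE vV(2)] hist_deg(2)[OF cubG nsG hG vV(2)] by simp
    obtain c' :: "'a set \<Rightarrow> nat" where c': "\<And>z. z \<in> ?Vm \<Longrightarrow> c' ` inc ?Em z \<union> g z = {..<3}"
      using unsubdivide_colouring[OF sEm emE w(2) dm qn c[unfolded subdiv2_def[of ?Em]] g0[OF vV(2)] g(3,4)]
      by blast
    obtain c'' :: "'a set \<Rightarrow> nat" where c'': "\<And>z. z \<in> VG \<Longrightarrow> c'' ` inc EG z \<union> g z = {..<3}"
      using unsubdivide_colouring[OF hsG(1) eE(1,2) w(1) hist_deg(2)[OF cubG nsG hG vV(1)] pn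
          c'[unfolded subdiv2_def[of EG]] g0[OF vV(1)] g(1,2)] by blast
    then have "\<And>z. z \<in> VG \<Longrightarrow> c'' ` inc EG z = {..<3}" using g0 by auto
    then show False using colourableI[OF cubG] ncG by blast
  qed
  then have snark: "snark ?V ?G" using gp by (simp add: snark_def)
  have TE1: "?T1 \<subseteq> ?E1" using hsG(3) by (intro subdiv2_mono)
  have TE2: "?T2 \<subseteq> ?E2" using hsH(3) by (auto simp: del2_def)
  have cG: "(adj TG)\<^sup>*\<^sup>* a b" if "a \<in> VG" "b \<in> VG" for a b
    using hG that by (auto simp: hist_def spanning_tree_def)
  note connm = subdiv2_connected[OF mT cG]
  note conn1 = subdiv2_connected[OF nT connm]
  have conn2: "\<exists>w\<in>f ` ?P. (adj ?T2)\<^sup>*\<^sup>* w z" if "z \<in> ?V2" for z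
    using hist_del2_reach[OF cubH nsH hH xy(1) that] eT2 by simp
  \<comment> \<open>The subdivided tree has one edge fewer than vertices and the remnant of
    \<open>TH\<close> has four fewer; the four connecting edges restore the balance.\<close>
  have card: "card ?T1 + card ?T2 + card ?P + 1 = card ?V1 + card ?V2"
  proof -
    have "card ?T1 = card TG + 4" using subdiv2_card[OF mT] subdiv2_card[OF nT] by simp
    moreover have "card TG + 1 = card VG" by (rule hist_card[OF cubG nsG hG snark_nonempty[OF snG]])
    moreover have "card ?V1 = card VG + 4"
    proof -
      have "finite ?Vm" "card ?Vm = card VG + 2" using pn hsG(1) by (simp_all add: simple_graph_def)
      moreover have "q2 \<notin> insert q1 ?Vm" using qn by blast
      ultimately show ?thesis using qn(1) by simp
    qed
    moreover have "card ?T2 + 7 = card ?V2 + 3" using hist_del2_card(1)[OF cubH nsH hH xy(1)] xy by simp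
    ultimately show ?thesis using cP by linarith
  qed
  \<comment> \<open>The value 3 at a new vertex is 2 from the subdivided edge plus 1 for the
    connecting edge.\<close>
  have d1: "deg ?T1 z + of_bool (z \<in> ?P) = (if z \<in> VG then deg TG z else 3)" if "z \<in> ?V1" for z
  proof -
    consider "z \<in> VG" | "z = p1" | "z = p2" | "z = q1" | "z = q2" using \<open>z \<in> ?V1\<close> by auto
    then show ?thesis
    proof cases
      case 1
      then show ?thesis using subdiv2_deg(1)[OF nT, of z] subdiv2_deg(1)[OF mT, of z] p(2) by auto
    qed (use subdiv2_deg[OF nT] subdiv2_deg[OF mT] p(2) in auto)
  qed
  have d2: "deg ?T2 z + of_bool (z \<in> f ` ?P) = deg TH z" if "z \<in> ?V2" for z
    using hist_del2_deg[OF cubH nsH hH xy(1) that] eT2 by simp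
  have d1': "deg ?T1 z + of_bool (z \<in> ?P) = 1 \<or> deg ?T1 z + of_bool (z \<in> ?P) = 3" if "z \<in> ?V1" for z
    unfolding d1[OF that] using hist_deg(1)[OF cubG nsG hG, of z] by auto
  have d2': "deg ?T2 z + of_bool (z \<in> f ` ?P) = 1 \<or> deg ?T2 z + of_bool (z \<in> f ` ?P) = 3" if "z \<in> ?V2" for z
    unfolding d2[OF that] using hist_deg(1)[OF cubH nsH hH, of z] that by auto
  note gh = M.glue_hist[OF sE1 sE2 TE1 TE2 subset_refl conn1 conn2 card insert_not_empty d1' d2']
  have "{z \<in> ?V1. deg ?T1 z + of_bool (z \<in> ?P) = 1} = {z \<in> ?V1. (if z \<in> VG then deg TG z else 3) = 1}"
    by (rule Collect_eq_on) (rule d1)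
  also have "\<dots> = leaves VG TG" by (auto simp: leaves_def)
  finally have "{z \<in> ?V1. deg ?T1 z + of_bool (z \<in> ?P) = 1} = leaves VG TG" .
  moreover have "{z \<in> ?V2. deg ?T2 z + of_bool (z \<in> f ` ?P) = 1} = leaves VH TH"
  proof -
    have "{z \<in> ?V2. deg ?T2 z + of_bool (z \<in> f ` ?P) = 1} = {z \<in> ?V2. deg TH z = 1}"
      by (rule Collect_eq_on) (rule d2)
    also have "\<dots> = leaves VH TH" using xy by (auto simp: leaves_def)
    finally show ?thesis .
  qed
  ultimately have lv: "leaves ?V ?T = leaves VG TG \<union> leaves VH TH" using gh(3) by simp
  have "?E1 - ?T1 = EG - TG"
    using subdiv2_diff[OF nE subdiv2_mono[OF hsG(3)] emT] subdiv2_diff[OF mE hsG(3) eT] by simp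
  moreover have "?E2 - ?T2 = EH - TH"
  proof -
    have "x \<notin> e \<and> y \<notin> e" if "e \<in> EH - TH" for e using that xE yE by blast
    then show ?thesis by (auto simp: del2_def)
  qed
  ultimately have nt: "?G - ?T = (EG - TG) \<union> (EH - TH)" using gh(2) by (simp add: M.cross_def)
  have ldj: "leaves VG TG \<inter> leaves VH TH = {}" using dj by (auto simp: leaves_def)
  have lfin: "finite (leaves VG TG)" "finite (leaves VH TH)"
    using hsG(1) hsH(1) by (auto simp: leaves_def simple_graph_def)
  have "oc ?V ?G ?T = oc VG EG TG + oc VH EH TH"
    unfolding oc_def outer_cycles_classes lv nt
      classes_Un[OF nontree_simple[OF cubG nsG hG] nontree_simple[OF cubH nsH hH] ldj]
    by (rule oc_disjoint_Un[OF lfin ldj])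
  then show ?thesis using snark gh(1) by blast
qed

text \<open>Only the connecting edges that replace those at \<open>y\<close> join the tree. The two
  that replace those at \<open>x\<close> keep \<open>c\<close>, \<open>d\<close>, \<open>r\<close>
  and \<open>s\<close> leaves and link the two opened outer cycles into one.\<close>

lemma glue_at_outer_cycles:
  fixes VG VH :: "'a set"
  assumes snG: "snark VG EG" and hG: "hist VG EG TG" and snH: "snark VH EH" and hH: "hist VH EH TH"
    and dj: "VG \<inter> VH = {}" and p: "p1 \<noteq> p2" "{p1, p2} \<inter> (VG \<union> VH) = {}"
    and k: "k \<in># oc VG EG TG" and l: "l \<in># oc VH EH TH"
  shows "\<exists>(V' :: 'a set) E' T'. snark V' E' \<and> hist V' E' T' \<and>
    oc V' E' T' = oc VG EG TG + oc VH EH TH - {#k, l#} + {#k + l - 1#}"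
proof -
  have cubG: "cubic VG EG" and cycG: "cyc_4_edge_connected VG EG" and nsG: "no_short_cycle EG"
    and ncG: "\<not> three_edge_colourable EG" using snG by (auto simp: snark_def girth_ge_5_iff)
  have cubH: "cubic VH EH" and cycH: "cyc_4_edge_connected VH EH" and nsH: "no_short_cycle EH"
    and ncH: "\<not> three_edge_colourable EH" using snH by (auto simp: snark_def girth_ge_5_iff)
  note hsG = hist_simple[OF cubG nsG hG] and hsH = hist_simple[OF cubH nsH hH]
  let ?LG = "leaves VG TG" let ?FG = "EG - TG" let ?LH = "leaves VH TH" let ?FH = "EH - TH"
  note sFG = nontree_simple[OF cubG nsG hG] and sFH = nontree_simple[OF cubH nsH hH]
  have lfin: "finite ?LG" "finite ?LH" using sFG sFH by (auto simp: simple_graph_def)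
  have ldj: "?LG \<inter> ?LH = {}" using dj by (auto simp: leaves_def)
  have lfV: "?LG \<subseteq> VG" "?LH \<subseteq> VH" by (auto simp: leaves_def)
  obtain c where c: "c \<in> ?LG" "k = card (component ?FG c)"
    using k lfin(1) by (auto simp: oc_def outer_cycles_classes classes_component[OF sFG])
  obtain x where x: "x \<in> ?LH" "l = card (component ?FH x)"
    using l lfin(2) by (auto simp: oc_def outer_cycles_classes classes_component[OF sFH])
  have cV: "c \<in> VG" "deg TG c = 1" and xV: "x \<in> VH" "deg TH x = 1" using c x by (auto simp: leaves_def)
  \<comment> \<open>A leaf has two edges outside the tree; either of them leads to a neighbour
    \<open>d\<close> on the outer cycle of \<open>c\<close>.\<close>
  have "deg ?FG c = 2" using nontree_deg[OF cubG nsG hG cV(1)] cV(2) by simp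
  then obtain d where cd: "{c, d} \<in> ?FG"
    using deg_ge2_other[OF sFG, of c] by (metis order_refl)
  have cdV: "c \<noteq> d" "d \<in> ?LG" using simple_graph_edge[OF sFG cd] by auto
  obtain y where y: "inc TH x = {{x, y}}" using deg1_neighbour[OF hsH(2) xV(2)] .
  have xy: "{x, y} \<in> TH" using y by auto
  have yV: "y \<in> VH" "x \<noteq> y" using simple_graph_edge[OF hsH(2) xy] by auto
  have dy: "deg TH y = 3" by (rule leaf_parent[OF cubH nsH hH xV xy])
  have xyE: "{x, y} \<in> EH" using xy hsH(3) by auto
  obtain r s where xE: "inc EH x = {{x, y}, {x, r}, {x, s}}" "distinct [x, y, r, s]"
    using deg3_neighbours[OF hsH(1) hist_deg(2)[OF cubH nsH hH xV(1)] xyE] .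
  have yx: "{y, x} \<in> TH" using xy by (simp add: insert_commute)
  obtain t u where yT': "inc TH y = {{y, x}, {y, t}, {y, u}}" and yd: "distinct [y, x, t, u]"
    using deg3_neighbours[OF hsH(2) dy yx] .
  have "{y, x} = {x, y}" by auto
  note yT = yT'[unfolded this] yd
  have yEq: "inc EH y = inc TH y"
    using inc_eq_of_deg_eq[OF hsH(1,3)] dy hist_deg(2)[OF cubH nsH hH] yV by auto
  note yE = yEq[unfolded yT(1)]
  have dist: "distinct [x, y, r, s, t, u]" by (rule neighbours_distinct[OF nsH xE yE yT(2)])
  \<comment> \<open>The only tree edge at the leaf \<open>x\<close> goes to its parent, so the other
    two belong to its outer cycle.\<close>
  have xF: "inc ?FH x = {{x, r}, {x, s}}"
  proof -
    have "inc ?FH x = inc EH x - inc TH x" by auto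
    also have "\<dots> = {{x, r}, {x, s}}" unfolding xE(1) y using xE(2) by (auto simp: doubleton_eq_iff)
    finally show ?thesis .
  qed
  obtain v v' where v: "{v, v'} \<in> TG" "deg TG v = 3"
    using inner_edge[OF cubG nsG hG snark_nonempty[OF snG]] by metis
  have vV: "v \<in> VG" using simple_graph_edge[OF hsG(2) v(1)] by auto
  obtain w1 w2 where vT: "inc TG v = {{v, v'}, {v, w1}, {v, w2}}" "distinct [v, v', w1, w2]"
    using deg3_neighbours[OF hsG(2) v(2,1)] .
  have eT: "{v, w1} \<in> TG" "{v, w2} \<in> TG" using vT(1) by auto
  have eE: "{v, w1} \<in> EG" "{v, w2} \<in> EG" using eT hsG(3) by auto
  have w: "w1 \<noteq> w2" using vT by auto
  have vcd: "c \<noteq> v" "d \<noteq> v" using cV(2) cdV(2) v(2) by (auto simp: leaves_def)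
  have cdE: "{c, d} \<in> EG" using cd by simp

  let ?EG = "EG - {{c, d}}"
  let ?V1 = "insert p2 (insert p1 VG)"
  let ?E1 = "subdiv2 ?EG v w1 w2 p1 p2" let ?T1 = "subdiv2 TG v w1 w2 p1 p2"
  let ?V2 = "VH - {x, y}" let ?E2 = "del2 EH x y" let ?T2 = "del2 TH x y"
  \<comment> \<open>All four connecting edges start in \<open>?P\<close>, those of the tree only in
    \<open>?Q\<close>.\<close>
  let ?P = "{c, d, p1, p2}" let ?Q = "{p1, p2}"
  define f where "f = (\<lambda>z. if z = c then r else if z = d then s else if z = p1 then t else u)"
  have cdG: "c \<in> VG" "d \<in> VG" using cV cdV lfV by auto
  have pd: "distinct [c, d, p1, p2]" using p cdG cdV(1) by auto
  have f: "f c = r" "f d = s" "f p1 = t" "f p2 = u" using pd by (auto simp: f_def)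
  have pn: "p1 \<notin> VG" "p2 \<notin> VG" using p by auto
  have s0: "simple_graph VG ?EG" by (rule simple_graph_subset[OF hsG(1)]) auto
  have e0: "{v, w1} \<in> ?EG" "{v, w2} \<in> ?EG" using eE vcd by (auto simp: doubleton_eq_iff)
  note mE = s0 e0 w pn p(1)
  note mT = hsG(2) eT w pn p(1)
  note sE1 = subdiv2_simple[OF mE] and sT1 = subdiv2_simple[OF mT]
  note sE2 = simple_graph_del2[OF hsH(1), of x y]
  have fP: "f ` ?P = {r, s, t, u}" by (simp add: f)
  have fQ: "f ` ?Q = {t, u}" by (simp add: f)
  have eE2: "ends2 VH EH x y = f ` ?P" unfolding fP by (rule ends2_eq[OF hsH(1) dist xE(1) yE])
  \<comment> \<open>In the tree \<open>x\<close> has no neighbour but \<open>y\<close>, so only the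
    two other tree neighbours of \<open>y\<close> are left as ends.\<close>
  have eT2: "ends2 VH TH x y = f ` ?Q"
  proof -
    have "{z, x} \<in> TH \<longleftrightarrow> z = y" for z
      unfolding inc_member[OF y] using yV(2) by (auto simp: doubleton_eq_iff)
    moreover have "{z, y} \<in> TH \<longleftrightarrow> z \<in> {x, t, u}" for z
      unfolding inc_member[OF yT(1)] using dist by (auto simp: doubleton_eq_iff)
    moreover have "t \<in> VH" "u \<in> VH"
    proof -
      have "{y, t} \<in> TH" "{y, u} \<in> TH" using yT(1) by auto
      then show "t \<in> VH" "u \<in> VH" using simple_graph_edge(3)[OF hsH(2)] by auto
    qed
    ultimately show ?thesis unfolding fQ using dist by (auto simp: ends2_def)
  qed
  interpret M: matching ?V1 ?V2 ?P f
  proof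
    show "?V1 \<inter> ?V2 = {}" using p(2) dj by auto
    show "inj_on f ?P" using dist f by (auto simp: inj_on_def)
    show "?P \<subseteq> ?V1" using cdG by auto
    have "ends2 VH EH x y \<subseteq> ?V2" by (auto simp: ends2_def)
    then show "f ` ?P \<subseteq> ?V2" using eE2 by simp
  qed
  have Pc: "{p1, p2, c, d} = ?P" by auto
  have pole1: "pole ?V1 ?E1 ?P"
    using pole_subdivide_delete[OF cubG cycG nsG eE w cdE vcd pn p(1)] unfolding subdiv2_def Pc .
  note pole2 = pole_del2[OF cubH cycH nsH xyE, unfolded eE2]
  have cP: "card ?P = 4" using pd by simp
  let ?G = "M.glue ?E1 ?E2 ?P" let ?T = "M.glue ?T1 ?T2 ?Q" let ?V = "?V1 \<union> ?V2"
  have ind: "{f a, f b} \<notin> ?E2" if "a \<in> ?P" "b \<in> ?P" for a b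
    using pole2(2) that by blast
  note gp = M.glue_poles[OF pole1 pole2(1) cP ind]
  have "\<not> three_edge_colourable ?G"
  proof
    assume col: "three_edge_colourable ?G"
    obtain h g k1 k2 where h: "\<And>z. z \<in> ?V1 \<Longrightarrow> h ` inc ?E1 z \<union> g z = {..<3 :: nat}"
      and g: "g c = {k1}" "g d = {k1}" "g p1 = {k2}" "g p2 = {k2}" "\<And>z. z \<notin> ?P \<Longrightarrow> g z = {}"
      using M.glue_colouring_left[OF sE1 cubH ncH xE(1) yE dist refl refl pd f gp(1) col] by blast
    have gv: "g v = {}" using g(5)[of v] vcd vV pn by auto
    have "deg ?EG v = 3"
      using deg_remove[OF simple_graph_finite[OF hsG(1)] cdE, of v] vcd
        hist_deg(2)[OF cubG nsG hG vV] by simp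
    then obtain h' :: "'a set \<Rightarrow> nat" where h': "\<And>z. z \<in> VG \<Longrightarrow> h' ` inc ?EG z \<union> g z = {..<3}"
      using unsubdivide_colouring[OF s0 e0 w _ pn p(1) h[unfolded subdiv2_def] gv g(3,4)] by blast
    \<comment> \<open>The colours at \<open>p1\<close> and \<open>p2\<close> are dropped along with
      these vertices; what is left is the common colour \<open>k1\<close> for the edge
      \<open>cd\<close>.\<close>
    define g' where "g' z = (if z \<in> {c, d} then {k1} else {})" for z
    have "h' ` inc ?EG z \<union> g' z = {..<3}" if "z \<in> VG" for z
    proof -
      have "g z = g' z" using g(1,2) g(5)[of z] that pn by (auto simp: g'_def)
      then show ?thesis using h'[OF that] by simp
    qed
    moreover have "g' c = {k1}" "g' d = {k1}" "\<And>z. z \<notin> {c, d} \<Longrightarrow> g' z = {}" by (auto simp: g'_def)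
    ultimately obtain h'' :: "'a set \<Rightarrow> nat" where "\<And>z. z \<in> VG \<Longrightarrow> h'' ` inc EG z = {..<3}"
      using undelete_colouring[OF cdE, of VG h' g' k1] by blast
    then show False using colourableI[OF cubG] ncG by blast
  qed
  then have snark: "snark ?V ?G" using gp by (simp add: snark_def)
  have TE0: "TG \<subseteq> ?EG" using hsG(3) cd by auto
  have TE1: "?T1 \<subseteq> ?E1" using TE0 by (intro subdiv2_mono)
  have TE2: "?T2 \<subseteq> ?E2" using hsH(3) by (auto simp: del2_def)
  have cG: "(adj TG)\<^sup>*\<^sup>* a b" if "a \<in> VG" "b \<in> VG" for a b
    using hG that by (auto simp: hist_def spanning_tree_def)
  note conn1 = subdiv2_connected[OF mT cG]
  have conn2: "\<exists>w\<in>f ` ?Q. (adj ?T2)\<^sup>*\<^sup>* w z" if "z \<in> ?V2" for z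
    using hist_del2_reach[OF cubH nsH hH xy that] eT2 by simp
  \<comment> \<open>With a leaf and its parent removed, the remnant of \<open>TH\<close> has two
    edges fewer than vertices, and two connecting edges make up for it.\<close>
  have card: "card ?T1 + card ?T2 + card ?Q + 1 = card ?V1 + card ?V2"
  proof -
    have "card ?T1 = card TG + 2" using subdiv2_card[OF mT] by simp
    moreover have "card TG + 1 = card VG" by (rule hist_card[OF cubG nsG hG snark_nonempty[OF snG]])
    moreover have "card ?V1 = card VG + 2" using pn p(1) hsG(1) by (simp add: simple_graph_def)
    moreover have "card ?T2 + 5 = card ?V2 + 3"
      using hist_del2_card(1)[OF cubH nsH hH xy] dy xV(2) by simp
    moreover have "card ?Q = 2" using p(1) by simp
    ultimately show ?thesis by linarith
  qed
  have d1: "deg ?T1 z + of_bool (z \<in> ?Q) = (if z \<in> VG then deg TG z else 3)" if "z \<in> ?V1" for z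
  proof -
    consider "z \<in> VG" | "z = p1" | "z = p2" using \<open>z \<in> ?V1\<close> by auto
    then show ?thesis
    proof cases
      case 1
      then show ?thesis using subdiv2_deg(1)[OF mT, of z] p(2) by auto
    qed (use subdiv2_deg[OF mT] p(2) in auto)
  qed
  have d2: "deg ?T2 z + of_bool (z \<in> f ` ?Q) = deg TH z" if "z \<in> ?V2" for z
    using hist_del2_deg[OF cubH nsH hH xy that] eT2 by simp
  have d1': "deg ?T1 z + of_bool (z \<in> ?Q) = 1 \<or> deg ?T1 z + of_bool (z \<in> ?Q) = 3" if "z \<in> ?V1" for z
    unfolding d1[OF that] using hist_deg(1)[OF cubG nsG hG, of z] by auto
  have d2': "deg ?T2 z + of_bool (z \<in> f ` ?Q) = 1 \<or> deg ?T2 z + of_bool (z \<in> f ` ?Q) = 3" if "z \<in> ?V2" for z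
    unfolding d2[OF that] using hist_deg(1)[OF cubH nsH hH, of z] that by auto
  have QP: "?Q \<subseteq> ?P" by auto
  note gh = M.glue_hist[OF sE1 sE2 TE1 TE2 QP conn1 conn2 card insert_not_empty d1' d2']
  have "{z \<in> ?V1. deg ?T1 z + of_bool (z \<in> ?Q) = 1} = {z \<in> ?V1. (if z \<in> VG then deg TG z else 3) = 1}"
    by (rule Collect_eq_on) (rule d1)
  also have "\<dots> = ?LG" by (auto simp: leaves_def)
  finally have "{z \<in> ?V1. deg ?T1 z + of_bool (z \<in> ?Q) = 1} = ?LG" .
  moreover have "{z \<in> ?V2. deg ?T2 z + of_bool (z \<in> f ` ?Q) = 1} = ?LH - {x}"
  proof -
    have "{z \<in> ?V2. deg ?T2 z + of_bool (z \<in> f ` ?Q) = 1} = {z \<in> ?V2. deg TH z = 1}"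
      by (rule Collect_eq_on) (rule d2)
    also have "\<dots> = ?LH - {x}" using dy by (auto simp: leaves_def)
    finally show ?thesis .
  qed
  moreover have "x \<notin> ?LG" using x(1) ldj by auto
  ultimately have lv: "leaves ?V ?T = ?LG \<union> ?LH - {x}" using gh(3) by auto
  have "?E1 - ?T1 = ?FG - {{c, d}}"
    using subdiv2_diff[OF mE TE0 eT] by auto
  moreover have "?E2 - ?T2 = ?FH - {{x, r}, {x, s}}"
  proof -
    have "y \<notin> e" if "e \<in> ?FH" for e using that yEq by blast
    moreover have "x \<in> e \<longleftrightarrow> e \<in> {{x, r}, {x, s}}" if "e \<in> ?FH" for e using that xF by auto
    ultimately show ?thesis by (auto simp: del2_def)
  qed
  moreover have "M.cross (?P - ?Q) = {{c, r}, {d, s}}"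
  proof -
    have "?P - ?Q = {c, d}" using pd by auto
    then show ?thesis by (simp add: M.cross_def f)
  qed
  ultimately have nt: "?G - ?T = (?FG - {{c, d}}) \<union> (?FH - {{x, r}, {x, s}}) \<union> {{c, r}, {d, s}}"
    using gh(2) by simp
  have ev: "even (deg ?FH z)" if "z \<in> ?LH" for z
    using nontree_deg[OF cubH nsH hH, of z] that by (auto simp: leaves_def)
  have rs: "r \<noteq> s" using dist by simp
  let ?K = "component ?FG c" let ?M = "component ?FH x" let ?D = "?K \<union> ?M - {x}"
  let ?A = "classes ?LG ?FG" let ?B = "classes ?LH ?FH"
  have cl: "classes (?LG \<union> ?LH - {x}) (?G - ?T) = insert ?D ((?A - {?K}) \<union> (?B - {?M}))"
    unfolding nt by (rule classes_merge[OF sFG sFH ldj ev xF rs cd])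
  have KA: "?K \<in> ?A" and MB: "?M \<in> ?B"
    using c(1) x(1) by (auto simp: classes_component[OF sFG] classes_component[OF sFH])
  have finA: "finite ?A" "finite ?B" using lfin by (auto intro: classes_finite)
  have KL: "?K \<subseteq> ?LG" "?M \<subseteq> ?LH" using component_subset[OF sFG c(1)] component_subset[OF sFH x(1)] by auto
  have cD: "c \<in> ?D" using component_self[of c ?FG] c(1) x(1) ldj by auto
  \<comment> \<open>The multiset counts each set once, so the merged cycle must not coincide with
    one of the old ones. It contains \<open>c\<close>, whose old class is the removed
    \<open>?K\<close>.\<close>
  have Dn: "?D \<notin> (?A - {?K}) \<union> (?B - {?M})"
  proof
    assume "?D \<in> (?A - {?K}) \<union> (?B - {?M})"
    then show False
    proof
      assume D: "?D \<in> ?A - {?K}"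
      then obtain z where "?D = component ?FG z" by (auto simp: classes_component[OF sFG])
      then have "component ?FG c = ?D" using component_eq[of c ?FG z] cD by simp
      then show False using D by simp
    next
      assume "?D \<in> ?B - {?M}"
      then have "?D \<subseteq> ?LH" by (auto simp: classes_def)
      then show False using cD c(1) ldj by auto
    qed
  qed
  \<comment> \<open>The two components are disjoint, and the union loses only the deleted leaf
    \<open>x\<close>.\<close>
  have "card ?D = k + l - 1"
  proof -
    have "finite ?K" "finite ?M" using KL lfin finite_subset by blast+
    moreover have "?K \<inter> ?M = {}" using KL ldj by blast
    ultimately have "card (?K \<union> ?M) = k + l" using c(2) x(2) by (simp add: card_Un_disjoint)
    moreover have "x \<in> ?K \<union> ?M" using component_self[of x ?FH] by simp
    ultimately show ?thesis by (simp add: card_Diff_singleton)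
  qed
  moreover have "(?A - {?K}) \<inter> (?B - {?M}) = {}" using classes_disjoint[OF ldj] by blast
  ultimately have "oc ?V ?G ?T = {#k + l - 1#} +
      (image_mset card (mset_set (?A - {?K})) + image_mset card (mset_set (?B - {?M})))"
    unfolding oc_def outer_cycles_classes lv cl using Dn finA by (simp add: mset_set_Union)
  moreover have "oc VG EG TG = add_mset k (image_mset card (mset_set (?A - {?K})))"
    unfolding oc_def outer_cycles_classes using mset_set.remove[OF finA(1) KA] c(2) by simp
  moreover have "oc VH EH TH = add_mset l (image_mset card (mset_set (?B - {?M})))"
    unfolding oc_def outer_cycles_classes using mset_set.remove[OF finA(2) MB] x(2) by simp
  ultimately have "oc ?V ?G ?T = oc VG EG TG + oc VH EH TH - {#k, l#} + {#k + l - 1#}" by simp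
  then show ?thesis using snark gh(1) by blast
qed

theorem theorem2:
  fixes VG :: "'a set" and EG TG :: "'a set set"
    and VH :: "'b set" and EH TH :: "'b set set"
  assumes "snark VG EG" and "hist VG EG TG"
    and "snark VH EH" and "hist VH EH TH"
  shows "(\<exists>(V' :: nat set) E' T'. snark V' E' \<and> hist V' E' T' \<and>
            oc V' E' T' = oc VG EG TG + oc VH EH TH)
       \<and> (\<forall>k l. k \<in># oc VG EG TG \<longrightarrow> l \<in># oc VH EH TH \<longrightarrow>
            (\<exists>(V' :: nat set) E' T'. snark V' E' \<and> hist V' E' T' \<and>
              oc V' E' T' = oc VG EG TG + oc VH EH TH - {#k, l#} + {#k + l - 1#}))"
proof -
  have fin: "finite VG" "finite VH"
    using assms by (auto simp: snark_def cubic_def simple_graph_def)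
  \<comment> \<open>The two vertex types may differ, so both graphs are copied into the natural
    numbers: \<open>VG\<close> to an initial segment and \<open>VH\<close> directly behind it. All
    numbers from \<open>m + n\<close> on stay free for the new vertices.\<close>
  obtain f :: "'a \<Rightarrow> nat" and m where f: "f ` VG = {i. i < m}" "inj_on f VG"
    using finite_imp_inj_to_nat_seg[OF fin(1)] by blast
  obtain g0 :: "'b \<Rightarrow> nat" and n where g0: "g0 ` VH = {i. i < n}" "inj_on g0 VH"
    using finite_imp_inj_to_nat_seg[OF fin(2)] by blast
  define g where "g z = m + g0 z" for z
  have g: "inj_on g VH" using g0(2) by (auto simp: g_def inj_on_def)
  have gV: "i \<in> g ` VH \<longleftrightarrow> m \<le> i \<and> i < m + n" for i
  proof -
    have "g ` VH = (+) m ` (g0 ` VH)" by (simp add: g_def image_image)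
    then show ?thesis unfolding g0(1) by (auto simp: image_iff intro!: exI[of _ "i - m"])
  qed
  have "i \<notin> g ` VH" if "i \<in> f ` VG" for i using that gV[of i] unfolding f(1) by simp
  then have dj: "f ` VG \<inter> g ` VH = {}" by blast
  let ?EG = "(`) f ` EG" let ?TG = "(`) f ` TG" let ?EH = "(`) g ` EH" let ?TH = "(`) g ` TH"
  have cG: "cubic VG EG" "no_short_cycle EG" "simple_graph VG EG"
    and cH: "cubic VH EH" "no_short_cycle EH" "simple_graph VH EH"
    using assms by (auto simp: snark_def girth_ge_5_iff cubic_def)
  note G = relabel_snark[OF f(2) assms(1)]
    relabel_hist[OF f(2) cG(3) snark_nonempty[OF assms(1)] assms(2)]
  note H = relabel_snark[OF g assms(3)]
    relabel_hist[OF g cH(3) snark_nonempty[OF assms(3)] assms(4)]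
  note oc = relabel_oc[OF f(2) cG(1,2) assms(2)] relabel_oc[OF g cH(1,2) assms(4)]
  let ?p = "m + n"
  have new: "{?p, ?p + 1, ?p + 2, ?p + 3} \<inter> (f ` VG \<union> g ` VH) = {}" using gV unfolding f(1) by simp
  have "\<exists>(V' :: nat set) E' T'. snark V' E' \<and> hist V' E' T' \<and>
      oc V' E' T' = oc VG EG TG + oc VH EH TH"
    using glue_at_inner_edges[OF G H dj _ new] unfolding oc by simp
  moreover have "\<exists>(V' :: nat set) E' T'. snark V' E' \<and> hist V' E' T' \<and>
      oc V' E' T' = oc VG EG TG + oc VH EH TH - {#k, l#} + {#k + l - 1#}"
    if "k \<in># oc VG EG TG" "l \<in># oc VH EH TH" for k l
    using glue_at_outer_cycles[OF G H dj, of ?p "?p + 1" k l] new that unfolding oc by simp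
  ultimately show ?thesis by blast
qed

end
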